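(* Consider the stochastic control system, attack model, stealthiness notion and performance metric described in the context, let $\epsilon>0$, and suppose that the linear time-invariant system $(A,B,C)$ is right invertible. Then the attack $\mathcal A_1$ defined in the context is $\epsilon$-stealthy and, with this attack, $$\tilde P_W=\mathrm{tr}(PW)+N_y\Big(\bar\delta\Big(\frac{\epsilon}{N_y}\Big)-1\Big),$$ where $W=C^T\Sigma_z^{-1}C$ and $\bar\delta:[0,\infty)\to[1,\infty)$ is the function defined by $\bar\delta(x)=2x+1+\log\bar\delta(x)$.
   Context: Notation. $x_i^j$ denotes the sequence $\{x_n\}_{n=i}^j$. $\log$ is the natural logarithm, and $\bar\delta(x)$ is the solution in $[1,\infty)$ of its implicit equation. Plant. $x_{k+1}=Ax_k+Bu_k+w_k$, $y_k=Cx_k+v_k$, $k\ge1$, with $x_k\in\mathbb R^{N_x}$, $u_k\in\mathbb R^{N_u}$, $y_k\in\mathbb R^{N_y}$. The noises $w_1^\infty$, $v_1^\infty$ are independent i.i.d. sequences, $w_k\sim\mathcal N(0,\Sigma_w)$, $v_k\sim\mathcal N(0,\Sigma_v)$, with $\Sigma_w,\Sigma_v$ positive definite. The realization $(A,B,C)$ has no invariant zeros (in particular it is controllable and observable). The control input $u_k$ is calculated by the controller using an arbitrary control law. Kalman filter. The controller uses the filter $\hat x_{k+1}=A\hat x_k+K(y_k-C\hat x_k)+Bu_k$, $\hat x_1=\mathbb E[x_1]=0$, in steady state: $\mathbb E[x_1x_1^T]=P$, where $P$ is the unique solution of $P=APA^T-APC^T(CPC^T+\Sigma_v)^{-1}CPA^T+\Sigma_w$,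 and $K=APC^T(CPC^T+\Sigma_v)^{-1}$. The nominal innovations $z_k=y_k-C\hat x_k$ are i.i.d. $\mathcal N(0,\Sigma_z)$, $\Sigma_z=CPC^T+\Sigma_v$ (positive definite). Attack. An attacker replaces $u_1^\infty$ by a sequence $\tilde u_1^\infty$, so that the system becomes $\tilde x_{k+1}=A\tilde x_k+B\tilde u_k+w_k$, $\tilde y_k=C\tilde x_k+v_k$ (with $\tilde x_1=x_1$). The attacker knows $A,B,C,\Sigma_w,\Sigma_v$ and has information pattern $\mathcal I_k$ satisfying: $u_k\in\mathcal I_k$ for all $k$, and the attacker does not know the noise vectors at any time; $\mathcal I_k\subseteq\mathcal I_{k+1}$; $\mathcal I_k$ is independent of $w_k^\infty$ and $v_{k+1}^\infty$. Under attack the controller (unaware of it) runs the filter $\hat{\tilde x}_{k+1}=A\hat{\tilde x}_k+K\tilde z_k+Bu_k$, $\hat{\tilde x}_1=0$, with innovation $\tilde z_k=\tilde y_k-C\hat{\tilde x}_k$. Right invertibility. A system $(A,B,C)$ with $N_y\times N_u$ transfer function matrix $G(\mathcal Z)$ is right invertible if there is an $N_u\times N_y$ transfer function matrix $G_{RI}(\mathcal Z)$ with $G(\mathcal Z)G_{RI}(\mathcal Z)=I_{N_y}$. When $(A,B,C)$ is right invertible, so is $(A-KC,B,C)$; let $G'_{RI}$ be a right inverse of $(A-KC,B,C)$. Attack $\mathcal A_1$. (1) Generate a sequence $\zeta_1^\infty$ of i.i.d. vectors $\zeta_k\sim\mathcal N\big(0,(\bar\delta(\epsilon/N_y)-1)\Sigma_z\big)$,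 independent of the attacker's information pattern $\mathcal I_k$ and of $x_1,w_1^\infty,v_1^\infty$. (2) Generate $\phi_1^\infty$ as the output of the system $G'_{RI}$ with input $\zeta_1^\infty$. (3) Set $\tilde u_k=u_k+\phi_k$. Stealthiness. The controller tests, from the received measurements, $H_0$: no attack (it receives $y_1^k$) versus $H_1$: attack (it receives $\tilde y_1^k$). For a given detector (an arbitrary decision rule), $p_k^F$ is the probability of false alarm (deciding $H_1$ when $H_0$ is true) and $p_k^D$ the probability of correct detection (deciding $H_1$ when $H_1$ is true), for the decision based on the first $k$ measurements. Given $\epsilon>0$ and $0<\delta<1$, an attack is $\epsilon$-stealthy if for any detector for which $0<1-p_k^D\le\delta$ for all times $k$, it holds that $\limsup_{k\to\infty}-\frac1k\log p_k^F\le\epsilon$. Performance metric. $\tilde P_k=\mathbb E[(\hat{\tilde x}_k-\tilde x_k)(\hat{\tilde x}_k-\tilde x_k)^T]$ and $\tilde P_W=\limsup_{k\to\infty}\frac1k\sum_{n=1}^k\mathrm{tr}(\tilde P_nW)$. *)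

theory Defs
  imports
    "HOL-Probability.Probability"
    "HOL-Computational_Algebra.Computational_Algebra"
begin

definition pos_def :: "real^'n^'n \<Rightarrow> bool" where
  "pos_def S \<longleftrightarrow> transpose S = S \<and> (\<forall>x. x \<noteq> 0 \<longrightarrow> 0 < x \<bullet> (S *v x))"

definition pos_semidef :: "real^'n^'n \<Rightarrow> bool" where
  "pos_semidef S \<longleftrightarrow> transpose S = S \<and> (\<forall>x. 0 \<le> x \<bullet> (S *v x))"

definition outer :: "real^'n \<Rightarrow> real^'m \<Rightarrow> real^'m^'n" where
  "outer x y = (\<chi> i j. x $ i * y $ j)"

definition mvn_density :: "real^'n^'n \<Rightarrow> real^'n \<Rightarrow> real" where
  "mvn_density S x =
     exp (- (x \<bullet> (matrix_inv S *v x)) / 2) / sqrt ((2 * pi) ^ CARD('n) * det S)"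

text \<open>Centred Gaussian law; the covariance is meant to be positive definite.\<close>

definition gaussian :: "'a measure \<Rightarrow> ('a \<Rightarrow> real^'n) \<Rightarrow> real^'n^'n \<Rightarrow> bool" where
  "gaussian M X S \<longleftrightarrow> distributed M lborel X (\<lambda>x. ennreal (mvn_density S x))"

text \<open>Stacking the matrices \<open>B, A B, \<dots>, A^(n-1) B\<close> side by side gives the controllability matrix,
  stacking \<open>C, C A, \<dots>, C A^(n-1)\<close> on top of each other the observability matrix. Powers are
  iterated matrix products, because \<open>^\<close> on this type is componentwise.\<close>

definition controllable :: "real^'n^'n \<Rightarrow> real^'m^'n \<Rightarrow> bool" where
  "controllable A B \<longleftrightarrow>
     dim (\<Union>k<CARD('n). columns (((\<lambda>X. A ** X) ^^ k) B)) = CARD('n)"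

definition observable :: "real^'n^'n \<Rightarrow> real^'n^'p \<Rightarrow> bool" where
  "observable A C \<longleftrightarrow>
     dim (\<Union>k<CARD('n). rows (((\<lambda>X. X ** A) ^^ k) C)) = CARD('n)"

text \<open>The block matrix with rows \<open>[z I - A, -B]\<close> and \<open>[C, 0]\<close>.\<close>

definition rosenbrock ::
  "real^'n^'n \<Rightarrow> real^'m^'n \<Rightarrow> real^'n^'p \<Rightarrow> complex \<Rightarrow> complex^('n + 'm)^('n + 'p)" where
  "rosenbrock A B C z = (\<chi> i j.
     case i of
       Inl a \<Rightarrow> (case j of
           Inl b \<Rightarrow> (if a = b then z else 0) - complex_of_real (A $ a $ b)
         | Inr b \<Rightarrow> - complex_of_real (B $ a $ b))
     | Inr a \<Rightarrow> (case j of
           Inl b \<Rightarrow> complex_of_real (C $ a $ b)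
         | Inr b \<Rightarrow> 0))"

definition normal_rank :: "real^'n^'n \<Rightarrow> real^'m^'n \<Rightarrow> real^'n^'p \<Rightarrow> nat" where
  "normal_rank A B C = Max (range (\<lambda>z. rank (rosenbrock A B C z)))"

definition invariant_zero ::
  "real^'n^'n \<Rightarrow> real^'m^'n \<Rightarrow> real^'n^'p \<Rightarrow> complex \<Rightarrow> bool" where
  "invariant_zero A B C z \<longleftrightarrow> rank (rosenbrock A B C z) < normal_rank A B C"

abbreviation const_fract :: "real \<Rightarrow> real poly fract" where
  "const_fract c \<equiv> to_fract [:c:]"

definition transfer_function ::
  "real^'n^'n \<Rightarrow> real^'m^'n \<Rightarrow> real^'n^'p \<Rightarrow> (real poly fract)^'m^'p" where
  "transfer_function A B C =
     map_matrix const_fract C **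
     matrix_inv (mat (to_fract [:0, 1:]) - map_matrix const_fract A) **
     map_matrix const_fract B"

definition right_inverse ::
  "real^'n^'n \<Rightarrow> real^'m^'n \<Rightarrow> real^'n^'p \<Rightarrow> (real poly fract)^'p^'m \<Rightarrow> bool" where
  "right_inverse A B C G \<longleftrightarrow> transfer_function A B C ** G = mat 1"

definition right_invertible :: "real^'n^'n \<Rightarrow> real^'m^'n \<Rightarrow> real^'n^'p \<Rightarrow> bool" where
  "right_invertible A B C \<longleftrightarrow> (\<exists>G. right_inverse A B C G)"

text \<open>The Laurent expansion at infinity of a rational function \<open>r\<close>. The formal variable is the
  unit delay \<open>1 / z\<close>, so the \<open>n\<close>-th coefficient is the impulse response of \<open>r\<close> at time \<open>n\<close>; it
  may be nonzero for finitely many negative \<open>n\<close>, since \<open>r\<close> need not be proper.\<close>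

text \<open>\<open>p(z) = z^(degree p) * q(1/z)\<close>, where \<open>q = reflect_poly p\<close>.\<close>

definition poly_at_infinity :: "real poly \<Rightarrow> real fls" where
  "poly_at_infinity p = fls_shift (int (degree p)) (fps_to_fls (fps_of_poly (reflect_poly p)))"

lemma poly_at_infinity_mult:
  "poly_at_infinity (p * q) = poly_at_infinity p * poly_at_infinity q"
proof (cases "p = 0 \<or> q = 0")
  case True
  then show ?thesis by (auto simp: poly_at_infinity_def)
next
  case False
  then show ?thesis
    by (simp add: poly_at_infinity_def degree_mult_eq reflect_poly_mult fps_of_poly_mult
        fls_times_fps_to_fls fls_shifted_times_simps add.commute)
qed

lemma poly_at_infinity_eq_0_iff: "poly_at_infinity p = 0 \<longleftrightarrow> p = 0"
  by (simp add: poly_at_infinity_def fls_shift_eq0_iff)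

definition impulse_response :: "real poly fract \<Rightarrow> real fls" where
  "impulse_response r =
     (THE f. \<exists>p q. q \<noteq> 0 \<and> r = Fract p q \<and> f = poly_at_infinity p / poly_at_infinity q)"

lemma impulse_response_Fract:
  assumes "q \<noteq> 0"
  shows "impulse_response (Fract p q) = poly_at_infinity p / poly_at_infinity q"
  unfolding impulse_response_def
proof (rule the_equality)
  fix f
  assume "\<exists>p' q'. q' \<noteq> 0 \<and> Fract p q = Fract p' q' \<and>
            f = poly_at_infinity p' / poly_at_infinity q'"
  with assms show "f = poly_at_infinity p / poly_at_infinity q"
    by (auto simp: eq_fract poly_at_infinity_eq_0_iff frac_eq_eq
        simp flip: poly_at_infinity_mult)
qed (use assms in blast)

text \<open>Output at time \<open>k\<close> of the system with transfer matrix \<open>G\<close> and zero initial conditions, for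
  an input \<open>f\<close> that starts at time 1. All nonzero terms of the convolution satisfy
  \<open>k - n \<ge> fls_subdegree\<close>, so the sum is the full convolution. For an improper \<open>G\<close> it involves
  finitely many future inputs.\<close>

definition system_output ::
  "(real poly fract)^'p^'m \<Rightarrow> (nat \<Rightarrow> real^'p) \<Rightarrow> nat \<Rightarrow> real^'m" where
  "system_output G f k = (\<chi> i. \<Sum>j\<in>UNIV.
     \<Sum>n = 1..nat (int k - fls_subdegree (impulse_response (G $ i $ j))).
       fls_nth (impulse_response (G $ i $ j)) (int k - int n) * f n $ j)"

definition innovation_cov :: "real^'n^'p \<Rightarrow> real^'p^'p \<Rightarrow> real^'n^'n \<Rightarrow> real^'p^'p" where
  "innovation_cov C Sv P = C ** P ** transpose C + Sv"

definition kalman_gain ::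
  "real^'n^'n \<Rightarrow> real^'n^'p \<Rightarrow> real^'p^'p \<Rightarrow> real^'n^'n \<Rightarrow> real^'p^'n" where
  "kalman_gain A C Sv P = A ** P ** transpose C ** matrix_inv (innovation_cov C Sv P)"

definition riccati ::
  "real^'n^'n \<Rightarrow> real^'n^'p \<Rightarrow> real^'n^'n \<Rightarrow> real^'p^'p \<Rightarrow> real^'n^'n \<Rightarrow> bool" where
  "riccati A C Sw Sv P \<longleftrightarrow>
     P = A ** P ** transpose A
         - A ** P ** transpose C ** matrix_inv (C ** P ** transpose C + Sv)
             ** C ** P ** transpose A
         + Sw"

text \<open>A control law maps a private random seed of the controller and the received measurements
  \<open>y 1, \<dots>, y k\<close> to the input at time \<open>k\<close>.\<close>

definition control_law ::
  "'s measure \<Rightarrow> (nat \<Rightarrow> 's \<Rightarrow> (nat \<Rightarrow> real^'p) \<Rightarrow> real^'m) \<Rightarrow> bool" where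
  "control_law S \<mu> \<longleftrightarrow>
     (\<forall>k\<ge>1. (\<lambda>(s, y). \<mu> k s y) \<in> borel_measurable (S \<Otimes>\<^sub>M PiM {1..k} (\<lambda>_. borel)))"

text \<open>Plant with state \<open>x\<close>, actually applied input \<open>ua\<close> and output \<open>y\<close>, together with the controller:
  its input \<open>u\<close>, its state estimate \<open>xh\<close> and its innovation \<open>z\<close>. The controller only sees \<open>y\<close>, and
  its filter is driven by \<open>u\<close> rather than \<open>ua\<close>. Time starts at 1; values at time 0 are irrelevant.\<close>

definition closed_loop ::
  "'a measure \<Rightarrow> real^'n^'n \<Rightarrow> real^'m^'n \<Rightarrow> real^'n^'p \<Rightarrow> real^'p^'n \<Rightarrow>
   (nat \<Rightarrow> 's \<Rightarrow> (nat \<Rightarrow> real^'p) \<Rightarrow> real^'m) \<Rightarrow> ('a \<Rightarrow> 's) \<Rightarrow>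
   ('a \<Rightarrow> real^'n) \<Rightarrow> (nat \<Rightarrow> 'a \<Rightarrow> real^'n) \<Rightarrow> (nat \<Rightarrow> 'a \<Rightarrow> real^'p) \<Rightarrow>
   (nat \<Rightarrow> 'a \<Rightarrow> real^'n) \<Rightarrow> (nat \<Rightarrow> 'a \<Rightarrow> real^'m) \<Rightarrow> (nat \<Rightarrow> 'a \<Rightarrow> real^'m) \<Rightarrow>
   (nat \<Rightarrow> 'a \<Rightarrow> real^'p) \<Rightarrow> (nat \<Rightarrow> 'a \<Rightarrow> real^'n) \<Rightarrow> (nat \<Rightarrow> 'a \<Rightarrow> real^'p) \<Rightarrow> bool" where
  "closed_loop M A B C K \<mu> \<rho> x1 w v x u ua y xh z \<longleftrightarrow>
     (\<forall>\<omega>\<in>space M.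
        x 1 \<omega> = x1 \<omega> \<and> xh 1 \<omega> = 0 \<and>
        (\<forall>k\<ge>1.
           x (k + 1) \<omega> = A *v x k \<omega> + B *v ua k \<omega> + w k \<omega> \<and>
           y k \<omega> = C *v x k \<omega> + v k \<omega> \<and>
           u k \<omega> = \<mu> k (\<rho> \<omega>) (\<lambda>n\<in>{1..k}. y n \<omega>) \<and>
           z k \<omega> = y k \<omega> - C *v xh k \<omega> \<and>
           xh (k + 1) \<omega> = A *v xh k \<omega> + K *v z k \<omega> + B *v u k \<omega>))"

datatype source = Initial | Process nat | Sensor nat | Attacker nat | Controller

definition source_sets ::
  "'a measure \<Rightarrow> 's measure \<Rightarrow> ('a \<Rightarrow> real^'n) \<Rightarrow> (nat \<Rightarrow> 'a \<Rightarrow> real^'n) \<Rightarrow>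
   (nat \<Rightarrow> 'a \<Rightarrow> real^'p) \<Rightarrow> (nat \<Rightarrow> 'a \<Rightarrow> real^'p) \<Rightarrow> ('a \<Rightarrow> 's) \<Rightarrow> source \<Rightarrow> 'a set set" where
  "source_sets M S x1 w v \<zeta> \<rho> s = (case s of
      Initial \<Rightarrow> sets (vimage_algebra (space M) x1 borel)
    | Process k \<Rightarrow> sets (vimage_algebra (space M) (w k) borel)
    | Sensor k \<Rightarrow> sets (vimage_algebra (space M) (v k) borel)
    | Attacker k \<Rightarrow> sets (vimage_algebra (space M) (\<zeta> k) borel)
    | Controller \<Rightarrow> sets (vimage_algebra (space M) \<rho> S))"

definition independent_sources ::
  "'a measure \<Rightarrow> 's measure \<Rightarrow> ('a \<Rightarrow> real^'n) \<Rightarrow> (nat \<Rightarrow> 'a \<Rightarrow> real^'n) \<Rightarrow>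
   (nat \<Rightarrow> 'a \<Rightarrow> real^'p) \<Rightarrow> (nat \<Rightarrow> 'a \<Rightarrow> real^'p) \<Rightarrow> ('a \<Rightarrow> 's) \<Rightarrow> bool" where
  "independent_sources M S x1 w v \<zeta> \<rho> \<longleftrightarrow>
     prob_space.indep_sets M (source_sets M S x1 w v \<zeta> \<rho>)
       ({Initial, Controller} \<union> Process ` {1..} \<union> Sensor ` {1..} \<union> Attacker ` {1..})"

text \<open>The \<sigma>-algebra generated by \<open>w k, w (k + 1), \<dots>\<close> and \<open>v (k + 1), v (k + 2), \<dots>\<close>.\<close>

definition future_noise ::
  "'a measure \<Rightarrow> (nat \<Rightarrow> 'a \<Rightarrow> real^'n) \<Rightarrow> (nat \<Rightarrow> 'a \<Rightarrow> real^'p) \<Rightarrow> nat \<Rightarrow> 'a set set" where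
  "future_noise M w v k = sigma_sets (space M)
     ((\<Union>n\<in>{k..}. sets (vimage_algebra (space M) (w n) borel)) \<union>
      (\<Union>n\<in>{k + 1..}. sets (vimage_algebra (space M) (v n) borel)))"

definition information_pattern ::
  "'a measure \<Rightarrow> (nat \<Rightarrow> 'a \<Rightarrow> real^'n) \<Rightarrow> (nat \<Rightarrow> 'a \<Rightarrow> real^'p) \<Rightarrow>
   (nat \<Rightarrow> 'a \<Rightarrow> real^'m) \<Rightarrow> (nat \<Rightarrow> 'a measure) \<Rightarrow> bool" where
  "information_pattern M w v u \<I> \<longleftrightarrow>
     (\<forall>k\<ge>1.
        subalgebra M (\<I> k) \<and>
        u k \<in> borel_measurable (\<I> k) \<and>
        (\<forall>n\<ge>1. w n \<notin> borel_measurable (\<I> k) \<and> v n \<notin> borel_measurable (\<I> k)) \<and>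
        sets (\<I> k) \<subseteq> sets (\<I> (k + 1)) \<and>
        prob_space.indep_set M (sets (\<I> k)) (future_noise M w v k))"

text \<open>A possibly randomized detector: \<open>D k\<close> maps the first \<open>k\<close> measurements to the probability of
  deciding that there is an attack. Deterministic rules are the \<open>{0, 1}\<close>-valued ones.\<close>

definition detector :: "(nat \<Rightarrow> (nat \<Rightarrow> real^'p) \<Rightarrow> real) \<Rightarrow> bool" where
  "detector D \<longleftrightarrow>
     (\<forall>k\<ge>1. D k \<in> borel_measurable (PiM {1..k} (\<lambda>_. borel)) \<and> (\<forall>y. 0 \<le> D k y \<and> D k y \<le> 1))"

definition alarm_prob ::
  "'a measure \<Rightarrow> (nat \<Rightarrow> (nat \<Rightarrow> real^'p) \<Rightarrow> real) \<Rightarrow> (nat \<Rightarrow> 'a \<Rightarrow> real^'p) \<Rightarrow> nat \<Rightarrow> real" where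
  "alarm_prob M D y k = (\<integral>\<omega>. D k (\<lambda>n\<in>{1..k}. y n \<omega>) \<partial>M)"

text \<open>\<open>ln 0 = 0\<close> in the library, hence the case distinction.\<close>

definition neg_log :: "real \<Rightarrow> ereal" where
  "neg_log p = (if p = 0 then \<infinity> else ereal (- ln p))"

text \<open>\<open>y\<close> and \<open>yt\<close> are the measurements received without and with the attack; hence
  \<open>alarm_prob M D y k\<close> is the false alarm probability and \<open>alarm_prob M D yt k\<close> the probability
  of correct detection.\<close>

definition stealthy ::
  "'a measure \<Rightarrow> real \<Rightarrow> real \<Rightarrow> (nat \<Rightarrow> 'a \<Rightarrow> real^'p) \<Rightarrow> (nat \<Rightarrow> 'a \<Rightarrow> real^'p) \<Rightarrow> bool" where
  "stealthy M \<epsilon> \<delta> y yt \<longleftrightarrow>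
     (\<forall>D. detector D \<longrightarrow>
        (\<forall>k\<ge>1. 0 < 1 - alarm_prob M D yt k \<and> 1 - alarm_prob M D yt k \<le> \<delta>) \<longrightarrow>
        limsup (\<lambda>k. ereal (1 / real k) * neg_log (alarm_prob M D y k)) \<le> ereal \<epsilon>)"

definition error_cov ::
  "'a measure \<Rightarrow> (nat \<Rightarrow> 'a \<Rightarrow> real^'n) \<Rightarrow> (nat \<Rightarrow> 'a \<Rightarrow> real^'n) \<Rightarrow> nat \<Rightarrow> real^'n^'n" where
  "error_cov M x xh k = (\<integral>\<omega>. outer (xh k \<omega> - x k \<omega>) (xh k \<omega> - x k \<omega>) \<partial>M)"

definition weighted_mse ::
  "'a measure \<Rightarrow> real^'n^'n \<Rightarrow> (nat \<Rightarrow> 'a \<Rightarrow> real^'n) \<Rightarrow> (nat \<Rightarrow> 'a \<Rightarrow> real^'n) \<Rightarrow> ereal" where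
  "weighted_mse M W x xh =
     limsup (\<lambda>k. ereal (1 / real k * (\<Sum>n = 1..k. trace (error_cov M x xh n ** W))))"

definition delta_bar :: "real \<Rightarrow> real" where
  "delta_bar t = (THE d. 1 \<le> d \<and> d = 2 * t + 1 + ln d)"

end

theory Submission
  imports Defs
begin

text \<open>
  The filter of the controller accounts for the input that the controller has computed. So in the
  attacked run the prediction error \<open>xt - xht\<close> is \<open>err + f\<close>, where \<open>err\<close> is the prediction error of
  the nominal run and \<open>f\<close> is driven by the attack alone: \<open>f 1 = 0\<close> and
  \<open>f (k + 1) = (A - K C) f k + B (\<phi> k)\<close>. The attacked innovation is \<open>z + C f\<close>. As \<open>\<phi>\<close> is \<open>\<zeta>\<close>
  filtered by a right inverse of \<open>(A - K C, B, C)\<close>, the term \<open>C f\<close> should be \<open>\<zeta>\<close>. This is true only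
  up to a transient: a right inverse of a strictly proper system is improper, its output begins
  before time 1, and the attack applies it from time 1 on. In the field of Laurent series at
  infinity the right inverse yields a trajectory of the error dynamics with output exactly \<open>\<zeta>\<close>
  whose value \<open>s\<close> at time 1 is a linear function of finitely many of the \<open>\<zeta> n\<close>
  (\<open>right_inverse_trajectory\<close>). Subtracting \<open>f\<close> gives \<open>C (f k) = \<zeta> k - C (A - K C)^(k - 1) s\<close>. The
  Riccati equation makes \<open>A - K C\<close> stable (\<open>error_dynamics_stable\<close>), so the transient decays
  geometrically.

  Performance: \<open>err k\<close> has law \<open>N(0, P)\<close> and is independent of \<open>f k\<close>, so the weighted error is
  \<open>tr (P W)\<close> plus the mean of \<open>C f\<close> squared in the metric of the inverse of \<open>Sz\<close>. The latter is
  \<open>p (D - 1)\<close> up to a geometrically small term, where \<open>p\<close> is the number of outputs and \<open>D\<close> the value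
  of \<open>delta_bar\<close> (\<open>mean_square_error\<close>); the transient is averaged out.

  Stealthiness: in both runs the measurements are the same function of the private seed of the
  controller and of the innovations (\<open>decoder_correct\<close>), whatever the control law is. Every detector
  thus becomes a test on seed and innovations. The nominal innovations are independent with law
  \<open>N(0, Sz)\<close> and independent of the seed and of the attacker (\<open>innovations_law\<close>, an induction over
  time whose step \<open>kalman_step\<close> is a change of variables in a Gaussian integral). Given the finitely
  many \<open>\<zeta> n\<close> that determine \<open>s\<close>, the attacked innovations are independent Gaussians too, with means
  of finite total energy and covariance \<open>D Sz\<close> at all but finitely many times. Under the attack the
  logarithm of the likelihood ratio grows at the rate of the relative entropy of \<open>N(0, D Sz)\<close> with
  respect to \<open>N(0, Sz)\<close>, which is \<open>p (D - 1 - ln D) / 2\<close>. The equation that defines \<open>delta_bar\<close> says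
  that this rate is \<open>\<epsilon>\<close>. A Chernoff bound (\<open>testing_bound\<close>, \<open>ratio_bound_less_one\<close>) shows that the
  likelihood ratio exceeds \<open>exp (k \<tau>)\<close> with vanishing probability if \<open>\<tau> > \<epsilon>\<close>. Hence a test with
  detection probability at least \<open>1 - \<delta>\<close> has a false alarm probability of at least a constant times
  \<open>exp (- k \<tau>)\<close> (\<open>detection_bound\<close>).
\<close>

notation fls_nth (infixl "$$" 75)
no_notation fps_nth (infixl "$" 75)

(* Transposes stay visible, because inner_matrix_vector moves matrices across inner products in
    this form. *)
declare transpose_matrix_vector [simp del]

section \<open>Transfer functions as Laurent series at infinity\<close>

lemma matrix_inv_right: "invertible X \<Longrightarrow> X ** matrix_inv X = mat 1"
  unfolding matrix_inv_def invertible_def by (erule someI2_ex) (rule conjunct1)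

lemma matrix_inv_unique:
  fixes X Y :: "'a::field^'n^'n"
  assumes XY: "X ** Y = mat 1"
  shows "matrix_inv X = Y"
proof -
  have YX: "Y ** X = mat 1" using XY by (rule matrix_left_right_inverse[THEN iffD1])
  have "invertible X" unfolding invertible_def using XY YX by blast
  then have "Y ** (X ** matrix_inv X) = Y" by (simp add: matrix_inv_right)
  then show ?thesis by (simp add: matrix_mul_assoc YX)
qed

lemma poly_at_infinity_nth:
  "poly_at_infinity p $$ n = (if n \<le> 0 then coeff p (nat (- n)) else 0)"
  by (auto simp: poly_at_infinity_def coeff_reflect_poly coeff_eq_0 nat_diff_distrib nat_add_distrib
      intro!: arg_cong[of _ _ "coeff p"])

lemma poly_at_infinity_add: "poly_at_infinity (p + q) = poly_at_infinity p + poly_at_infinity q"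
  by (rule fls_eqI) (simp add: poly_at_infinity_nth)

lemma poly_at_infinity_const: "poly_at_infinity [:c:] = fls_const c"
  by (rule fls_eqI) (auto simp: poly_at_infinity_nth coeff_pCons split: nat.splits)

lemma poly_at_infinity_X: "poly_at_infinity [:0, 1:] = fls_X_inv"
  by (rule fls_eqI) (auto simp: poly_at_infinity_nth coeff_pCons split: nat.splits)

lemma impulse_response_to_fract: "impulse_response (to_fract p) = poly_at_infinity p"
  using impulse_response_Fract[of 1 p] poly_at_infinity_const[of 1]
  by (simp add: to_fract_def one_pCons)

lemma impulse_response_mult: "impulse_response (r * s) = impulse_response r * impulse_response s"
proof -
  obtain p q p' q' where "r = Fract p q" "q \<noteq> 0" "s = Fract p' q'" "q' \<noteq> 0"
    by (metis Fract_cases)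
  then show ?thesis
    by (simp add: impulse_response_Fract poly_at_infinity_mult)
qed

lemma impulse_response_add: "impulse_response (r + s) = impulse_response r + impulse_response s"
proof -
  obtain p q p' q' where "r = Fract p q" "q \<noteq> 0" "s = Fract p' q'" "q' \<noteq> 0"
    by (metis Fract_cases)
  then show ?thesis
    by (simp add: impulse_response_Fract poly_at_infinity_mult poly_at_infinity_add
        poly_at_infinity_eq_0_iff add_frac_eq)
qed

lemma impulse_response_0 [simp]: "impulse_response 0 = 0"
  using impulse_response_add[of 0 0] by simp

lemma impulse_response_1 [simp]: "impulse_response 1 = 1"
  using impulse_response_to_fract[of 1] poly_at_infinity_const[of 1] by (simp add: flip: one_pCons)

lemma impulse_response_uminus: "impulse_response (- r) = - impulse_response r"
  using impulse_response_add[of r "- r"] by (simp add: eq_neg_iff_add_eq_0 add.commute)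

lemma impulse_response_diff: "impulse_response (r - s) = impulse_response r - impulse_response s"
  using impulse_response_add[of r "- s"] by (simp add: impulse_response_uminus)

lemma impulse_response_sum: "impulse_response (sum f I) = (\<Sum>i\<in>I. impulse_response (f i))"
  by (induction I rule: infinite_finite_induct) (auto simp: impulse_response_add)

lemma impulse_response_prod: "impulse_response (prod f I) = (\<Prod>i\<in>I. impulse_response (f i))"
  by (induction I rule: infinite_finite_induct) (auto simp: impulse_response_mult)

lemma map_matrix_impulse_response_mult:
  "map_matrix impulse_response (X ** Y) =
     map_matrix impulse_response X ** map_matrix impulse_response Y"
  by (simp add: vec_eq_iff matrix_matrix_mult_def impulse_response_sum impulse_response_mult)

lemma map_matrix_impulse_response_mat1: "map_matrix impulse_response (mat 1) = mat 1"
  by (auto simp: vec_eq_iff mat_def)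

text \<open>The expansion at infinity is a ring homomorphism into a field, so it commutes with
    determinants
  and thereby decides invertibility of rational matrices.\<close>

lemma impulse_response_det:
  "impulse_response (det X) = det (map_matrix impulse_response X)"
proof -
  have "impulse_response (of_int (sign p)) = of_int (sign p)" for p :: "'a \<Rightarrow> 'a"
    by (cases p rule: sign_cases) (auto simp: impulse_response_uminus)
  then show ?thesis
    by (simp add: det_def impulse_response_sum impulse_response_mult impulse_response_prod)
qed

text \<open>The inverse of \<open>z I - A\<close> as the geometric series of the matrices \<open>A^k z^(- k - 1)\<close>, with
    \<open>fls_X\<close>
  for \<open>1 / z\<close>. Powers are iterated products, because \<open>^\<close> on matrices is componentwise.\<close>

definition resolvent_series :: "real^'n^'n \<Rightarrow> real fls^'n^'n" where
  "resolvent_series A = (\<chi> i j. fls_X *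
     fps_to_fls (Abs_fps (\<lambda>k. ((\<lambda>X. A ** X) ^^ k) (mat 1) $ i $ j)))"

lemma resolvent_series_nth:
  "resolvent_series A $ i $ j $$ n =
     (if n \<ge> 1 then ((\<lambda>X. A ** X) ^^ nat (n - 1)) (mat 1) $ i $ j else 0)"
  by (auto simp: resolvent_series_def fls_X_times_conv_shift)

lemma sum_fls_nth: "(\<Sum>i\<in>I. f i) $$ n = (\<Sum>i\<in>I. f i $$ n)"
  by (induction I rule: infinite_finite_induct) auto

lemma mat_mult_component: "(mat a ** X) $ i $ j = a * X $ i $ j"
  by (simp add: matrix_matrix_mult_def mat_def if_distrib[of "\<lambda>x. x * _"] cong: if_cong)

lemma matrix_diff_mult: "(X - Y) ** Z = X ** Z - Y ** (Z :: 'a::ring_1^'n^'m)"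
  by (vector matrix_matrix_mult_def sum_subtractf left_diff_distrib)

lemma resolvent_series:
  fixes A :: "real^'n^'n"
  shows "(mat fls_X_inv - map_matrix fls_const A) ** resolvent_series A = mat 1"
proof -
  have "((mat fls_X_inv - map_matrix fls_const A) ** resolvent_series A) $ i $ j $$ n =
      (mat 1 :: real fls^'n^'n) $ i $ j $$ n" for i j n
  proof -
    have "((mat fls_X_inv - map_matrix fls_const A) ** resolvent_series A) $ i $ j $$ n =
       resolvent_series A $ i $ j $$ (n + 1) - (\<Sum>k\<in>UNIV. A $ i $ k * resolvent_series A $ k $ j $$
           n)"
      by (simp add: matrix_diff_mult mat_mult_component fls_X_inv_times_conv_shift,
          simp add: matrix_matrix_mult_def sum_fls_nth)
    also have "\<dots> = (mat 1 :: real fls^'n^'n) $ i $ j $$ n"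
    proof (cases "n \<ge> 1")
      case True
      then have "nat n = Suc (nat (n - 1))" by simp
      with True show ?thesis
        by (simp add: resolvent_series_nth) (simp add: matrix_matrix_mult_def mat_def)
    next
      case False
      then show ?thesis by (auto simp: resolvent_series_nth mat_def)
    qed
    finally show ?thesis .
  qed
  then show ?thesis by (simp add: vec_eq_iff fls_eq_iff)
qed

text \<open>The geometric series inverts \<open>z I - A\<close> over the Laurent series. Hence its determinant is a
    nonzero
  rational function, and \<open>matrix_inv\<close> in the transfer function is an inverse indeed.\<close>

lemma impulse_response_transfer_function:
  fixes A :: "real^'n^'n" and B :: "real^'m^'n" and C :: "real^'n^'p"
  shows "map_matrix impulse_response (transfer_function A B C) =
     map_matrix fls_const C ** resolvent_series A ** map_matrix fls_const B"
proof -
  let ?N = "mat (to_fract [:0, 1:]) - map_matrix const_fract A"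
  let ?h = "map_matrix impulse_response"
  have hc: "?h (map_matrix const_fract X) = map_matrix fls_const X" for X :: "real^'x^'y"
    by (simp add: vec_eq_iff impulse_response_to_fract poly_at_infinity_const)
  have hN: "?h ?N = mat fls_X_inv - map_matrix fls_const A"
    by (auto simp add: vec_eq_iff mat_def impulse_response_diff impulse_response_to_fract
        poly_at_infinity_const poly_at_infinity_X)
  have "det (?h ?N) * det (resolvent_series A) = 1"
    unfolding hN using arg_cong[OF resolvent_series, of det] by (simp only: det_I det_mul)
  then have "det ?N \<noteq> 0"
    by (auto simp flip: impulse_response_det)
  then have inv: "?N ** matrix_inv ?N = mat 1"
    by (intro matrix_inv_right iffD2[OF invertible_det_nz])
  have "?h ?N ** ?h (matrix_inv ?N) = mat 1"
    using arg_cong[OF inv, of ?h]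
    by (simp only: map_matrix_impulse_response_mult map_matrix_impulse_response_mat1)
  moreover have "resolvent_series A ** ?h ?N = mat 1"
    unfolding hN using resolvent_series by (rule matrix_left_right_inverse[THEN iffD1])
  ultimately have "?h (matrix_inv ?N) = resolvent_series A"
    using matrix_mul_assoc[of "resolvent_series A" "?h ?N" "?h (matrix_inv ?N)"]
    by (simp only: matrix_mul_lid matrix_mul_rid)
  then show ?thesis
    by (simp add: transfer_function_def map_matrix_impulse_response_mult hc)
qed

definition signal_series :: "(nat \<Rightarrow> real^'p) \<Rightarrow> real fls^'p" where
  "signal_series f = (\<chi> j. fps_to_fls (Abs_fps (\<lambda>n. if n = 0 then 0 else f n $ j)))"

text \<open>The terms beyond the subdegree vanish; a common bound \<open>N\<close> lets matrix entries with different
  subdegrees share one range of summation.\<close>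

lemma times_signal_series_nth:
  assumes N: "nat (k - fls_subdegree g) \<le> N"
  shows "(g * signal_series f $ j) $$ k = (\<Sum>n = 1..N. g $$ (k - int n) * f n $ j)"
proof -
  let ?s = "signal_series f $ j"
  have nth: "?s $$ n = (if n \<ge> 1 then f (nat n) $ j else 0)" for n
    by (auto simp: signal_series_def)
  have "(g * ?s) $$ k = (\<Sum>i=0..nat (k - fls_subdegree g). g $$ (k - int i) * ?s $$ int i)"
  proof -
    let ?h = "\<lambda>i. g $$ i * ?s $$ (k - i)"
    have "(g * ?s) $$ k = (\<Sum>i=fls_subdegree g..k - fls_subdegree ?s. ?h i)"
      by (rule fls_times_nth(2))
    also have "\<dots> = (\<Sum>i=fls_subdegree g..k. ?h i)"
    proof (cases "?s = 0")
      case False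
      have "fls_subdegree ?s \<ge> 0"
        unfolding signal_series_def vec_lambda_beta by (rule fls_subdegree_fls_to_fps_gt0)
      then show ?thesis
        by (intro sum.mono_neutral_left) auto
    qed simp
    also have "\<dots> = (\<Sum>i=0..nat (k - fls_subdegree g). g $$ (k - int i) * ?s $$ int i)"
    proof (cases "fls_subdegree g \<le> k")
      case True
      then show ?thesis
        by (intro sum.reindex_bij_witness[of _ "\<lambda>i. k - int i" "\<lambda>i. nat (k - i)"]) auto
    qed (simp add: nth)
    finally show ?thesis .
  qed
  also have "\<dots> = (\<Sum>i\<in>{1..N}. g $$ (k - int i) * ?s $$ int i)"
    using N by (intro sum.mono_neutral_cong) (auto simp: nth)
  finally show ?thesis by (simp add: nth)
qed

definition signal_at :: "real fls^'n \<Rightarrow> int \<Rightarrow> real^'n" where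
  "signal_at F k = (\<chi> i. F $ i $$ k)"

lemma signal_at_signal_series: "k \<ge> 1 \<Longrightarrow> signal_at (signal_series f) (int k) = f k"
  by (simp add: signal_at_def signal_series_def vec_eq_iff)

lemma signal_at_const_mult: "signal_at (map_matrix fls_const X *v F) k = X *v signal_at F k"
  by (simp add: signal_at_def matrix_vector_mult_def vec_eq_iff sum_fls_nth)

lemma signal_at_shift: "signal_at (mat fls_X_inv *v F) k = signal_at F (k + 1)"
  by (simp add: signal_at_def matrix_vector_mult_def mat_def vec_eq_iff fls_X_inv_times_conv_shift
     if_distrib[of "\<lambda>x. x * _"] cong: if_cong)

lemma signal_at_response:
  "signal_at (map_matrix impulse_response G *v signal_series f) (int k) = system_output G f k"
  unfolding signal_at_def matrix_vector_mult_def vec_eq_iff sum_fls_nth system_output_def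
  by (simp del: One_nat_def add: sum_fls_nth times_signal_series_nth[OF order_refl])

lemma signal_at_diff: "signal_at (F - F') k = signal_at F k - signal_at F' k"
  by (simp add: signal_at_def vec_eq_iff)

text \<open>The matrix of Laurent series \<open>T = (z I - A)^(-1) B G\<close> satisfies \<open>C T = I\<close> and \<open>(z I - A) T =
    B G\<close>.
  So the coefficients of \<open>T\<close> applied to the signal \<open>f\<close> form a state trajectory with input \<open>G f\<close> and
  output \<open>f\<close> at all integer times. Its value at time 1 is what the part of the input before time 1
  has left behind. Only finitely many values of \<open>f\<close> enter there, because a Laurent series has
  finitely many coefficients of negative index.\<close>

lemma right_inverse_trajectory:
  fixes A :: "real^'n^'n" and B :: "real^'m^'n" and C :: "real^'n^'p"
  assumes G: "right_inverse A B C G"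
  obtains d :: nat and \<Gamma> :: "nat \<Rightarrow> real^'p^'n" where
    "\<And>f. \<exists>F. F 1 = (\<Sum>n=1..d. \<Gamma> n *v f n) \<and>
       (\<forall>k\<ge>1. C *v F k = f k \<and> F (k + 1) = A *v F k + B *v system_output G f k)"
proof -
  define T where "T = resolvent_series A ** map_matrix fls_const B ** map_matrix impulse_response G"
  \<comment> \<open>Any bound for the number of relevant coefficients of all entries will do.\<close>
  define d where "d = (\<Sum>i\<in>UNIV. \<Sum>j\<in>UNIV. nat (1 - fls_subdegree (T $ i $ j)))"
  have d: "nat (1 - fls_subdegree (T $ i $ j)) \<le> d" for i j
  proof -
    have "nat (1 - fls_subdegree (T $ i $ j)) \<le> (\<Sum>j\<in>UNIV. nat (1 - fls_subdegree (T $ i $ j)))"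
      by (rule member_le_sum) auto
    also have "\<dots> \<le> d" unfolding d_def by (rule member_le_sum) auto
    finally show ?thesis .
  qed
  define \<Gamma> :: "nat \<Rightarrow> real^'p^'n" where "\<Gamma> n = (\<chi> i j. T $ i $ j $$ (1 - int n))" for n
  have CT: "map_matrix fls_const C ** T = mat 1"
    using arg_cong[OF G[unfolded right_inverse_def], of "map_matrix impulse_response"]
    by (simp add: T_def map_matrix_impulse_response_mult map_matrix_impulse_response_mat1
        impulse_response_transfer_function matrix_mul_assoc)
  have AT: "(mat fls_X_inv - map_matrix fls_const A) ** T =
      map_matrix fls_const B ** map_matrix impulse_response G"
    by (simp add: T_def matrix_mul_assoc resolvent_series)
  have "\<exists>F. F 1 = (\<Sum>n=1..d. \<Gamma> n *v f n) \<and>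
       (\<forall>k\<ge>1. C *v F k = f k \<and> F (k + 1) = A *v F k + B *v system_output G f k)" for f
  proof -
    define \<F> where "\<F> = T *v signal_series f"
    have 1: "signal_at \<F> 1 = (\<Sum>n=1..d. \<Gamma> n *v f n)"
    proof -
      have "\<F> $ i $$ 1 = (\<Sum>n=1..d. \<Gamma> n *v f n) $ i" for i
      proof -
        have "\<F> $ i $$ 1 = (\<Sum>j\<in>UNIV. (T $ i $ j * signal_series f $ j) $$ 1)"
          by (simp add: \<F>_def matrix_vector_mult_def sum_fls_nth)
        also have "\<dots> = (\<Sum>j\<in>UNIV. \<Sum>n = 1..d. T $ i $ j $$ (1 - int n) * f n $ j)"
          by (intro sum.cong refl times_signal_series_nth d)
        also have "\<dots> = (\<Sum>n=1..d. \<Gamma> n *v f n) $ i"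
          by (subst sum.swap) (simp add: matrix_vector_mult_def \<Gamma>_def)
        finally show ?thesis .
      qed
      then show ?thesis by (simp add: signal_at_def vec_eq_iff)
    qed
    have 2: "C *v signal_at \<F> (int k) = f k" if "k \<ge> 1" for k
      using that by (simp add: \<F>_def matrix_vector_mul_assoc CT signal_at_signal_series
          flip: signal_at_const_mult)
    have 3: "signal_at \<F> (int k + 1) = A *v signal_at \<F> (int k) + B *v system_output G f k" for k
    proof -
      have "signal_at ((mat fls_X_inv - map_matrix fls_const A) *v \<F>) (int k) =
          B *v system_output G f k"
        by (simp add: \<F>_def matrix_vector_mul_assoc AT)
           (simp flip: matrix_vector_mul_assoc add: signal_at_const_mult signal_at_response)
      then show ?thesis
        by (simp add: matrix_vector_mult_diff_rdistrib signal_at_diff signal_at_shift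
            signal_at_const_mult algebra_simps)
    qed
    show ?thesis
      by (rule exI[of _ "\<lambda>k. signal_at \<F> (int k)"]) (use 1 2 3 in \<open>auto simp: add.commute\<close>)
  qed
  then show ?thesis by (rule that)
qed

section \<open>Gaussian laws under linear observations\<close>

lemma borel_measurable_matrix_vector_mult [measurable (raw)]:
  fixes f :: "'a \<Rightarrow> real^'n" and A :: "real^'n^'m"
  assumes "f \<in> borel_measurable M"
  shows "(\<lambda>x. A *v f x) \<in> borel_measurable M"
  by (rule measurable_compose[OF assms borel_measurable_continuous_onI])
     (rule linear_continuous_on[OF matrix_vector_mul_bounded_linear])

lemma inner_matrix_vector: "(A *v x) \<bullet> y = x \<bullet> (transpose A *v y)" for A :: "real^'n^'m"
  by (metis dot_lmul_matrix inner_commute transpose_matrix_vector)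

lemma transpose_add: "transpose (X + Y) = transpose X + transpose Y"
  by (simp add: vec_eq_iff transpose_def)

lemma nn_integral_lborel_translate:
  fixes c :: "'a::euclidean_space"
  assumes [measurable]: "f \<in> borel_measurable borel"
  shows "(\<integral>\<^sup>+x. f (x + c) \<partial>lborel) = (\<integral>\<^sup>+x. f x \<partial>lborel)"
  by (subst (2) lborel_distr_plus[of c, symmetric]) (simp add: nn_integral_distr add.commute)

lemma nn_integral_lborel_scale:
  fixes f :: "'a::euclidean_space \<Rightarrow> ennreal"
  assumes [measurable]: "f \<in> borel_measurable borel" and "c \<noteq> 0"
  shows "(\<integral>\<^sup>+x. f x \<partial>lborel) = ennreal (\<bar>c\<bar> ^ DIM('a)) * (\<integral>\<^sup>+x. f (c *\<^sub>R x) \<partial>lborel)"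
  by (subst lborel_affine[OF \<open>c \<noteq> 0\<close>, of 0])
     (simp add: nn_integral_density nn_integral_distr nn_integral_cmult)

text \<open>Laws with a density proportional to \<open>exp (- q / 2)\<close>. The normalizing constant is kept as an
  integral, so that a substitution requires to follow the exponents only: the constants on both
  sides agree because the total masses do, and no determinant has to be computed.\<close>

definition gibbs_mass :: "('a::euclidean_space \<Rightarrow> real) \<Rightarrow> ennreal" where
  "gibbs_mass q = (\<integral>\<^sup>+x. ennreal (exp (- q x / 2)) \<partial>lborel)"

definition gibbs :: "('a::euclidean_space \<Rightarrow> real) \<Rightarrow> 'a measure" where
  "gibbs q = density lborel (\<lambda>x. ennreal (exp (- q x / 2)) * inverse (gibbs_mass q))"

lemma space_gibbs [simp]: "space (gibbs q) = UNIV" by (simp add: gibbs_def)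
lemma sets_gibbs [simp, measurable_cong]: "sets (gibbs q) = sets borel" by (simp add: gibbs_def)

lemma gibbs_mass_nonzero:
  assumes [measurable]: "q \<in> borel_measurable borel"
  shows "gibbs_mass q \<noteq> 0"
proof
  assume "gibbs_mass q = 0"
  then have "AE x in lborel. ennreal (exp (- q x / 2)) = 0"
    unfolding gibbs_mass_def by (subst (asm) nn_integral_0_iff_AE) simp_all
  then have "AE x::'a in lborel. False" by simp
  then show False by (simp add: eventually_False ae_filter_eq_bot_iff)
qed

lemma nn_integral_gibbs:
  assumes [measurable]: "q \<in> borel_measurable borel" "f \<in> borel_measurable borel"
  shows "(\<integral>\<^sup>+x. f x \<partial>gibbs q) =
    (\<integral>\<^sup>+x. f x * ennreal (exp (- q x / 2)) \<partial>lborel) * inverse (gibbs_mass q)"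
  unfolding gibbs_def
  by (subst nn_integral_density, simp, simp, subst nn_integral_multc[symmetric]) (simp_all add:
      mult_ac)

lemma nn_integral_gibbs_gibbs:
  assumes [measurable]: "q \<in> borel_measurable borel" "q' \<in> borel_measurable borel"
    and f [measurable]: "f \<in> borel_measurable (borel \<Otimes>\<^sub>M borel)"
  shows "(\<integral>\<^sup>+x. \<integral>\<^sup>+y. f (x, y) \<partial>gibbs q' \<partial>gibbs q) =
    (\<integral>\<^sup>+x. \<integral>\<^sup>+y. f (x, y) * ennreal (exp (- q' y / 2)) * ennreal (exp (- q x / 2))
       \<partial>lborel \<partial>lborel) * (inverse (gibbs_mass q') * inverse (gibbs_mass q))"
proof -
  have "(\<integral>\<^sup>+y. f (x, y) \<partial>gibbs q') * ennreal (exp (- q x / 2)) =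
    (\<integral>\<^sup>+y. f (x, y) * ennreal (exp (- q' y / 2)) * ennreal (exp (- q x / 2)) \<partial>lborel) *
      inverse (gibbs_mass q')" for x
    by (subst nn_integral_gibbs, simp, simp, subst nn_integral_multc) (simp_all add: mult_ac)
  moreover have [measurable]: "(\<lambda>x. \<integral>\<^sup>+y. f (x, y) \<partial>gibbs q') \<in> borel_measurable borel"
    by (simp add: nn_integral_gibbs)
  ultimately show ?thesis
    by (simp add: nn_integral_gibbs[of q] nn_integral_multc mult.assoc del: times_divide_eq_right)
qed

lemma prob_space_gibbs:
  assumes [measurable]: "q \<in> borel_measurable borel" and fin: "gibbs_mass q < \<infinity>"
  shows "prob_space (gibbs q)"
proof
  have "emeasure (gibbs q) (space (gibbs q)) = (\<integral>\<^sup>+x. 1 \<partial>gibbs q)" by simp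
  also have "\<dots> = gibbs_mass q * inverse (gibbs_mass q)"
    by (subst nn_integral_gibbs) (auto simp: gibbs_mass_def)
  also have "\<dots> = 1"
    using fin gibbs_mass_nonzero[of q] by (simp flip: divide_ennreal_def add: ennreal_divide_self)
  finally show "emeasure (gibbs q) (space (gibbs q)) = 1" .
qed

lemma gibbs_mass_scale:
  fixes q :: "'a::euclidean_space \<Rightarrow> real"
  assumes [measurable]: "q \<in> borel_measurable borel"
    and q: "\<And>c x. q (c *\<^sub>R x) = c\<^sup>2 * q x" and l: "0 < l"
  shows "gibbs_mass (\<lambda>x. l * q x) = ennreal ((1 / sqrt l) ^ DIM('a)) * gibbs_mass q"
  unfolding gibbs_mass_def using l
  by (subst nn_integral_lborel_scale[of _ "1 / sqrt l"])
     (simp_all add: q real_sqrt_pow2 power_divide)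

text \<open>An unknown \<open>e\<close> is observed as \<open>z = v + C e\<close> and estimated by \<open>L z\<close>, with estimation error
  \<open>r = e - L z\<close>. The substitution of \<open>(z, r)\<close> for \<open>(e, v)\<close> is a composition of two shears, and
      shears
  preserve Lebesgue measure for arbitrary measurable \<open>C\<close> and \<open>L\<close>. If the exponent splits, \<open>z\<close> and
      \<open>r\<close>
  are independent.\<close>

locale gibbs_observation =
  fixes qe qr :: "'a::euclidean_space \<Rightarrow> real" and qv qz :: "'b::euclidean_space \<Rightarrow> real"
    and C :: "'a \<Rightarrow> 'b" and L :: "'b \<Rightarrow> 'a"
  assumes meas [measurable]: "qe \<in> borel_measurable borel" "qr \<in> borel_measurable borel"
      "qv \<in> borel_measurable borel" "qz \<in> borel_measurable borel"
      "C \<in> borel_measurable borel" "L \<in> borel_measurable borel"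
    and fin: "gibbs_mass qe < \<infinity>" "gibbs_mass qv < \<infinity>"
    and split: "\<And>r z. qe (r + L z) + qv (z - C (r + L z)) = qr r + qz z"
begin

lemma shear:
  fixes f :: "'b \<times> 'a \<Rightarrow> ennreal"
  assumes [measurable]: "f \<in> borel_measurable (borel \<Otimes>\<^sub>M borel)"
  shows "(\<integral>\<^sup>+e. \<integral>\<^sup>+v. f (v + C e, e - L (v + C e)) * ennreal (exp (- qv v / 2)) *
            ennreal (exp (- qe e / 2)) \<partial>lborel \<partial>lborel) =
         (\<integral>\<^sup>+z. \<integral>\<^sup>+r. f (z, r) * ennreal (exp (- qr r / 2)) * ennreal (exp (- qz z / 2))
            \<partial>lborel \<partial>lborel)"
proof -
  define h where "h e z = f (z, e - L z) * ennreal (exp (- qv (z - C e) / 2)) *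
            ennreal (exp (- qe e / 2))" for e z
  have h [measurable]: "case_prod h \<in> borel_measurable (borel \<Otimes>\<^sub>M borel)"
    unfolding h_def by measurable
  have "(\<integral>\<^sup>+e. \<integral>\<^sup>+v. f (v + C e, e - L (v + C e)) * ennreal (exp (- qv v / 2)) *
            ennreal (exp (- qe e / 2)) \<partial>lborel \<partial>lborel) =
        (\<integral>\<^sup>+e. \<integral>\<^sup>+v. h e (v + C e) \<partial>lborel \<partial>lborel)"
    by (simp add: h_def)
  also have "\<dots> = (\<integral>\<^sup>+e. \<integral>\<^sup>+z. h e z \<partial>lborel \<partial>lborel)"
    by (intro nn_integral_cong nn_integral_lborel_translate) measurable
  also have "\<dots> = (\<integral>\<^sup>+z. \<integral>\<^sup>+e. h e z \<partial>lborel \<partial>lborel)"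
    by (rule pair_sigma_finite.Fubini'[symmetric])
       (auto intro: pair_sigma_finite.intro lborel.sigma_finite_measure_axioms)
  also have "\<dots> = (\<integral>\<^sup>+z. \<integral>\<^sup>+r. h (r + L z) z \<partial>lborel \<partial>lborel)"
    by (intro nn_integral_cong nn_integral_lborel_translate[symmetric]) measurable
  also have "\<dots> = (\<integral>\<^sup>+z. \<integral>\<^sup>+r. f (z, r) * ennreal (exp (- qr r / 2)) * ennreal (exp (- qz z / 2))
            \<partial>lborel \<partial>lborel)"
  proof (intro nn_integral_cong)
    fix z r
    have "- qv (z - C (r + L z)) / 2 - qe (r + L z) / 2 = - qr r / 2 - qz z / 2"
      using split[of r z] by simp
    then have "exp (- qv (z - C (r + L z)) / 2) * exp (- qe (r + L z) / 2) =
        exp (- qr r / 2) * exp (- qz z / 2)"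
      by (simp flip: exp_add add: algebra_simps)
    then show "h (r + L z) z = f (z, r) * ennreal (exp (- qr r / 2)) * ennreal (exp (- qz z / 2))"
      by (simp add: h_def mult.assoc flip: ennreal_mult)
  qed
  finally show ?thesis .
qed

text \<open>The finiteness of the constants of \<open>qz\<close> and \<open>qr\<close> comes from this identity.\<close>

lemma mass_mult: "gibbs_mass qe * gibbs_mass qv = gibbs_mass qz * gibbs_mass qr"
  using shear[of "\<lambda>_. 1"]
  by (simp add: nn_integral_cmult nn_integral_multc gibbs_mass_def mult.commute)

lemma mass_finite: "gibbs_mass qz < \<infinity>" "gibbs_mass qr < \<infinity>"
proof -
  have "gibbs_mass qz * gibbs_mass qr < \<infinity>"
    using fin by (simp flip: mass_mult add: ennreal_mult_less_top)
  then have "gibbs_mass qz < \<infinity> \<and> gibbs_mass qr < \<infinity>"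
    using gibbs_mass_nonzero[OF meas(4)] gibbs_mass_nonzero[OF meas(2)] by (auto simp:
        ennreal_mult_less_top)
  then show "gibbs_mass qz < \<infinity>" "gibbs_mass qr < \<infinity>" by auto
qed

lemma nn_integral_observation:
  fixes f :: "'b \<times> 'a \<Rightarrow> ennreal"
  assumes [measurable]: "f \<in> borel_measurable (borel \<Otimes>\<^sub>M borel)"
  shows "(\<integral>\<^sup>+e. \<integral>\<^sup>+v. f (v + C e, e - L (v + C e)) \<partial>gibbs qv \<partial>gibbs qe) =
         (\<integral>\<^sup>+z. \<integral>\<^sup>+r. f (z, r) \<partial>gibbs qr \<partial>gibbs qz)"
proof -
  have inv: "inverse (gibbs_mass qv) * inverse (gibbs_mass qe) =
      inverse (gibbs_mass qr) * inverse (gibbs_mass qz)"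
    using mass_mult mass_finite fin by (simp flip: ennreal_inverse_mult add: mult.commute)
  show ?thesis
    using nn_integral_gibbs_gibbs[OF meas(1,3), of "\<lambda>(e, v). f (v + C e, e - L (v + C e))"]
      nn_integral_gibbs_gibbs[OF meas(4,2) assms]
    unfolding shear[OF assms, symmetric] by (simp add: inv)
qed

lemma nn_integral_observation1:
  fixes f :: "'b \<Rightarrow> ennreal"
  assumes [measurable]: "f \<in> borel_measurable borel"
  shows "(\<integral>\<^sup>+e. \<integral>\<^sup>+v. f (v + C e) \<partial>gibbs qv \<partial>gibbs qe) = (\<integral>\<^sup>+z. f z \<partial>gibbs qz)"
proof -
  interpret r: prob_space "gibbs qr" by (rule prob_space_gibbs) (use mass_finite in auto)
  show ?thesis
    using nn_integral_observation[of "\<lambda>x. f (fst x)"] r.emeasure_space_1 by simp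
qed

end

text \<open>The squared Mahalanobis distance from the origin, which is the exponent in \<open>mvn_density\<close>.\<close>

definition mahal :: "real^'n^'n \<Rightarrow> real^'n \<Rightarrow> real" where
  "mahal S x = x \<bullet> (matrix_inv S *v x)"

abbreviation normal_law :: "real^'n^'n \<Rightarrow> (real^'n) measure" where
  "normal_law S \<equiv> gibbs (mahal S)"

lemma mahal_measurable [measurable]: "mahal S \<in> borel_measurable borel"
  unfolding mahal_def by measurable

lemma mahal_scale: "mahal S (c *\<^sub>R x) = c\<^sup>2 * mahal S x"
  by (simp add: mahal_def matrix_vector_mult_scaleR power2_eq_square)

text \<open>The constant in \<open>mvn_density\<close> is the right one because the law of \<open>X\<close> has total mass 1.\<close>

lemma gaussian_law:
  fixes X :: "'a \<Rightarrow> real^'n"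
  assumes "prob_space M" and X: "gaussian M X S"
  shows "X \<in> borel_measurable M" "distr M borel X = normal_law S" "gibbs_mass (mahal S) < \<infinity>"
proof -
  interpret prob_space M by fact
  define c where "c = sqrt ((2 * pi) ^ CARD('n) * det S)"
  have D: "distributed M lborel X (\<lambda>x. ennreal (exp (- mahal S x / 2) / c))"
    using X by (simp add: gaussian_def mvn_density_def mahal_def c_def)
  show X [measurable]: "X \<in> borel_measurable M"
    using distributed_measurable[OF D] by simp
  have d: "distr M lborel X = density lborel (\<lambda>x. ennreal (exp (- mahal S x / 2) / c))"
    using D by (rule distributed_distr_eq_density[symmetric, THEN sym])
  have "1 = emeasure (distr M lborel X) UNIV"
    by (subst emeasure_distr) (auto simp: emeasure_space_1)
  also have "\<dots> = (\<integral>\<^sup>+x. ennreal (exp (- mahal S x / 2) / c) \<partial>lborel)"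
    unfolding d by (subst emeasure_density) auto
  finally have 1: "(\<integral>\<^sup>+x. ennreal (exp (- mahal S x / 2) / c) \<partial>lborel) = 1" by simp
  have c: "c > 0"
  proof (rule ccontr)
    assume "\<not> c > 0"
    then have "ennreal (exp (- mahal S x / 2) / c) = 0" for x
      by (intro ennreal_neg) (simp add: divide_nonneg_nonpos)
    with 1 show False by simp
  qed
  have e: "ennreal (exp (- mahal S x / 2) / c) = ennreal (exp (- mahal S x / 2)) * ennreal (1 /
      c)" for x
    using c by (simp flip: ennreal_mult)
  have m: "gibbs_mass (mahal S) * ennreal (1 / c) = 1"
    using 1 unfolding e by (simp add: nn_integral_multc gibbs_mass_def)
  then show fin: "gibbs_mass (mahal S) < \<infinity>"
    using c by (auto simp: less_top[symmetric] ennreal_top_mult)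
  have "inverse (gibbs_mass (mahal S)) = ennreal (1 / c)"
    using m fin gibbs_mass_nonzero[of "mahal S"]
    by (metis mahal_measurable ennreal_divide_self divide_ennreal_def mult.assoc mult.commute
        mult_1 less_irrefl infinity_ennreal_def)
  then have "density lborel (\<lambda>x. ennreal (exp (- mahal S x / 2) / c)) = normal_law S"
    unfolding gibbs_def e by simp
  moreover have "distr M lborel X = distr M borel X" by (rule distr_cong) auto
  ultimately show "distr M borel X = normal_law S" using d by simp
qed

lemma gibbs_uminus:
  assumes [measurable]: "q \<in> borel_measurable borel" and q: "\<And>x. q (- x) = q x"
  shows "distr (gibbs q) borel uminus = gibbs q"
proof (rule measure_eqI)
  fix A assume "A \<in> sets (distr (gibbs q) borel uminus)"
  then have [measurable]: "A \<in> sets borel" by simp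
  have "emeasure (distr (gibbs q) borel uminus) A = (\<integral>\<^sup>+x. indicator A x \<partial>distr (gibbs q) borel
      uminus)"
    by simp
  also have "\<dots> = (\<integral>\<^sup>+x. indicator A (- x) \<partial>gibbs q)"
    by (rule nn_integral_distr) simp_all
  also have "\<dots> = (\<integral>\<^sup>+x. indicator A x \<partial>gibbs q)"
    by (subst (1 2) nn_integral_gibbs, simp_all,
        subst (2) nn_integral_lborel_scale[of _ "-1"], simp_all add: q)
  also have "\<dots> = emeasure (gibbs q) A" by simp
  finally show "emeasure (distr (gibbs q) borel uminus) A = emeasure (gibbs q) A" .
qed simp

lemma gibbs_square:
  fixes s :: real assumes "0 < s"
  shows "gibbs (\<lambda>z::real. z\<^sup>2 / s) = density lborel (normal_density 0 (sqrt s))"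
    "gibbs_mass (\<lambda>z::real. z\<^sup>2 / s) < \<infinity>"
proof -
  define c where "c = 1 / sqrt (2 * pi * s)"
  have c: "c > 0" using assms by (simp add: c_def)
  have nd: "ennreal (normal_density 0 (sqrt s) z) = ennreal (exp (- (z\<^sup>2 / s) / 2)) * ennreal c"
      for z
    using assms by (simp add: normal_density_def c_def flip: ennreal_mult)
  interpret prob_space "density lborel (normal_density 0 (sqrt s))"
    by (rule prob_space_normal_density) (use assms in simp)
  have "1 = (\<integral>\<^sup>+z. ennreal (normal_density 0 (sqrt s) z) \<partial>lborel)"
    using emeasure_space_1 by (simp add: emeasure_density)
  also have "\<dots> = gibbs_mass (\<lambda>z::real. z\<^sup>2 / s) * ennreal c"
    unfolding nd gibbs_mass_def by (rule nn_integral_multc) simp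
  finally have m: "gibbs_mass (\<lambda>z::real. z\<^sup>2 / s) * ennreal c = 1" by simp
  then show fin: "gibbs_mass (\<lambda>z::real. z\<^sup>2 / s) < \<infinity>"
    using c by (auto simp: less_top[symmetric] ennreal_top_mult)
  have "inverse (gibbs_mass (\<lambda>z::real. z\<^sup>2 / s)) = ennreal c"
  proof -
    let ?m = "gibbs_mass (\<lambda>z::real. z\<^sup>2 / s)"
    have "ennreal c = ?m * ennreal c * inverse ?m"
      using fin gibbs_mass_nonzero[of "\<lambda>z::real. z\<^sup>2 / s"]
      by (simp add: mult.commute[of ?m] mult_divide_eq_ennreal flip: divide_ennreal_def)
    then show ?thesis by (simp add: m)
  qed
  then show "gibbs (\<lambda>z::real. z\<^sup>2 / s) = density lborel (normal_density 0 (sqrt s))"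
    unfolding gibbs_def nd by simp
qed

lemma nn_integral_normal_shifted_square:
  fixes c s :: real assumes "0 < s"
  shows "(\<integral>\<^sup>+v. ennreal ((v + c)\<^sup>2) \<partial>gibbs (\<lambda>z::real. z\<^sup>2 / s)) = ennreal (s + c\<^sup>2)"
proof -
  let ?d = "normal_density 0 (sqrt s)"
  have s: "0 < sqrt s" using assms by simp
  have 2: "has_bochner_integral lborel (\<lambda>x. ?d x * x\<^sup>2) s"
    using normal_moment_even[OF s, of 0 1] assms by (simp add: numeral_2_eq_2)
  have 1: "has_bochner_integral lborel (\<lambda>x. ?d x * x) 0"
    using normal_moment_odd[OF s, of 0 0] by simp
  have 0: "has_bochner_integral lborel (\<lambda>x. ?d x) 1"
    using normal_moment_even[OF s, of 0 0] by simp
  have "has_bochner_integral lborel (\<lambda>x. ?d x * x\<^sup>2 + 2 * c * (?d x * x) + c\<^sup>2 * ?d x)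
      (s + 2 * c * 0 + c\<^sup>2 * 1)"
    by (intro has_bochner_integral_add has_bochner_integral_mult_right 0 1 2)
  then have "has_bochner_integral lborel (\<lambda>x. ?d x * (x + c)\<^sup>2) (s + c\<^sup>2)"
    by (simp add: power2_sum algebra_simps)
  then have "(\<integral>\<^sup>+x. ennreal (?d x * (x + c)\<^sup>2) \<partial>lborel) = ennreal (s + c\<^sup>2)"
    by (subst nn_integral_eq_integral) (auto simp: has_bochner_integral_iff)
  then show ?thesis
    by (simp add: gibbs_square(1)[OF assms] nn_integral_density flip: ennreal_mult')
qed

lemma pos_def_inverse:
  assumes S: "pos_def S"
  shows "S ** matrix_inv S = mat 1" "matrix_inv S ** S = mat 1"
    "transpose (matrix_inv S) = matrix_inv S" "pos_def (matrix_inv S)"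
proof -
  have "S *v x = 0 \<Longrightarrow> x = 0" for x
    using S unfolding pos_def_def by (metis inner_zero_right less_irrefl)
  then have "invertible S"
    by (simp add: invertible_left_inverse matrix_left_invertible_ker)
  then have "S ** matrix_inv S = mat 1 \<and> matrix_inv S ** S = mat 1"
    unfolding matrix_inv_def invertible_def by (rule someI_ex)
  then show 1: "S ** matrix_inv S = mat 1" "matrix_inv S ** S = mat 1" by auto
  have "transpose (matrix_inv S) ** S = mat 1"
    using arg_cong[OF 1(1), of transpose] S by (simp add: matrix_transpose_mul pos_def_def)
  then have "transpose (matrix_inv S) ** (S ** matrix_inv S) = mat 1 ** matrix_inv S"
    by (simp only: matrix_mul_assoc)
  then show T: "transpose (matrix_inv S) = matrix_inv S" by (simp add: 1)
  have "0 < x \<bullet> (matrix_inv S *v x)" if "x \<noteq> 0" for x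
  proof -
    define y where "y = matrix_inv S *v x"
    have x: "x = S *v y" by (simp add: y_def matrix_vector_mul_assoc 1)
    with that have "y \<noteq> 0" by auto
    then have "0 < y \<bullet> (S *v y)" using S by (simp add: pos_def_def)
    then show ?thesis by (simp add: x[symmetric] inner_commute flip: y_def)
  qed
  then show "pos_def (matrix_inv S)" using T by (simp add: pos_def_def)
qed

lemma matrix_vector_left_inverse: "X ** Y = mat 1 \<Longrightarrow> X *v (Y *v x) = x"
  by (simp add: matrix_vector_mul_assoc)

text \<open>Completing the square. Here \<open>P\<close> and \<open>R\<close> are the covariances of the unknown and of the
    measurement
  noise, \<open>Q\<close> and \<open>T\<close> their inverses, and \<open>U\<close> is the inverse of the covariance of the measurement.\<close>

lemma quadratic_form_split:
  fixes P Q :: "real^'n^'n" and C :: "real^'n^'p" and R T U :: "real^'p^'p"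
  assumes sym: "transpose Q = Q" "transpose R = R" "transpose T = T"
    and QP: "Q ** P = mat 1" and TR: "T ** R = mat 1"
    and SU: "(C ** P ** transpose C + R) ** U = mat 1"
    and e: "e = r + P *v (transpose C *v (U *v z))"
  shows "e \<bullet> (Q *v e) + (z - C *v e) \<bullet> (T *v (z - C *v e)) =
    (r \<bullet> (Q *v r) + (C *v r) \<bullet> (T *v (C *v r))) + z \<bullet> (U *v z)"
proof -
  define k where "k = U *v z"
  define l where "l = P *v (transpose C *v k)"
  have e': "e = r + l" by (simp add: e l_def k_def)
  have Ql: "Q *v l = transpose C *v k" by (simp add: l_def QP matrix_vector_left_inverse)
  have z: "z = C *v l + R *v k"
    using arg_cong[OF SU, of "\<lambda>X. X *v z"]
    by (simp add: l_def k_def matrix_vector_mult_add_rdistrib flip: matrix_vector_mul_assoc)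
  have d: "z - C *v e = R *v k - C *v r"
    by (simp add: e' matrix_vector_right_distrib) (simp add: z)
  have lQ: "l \<bullet> (Q *v x) = (C *v x) \<bullet> k" for x
    using Ql sym(1) by (metis inner_matrix_vector inner_commute)
  have RT: "(R *v k) \<bullet> (T *v x) = k \<bullet> x" for x
    by (metis TR inner_commute inner_matrix_vector matrix_vector_left_inverse sym(3))
  have rC: "x \<bullet> (transpose C *v k) = (C *v x) \<bullet> k" for x
    by (simp add: inner_matrix_vector)
  have "e \<bullet> (Q *v e) + (z - C *v e) \<bullet> (T *v (z - C *v e)) =
     (r + l) \<bullet> (Q *v r + transpose C *v k) + (R *v k - C *v r) \<bullet> (k - T *v (C *v r))"
    unfolding d by (simp add: e' matrix_vector_right_distrib Ql matrix_vector_mult_diff_distrib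
      TR matrix_vector_left_inverse)
  also have "\<dots> = (r \<bullet> (Q *v r) + (C *v r) \<bullet> (T *v (C *v r))) + (C *v l + R *v k) \<bullet> k"
    by (simp add: inner_add_left inner_add_right inner_diff_left inner_diff_right lQ rC RT
        inner_commute matrix_vector_right_distrib)
  finally show ?thesis by (simp flip: z k_def)
qed

text \<open>The Woodbury identity. It turns the exponent of the estimation error back into a covariance,
    so that
  the posterior can serve as the prior of the next observation.\<close>

lemma posterior_precision:
  fixes P Q :: "real^'n^'n" and C :: "real^'n^'p" and R T U :: "real^'p^'p"
  assumes PQ: "P ** Q = mat 1" and RT: "R ** T = mat 1"
    and US: "U ** (C ** P ** transpose C + R) = mat 1"
  shows "(P - P ** transpose C ** U ** C ** P) ** (Q + transpose C ** T ** C) = mat 1"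
proof -
  have "(P - P ** transpose C ** U ** C ** P) *v ((Q + transpose C ** T ** C) *v x) = x" for x
  proof -
    define t where "t = T *v (C *v x)"
    define g where "g = P *v (transpose C *v t)"
    have "(Q + transpose C ** T ** C) *v x = Q *v x + transpose C *v t"
      by (simp add: t_def matrix_vector_mult_add_rdistrib matrix_vector_mul_assoc matrix_mul_assoc)
    then have a: "P *v ((Q + transpose C ** T ** C) *v x) = x + g"
      by (simp add: g_def matrix_vector_right_distrib PQ matrix_vector_left_inverse)
    have "C *v (x + g) = (C ** P ** transpose C + R) *v t"
      by (simp add: g_def t_def matrix_vector_right_distrib matrix_vector_mult_add_rdistrib
          RT matrix_vector_left_inverse flip: matrix_vector_mul_assoc)
    then have b: "U *v (C *v (x + g)) = t" by (simp add: US matrix_vector_left_inverse)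
    show ?thesis
      by (simp add: matrix_vector_mult_diff_rdistrib a b flip: matrix_vector_mul_assoc)
         (simp flip: g_def)
  qed
  then show ?thesis by (simp add: matrix_eq matrix_vector_mul_assoc)
qed

lemma pos_def_innovation:
  assumes "pos_def R" "pos_semidef P"
  shows "pos_def (C ** P ** transpose C + R)"
proof -
  have "x \<bullet> ((C ** P ** transpose C) *v x) = (transpose C *v x) \<bullet> (P *v (transpose C *v x))" for x
    by (simp add: inner_matrix_vector flip: matrix_vector_mul_assoc)
  moreover have "transpose (C ** P ** transpose C + R) = C ** P ** transpose C + R"
    using assms by (simp add: pos_def_def pos_semidef_def matrix_transpose_mul matrix_mul_assoc
      transpose_add)
  ultimately show ?thesis
    using assms by (auto simp: pos_def_def pos_semidef_def matrix_vector_mult_add_rdistrib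
        inner_add_right intro: add_nonneg_pos)
qed

lemma pos_def_imp_pos_semidef: "pos_def S \<Longrightarrow> pos_semidef S"
  unfolding pos_def_def pos_semidef_def by (metis inner_zero_left less_eq_real_def)

text \<open>Reduction to one dimension: if \<open>v\<close> is standard normal and independent of \<open>x\<close>, then \<open>v + a \<bullet>
    x\<close> is
  normal with variance \<open>1 + a \<bullet> (S *v a)\<close>, and its second moment exceeds that of \<open>a \<bullet> x\<close> by 1.\<close>

lemma normal_second_moment:
  fixes a :: "real^'n"
  assumes S: "pos_def S" and fin: "gibbs_mass (mahal S) < \<infinity>"
  shows "(\<integral>\<^sup>+x. ennreal ((a \<bullet> x)\<^sup>2) \<partial>normal_law S) = ennreal (a \<bullet> (S *v a))"
proof -
  define s where "s = 1 + a \<bullet> (S *v a)"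
  have nn: "0 \<le> a \<bullet> (S *v a)"
    using pos_def_imp_pos_semidef[OF S] by (simp add: pos_semidef_def)
  then have s: "0 < s" by (simp add: s_def)
  interpret prob_space "normal_law S" by (rule prob_space_gibbs) (use fin in auto)
  interpret gibbs_observation "mahal S" "\<lambda>r. mahal S r + (a \<bullet> r)\<^sup>2" "\<lambda>v. v\<^sup>2 / 1" "\<lambda>z. z\<^sup>2 / s"
     "\<lambda>e. a \<bullet> e" "\<lambda>z. (z / s) *\<^sub>R (S *v a)"
  proof unfold_locales
    show "gibbs_mass (\<lambda>v::real. v\<^sup>2 / 1) < \<infinity>" by (rule gibbs_square) simp
    fix r and z :: real
    define k where "k = z / s"
    have z: "z = s * k" using s by (simp add: k_def)
    have Sym: "(S *v a) \<bullet> (matrix_inv S *v x) = a \<bullet> x" for x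
      using S pos_def_inverse[OF S]
      by (metis inner_matrix_vector matrix_vector_left_inverse pos_def_def)
    have "mahal S (r + k *\<^sub>R (S *v a)) = mahal S r + 2 * k * (a \<bullet> r) + k\<^sup>2 * (a \<bullet> (S *v a))"
      using pos_def_inverse[OF S]
      by (simp add: mahal_def matrix_vector_right_distrib matrix_vector_mult_scaleR inner_add_left
        inner_add_right Sym matrix_vector_left_inverse power2_eq_square algebra_simps inner_commute)
    moreover have "(z - a \<bullet> (r + k *\<^sub>R (S *v a)))\<^sup>2 = (k - a \<bullet> r)\<^sup>2"
      by (simp add: z s_def inner_add_right algebra_simps)
    moreover have "z\<^sup>2 / s = s * k\<^sup>2"
      using s by (simp add: z power2_eq_square)
    ultimately have "mahal S (r + k *\<^sub>R (S *v a)) + (z - a \<bullet> (r + k *\<^sub>R (S *v a)))\<^sup>2 / 1 =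
        mahal S r + (a \<bullet> r)\<^sup>2 + z\<^sup>2 / s"
      by (simp add: s_def power2_eq_square algebra_simps)
    then show "mahal S (r + (z / s) *\<^sub>R (S *v a)) + (z - a \<bullet> (r + (z / s) *\<^sub>R (S *v a)))\<^sup>2 / 1 =
        mahal S r + (a \<bullet> r)\<^sup>2 + z\<^sup>2 / s" by (simp add: k_def)
  qed (use fin in measurable)
  have "(\<integral>\<^sup>+e. ennreal (1 + (a \<bullet> e)\<^sup>2) \<partial>normal_law S) = ennreal (s + 0\<^sup>2)"
    using nn_integral_observation1[of "\<lambda>z. ennreal (z\<^sup>2)"]
      nn_integral_normal_shifted_square[OF s, of 0] nn_integral_normal_shifted_square[of 1]
    by simp
  then have "1 + (\<integral>\<^sup>+e. ennreal ((a \<bullet> e)\<^sup>2) \<partial>normal_law S) = 1 + ennreal (a \<bullet> (S *v a))"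
    using nn emeasure_space_1 by (simp add: nn_integral_add s_def)
  then show ?thesis by (simp add: ennreal_add_left_cancel)
qed

text \<open>One step of the filter is two observations. The first one exchanges prediction error and
    measurement
  noise for the innovation and the filtering error \<open>r\<close>, which are independent. The second one treats
  the next prediction error \<open>w + A r\<close> as an observation of \<open>r\<close>; its covariance is \<open>P\<close> by the Riccati
  equation.\<close>

lemma kalman_step:
  fixes P Sw :: "real^'n^'n" and C :: "real^'n^'p" and H :: "(real^'p) \<times> (real^'n) \<Rightarrow> ennreal"
  assumes P: "pos_def P" "riccati A C Sw Sv P" and Sw: "pos_def Sw" and Sv: "pos_def Sv"
    and fin: "gibbs_mass (mahal P) < \<infinity>" "gibbs_mass (mahal Sw) < \<infinity>" "gibbs_mass (mahal Sv) < \<infinity>"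
    and H [measurable]: "H \<in> borel_measurable (borel \<Otimes>\<^sub>M borel)"
  defines "Sz \<equiv> innovation_cov C Sv P"
  defines "L \<equiv> \<lambda>z. P *v (transpose C *v (matrix_inv Sz *v z))"
  shows "(\<integral>\<^sup>+e. \<integral>\<^sup>+v. \<integral>\<^sup>+w. H (v + C *v e, w + A *v (e - L (v + C *v e)))
      \<partial>normal_law Sw \<partial>normal_law Sv \<partial>normal_law P) =
    (\<integral>\<^sup>+z. \<integral>\<^sup>+e. H (z, e) \<partial>normal_law P \<partial>normal_law Sz)"
    "gibbs_mass (mahal Sz) < \<infinity>"
proof -
  have Sz: "pos_def Sz"
    unfolding Sz_def innovation_cov_def
    by (intro pos_def_innovation Sv pos_def_imp_pos_semidef P)
  note iP = pos_def_inverse[OF P(1)] and iSw = pos_def_inverse[OF Sw]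
    and iSv = pos_def_inverse[OF Sv] and iSz = pos_def_inverse[OF Sz]
  have symP: "transpose P = P" "transpose Sw = Sw" "transpose Sv = Sv" "transpose Sz = Sz"
    using P Sw Sv Sz by (auto simp: pos_def_def)
  define qr where "qr = (\<lambda>r. mahal P r + mahal Sv (C *v r))"
  \<comment> \<open>The inverse covariance and the covariance of the filtering error.\<close>
  define Q' where "Q' = matrix_inv P + transpose C ** matrix_inv Sv ** C"
  define P' where "P' = P - P ** transpose C ** matrix_inv Sz ** C ** P"
  have PQ': "P' ** Q' = mat 1"
    unfolding P'_def Q'_def
    by (rule posterior_precision[OF iP(1) iSv(1)]) (use iSz(2) in \<open>simp add: Sz_def
        innovation_cov_def\<close>)
  have qr: "qr r = r \<bullet> (Q' *v r)" for r
    by (simp add: qr_def Q'_def mahal_def matrix_vector_mult_add_rdistrib inner_add_right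
        inner_matrix_vector flip: matrix_vector_mul_assoc)
  have [measurable]: "qr \<in> borel_measurable borel" unfolding qr_def by measurable
  have [measurable]: "L \<in> borel_measurable borel" unfolding L_def by measurable
  interpret o1: gibbs_observation "mahal P" qr "mahal Sv" "mahal Sz" "\<lambda>e. C *v e" L
  proof unfold_locales
    fix r z
    show "mahal P (r + L z) + mahal Sv (z - C *v (r + L z)) = qr r + mahal Sz z"
      unfolding mahal_def qr_def L_def
      by (rule quadratic_form_split[OF iP(3) symP(3) iSv(3) iP(2) iSv(2) _ refl])
         (use iSz(1) in \<open>simp add: Sz_def innovation_cov_def\<close>)
  qed (use fin in measurable)
  show "gibbs_mass (mahal Sz) < \<infinity>" by (rule o1.mass_finite)
  have symQ': "transpose Q' = Q'"
    by (simp add: Q'_def transpose_add matrix_transpose_mul matrix_mul_assoc iP(3) iSv(3))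
  have PP: "A ** P' ** transpose A + Sw = P"
  proof -
    have "A ** P' ** transpose A = A ** P ** transpose A - A ** P ** transpose C ** matrix_inv Sz
        ** C ** P ** transpose A"
      unfolding P'_def by (simp add: matrix_eq matrix_vector_mult_diff_rdistrib
        matrix_vector_mult_diff_distrib flip: matrix_vector_mul_assoc)
    then show ?thesis
      using P(2) unfolding riccati_def Sz_def innovation_cov_def by simp
  qed
  define L' where "L' = (\<lambda>x. P' *v (transpose A *v (matrix_inv P *v x)))"
  interpret o2: gibbs_observation qr "\<lambda>r. qr r + mahal Sw (A *v r)" "mahal Sw" "mahal P" "\<lambda>r. A *v
      r" L'
  proof unfold_locales
    show "gibbs_mass qr < \<infinity>" by (rule o1.mass_finite)
    fix r z
    show "qr (r + L' z) + mahal Sw (z - A *v (r + L' z)) = qr r + mahal Sw (A *v r) + mahal P z"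
      unfolding mahal_def qr L'_def
      by (rule quadratic_form_split[OF symQ' symP(2) iSw(3) _ iSw(2) _ refl])
         (use PQ' in \<open>simp_all add: PP iP matrix_left_right_inverse[of Q']\<close>)
    show "L' \<in> borel_measurable borel" unfolding L'_def by measurable
  qed (use fin in measurable)
  have "(\<integral>\<^sup>+e. \<integral>\<^sup>+v. \<integral>\<^sup>+w. H (v + C *v e, w + A *v (e - L (v + C *v e)))
      \<partial>normal_law Sw \<partial>normal_law Sv \<partial>normal_law P) =
     (\<integral>\<^sup>+z. \<integral>\<^sup>+r. \<integral>\<^sup>+w. H (z, w + A *v r) \<partial>normal_law Sw \<partial>gibbs qr \<partial>normal_law Sz)"
  proof -
    interpret w: prob_space "normal_law Sw" by (rule prob_space_gibbs) (use fin in auto)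
    have "(\<lambda>x. \<integral>\<^sup>+w. H (fst x, w + A *v snd x) \<partial>normal_law Sw) \<in>
       borel_measurable (borel \<Otimes>\<^sub>M borel)" by measurable
    from o1.nn_integral_observation[OF this] show ?thesis by simp
  qed
  also have "\<dots> = (\<integral>\<^sup>+z. \<integral>\<^sup>+e. H (z, e) \<partial>normal_law P \<partial>normal_law Sz)"
    by (intro nn_integral_cong o2.nn_integral_observation1) measurable
  finally show "(\<integral>\<^sup>+e. \<integral>\<^sup>+v. \<integral>\<^sup>+w. H (v + C *v e, w + A *v (e - L (v + C *v e)))
      \<partial>normal_law Sw \<partial>normal_law Sv \<partial>normal_law P) =
    (\<integral>\<^sup>+z. \<integral>\<^sup>+e. H (z, e) \<partial>normal_law P \<partial>normal_law Sz)" .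
qed

section \<open>The Riccati equation and stability of the filter\<close>

text \<open>The Joseph form \<open>P = (A - K C) P (A - K C)^T + K Sv K^T + Sw\<close> of the Riccati equation, a sum
    of
  nonnegative terms from which definiteness and stability can be read off.\<close>

lemma riccati_joseph:
  fixes P Sw :: "real^'n^'n" and C :: "real^'n^'p"
  assumes P: "pos_semidef P" "riccati A C Sw Sv P" and Sv: "pos_def Sv"
  defines "K \<equiv> kalman_gain A C Sv P"
  shows "y \<bullet> (P *v y) = (transpose (A - K ** C) *v y) \<bullet> (P *v (transpose (A - K ** C) *v y))
     + (transpose K *v y) \<bullet> (Sv *v (transpose K *v y)) + y \<bullet> (Sw *v y)"
proof -
  define M where "M = C ** P ** transpose C + Sv"
  have M: "pos_def M" unfolding M_def by (intro pos_def_innovation Sv P)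
  note iM = pos_def_inverse[OF M]
  have sym: "transpose P = P" "transpose M = M"
    using P M by (auto simp: pos_def_def pos_semidef_def)
  have K: "K = A ** P ** transpose C ** matrix_inv M"
    by (simp add: K_def kalman_gain_def innovation_cov_def M_def)
  define a where "a = transpose A *v y"
  define c where "c = C *v (P *v a)"
  define k where "k = transpose K *v y"
  have k: "k = matrix_inv M *v c"
    by (simp add: k_def K c_def a_def matrix_transpose_mul sym iM flip: matrix_vector_mul_assoc)
  have Mk: "M *v k = c" by (simp add: k matrix_vector_left_inverse iM)
  have b: "transpose (A - K ** C) *v y = a - transpose C *v k"
  proof -
    have "transpose (A - K ** C) = transpose A - transpose C ** transpose K"
      by (simp flip: matrix_transpose_mul) (simp add: vec_eq_iff transpose_def)
    then show ?thesis
      by (simp add: a_def k_def matrix_vector_mult_diff_rdistrib flip: matrix_vector_mul_assoc)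
  qed
  have Pc: "(transpose C *v x) \<bullet> (P *v a) = x \<bullet> c" for x
    by (simp add: c_def inner_matrix_vector)
  have Pc': "a \<bullet> (P *v (transpose C *v x)) = x \<bullet> c" for x
    by (metis Pc inner_commute inner_matrix_vector sym(1))
  have Mk': "(transpose C *v k) \<bullet> (P *v (transpose C *v k)) + k \<bullet> (Sv *v k) = k \<bullet> c"
    unfolding Mk[symmetric]
    by (simp add: M_def matrix_vector_mult_add_rdistrib inner_add_right inner_matrix_vector
        flip: matrix_vector_mul_assoc)
  have "y \<bullet> (P *v y) = a \<bullet> (P *v a) - c \<bullet> k + y \<bullet> (Sw *v y)"
  proof -
    have "P *v y = A *v (P *v a) - A *v (P *v (transpose C *v k)) + Sw *v y"
      by (subst P(2)[unfolded riccati_def])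
        (simp add: matrix_vector_mult_add_rdistrib matrix_vector_mult_diff_rdistrib k c_def a_def
          flip: matrix_vector_mul_assoc M_def)
    then show ?thesis
      using Pc'[of k]
      by (simp add: inner_add_right inner_diff_right a_def inner_matrix_vector inner_commute)
  qed
  then show ?thesis
    unfolding b k_def[symmetric] using Mk' Pc[of k] Pc'[of k]
    by (simp add: matrix_vector_mult_diff_distrib inner_diff_left inner_diff_right inner_commute)
qed

lemma riccati_pos_def:
  assumes P: "pos_semidef P" "riccati A C Sw Sv P" and Sv: "pos_def Sv" and Sw: "pos_def Sw"
  shows "pos_def P"
proof -
  have "0 < y \<bullet> (P *v y)" if "y \<noteq> 0" for y
  proof -
    have "0 \<le> x \<bullet> (P *v x)" "0 \<le> z \<bullet> (Sv *v z)" "0 < y \<bullet> (Sw *v y)" for x z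
      using P Sw that pos_def_imp_pos_semidef[OF Sv] by (auto simp: pos_def_def pos_semidef_def)
    then show ?thesis
      by (subst riccati_joseph[OF P Sv]) (simp add: add_nonneg_pos)
  qed
  then show ?thesis using P by (simp add: pos_def_def pos_semidef_def)
qed

lemma quadratic_form_le:
  fixes S :: "real^'n^'n"
  obtains b where "0 < b" "\<And>x. x \<bullet> (S *v x) \<le> b * (norm x)\<^sup>2"
proof -
  obtain b where b: "0 < b" "\<And>x. norm (S *v x) \<le> norm x * b"
    using bounded_linear.pos_bounded[OF matrix_vector_mul_bounded_linear] by blast
  have "x \<bullet> (S *v x) \<le> b * (norm x)\<^sup>2" for x
  proof -
    have "x \<bullet> (S *v x) \<le> norm x * norm (S *v x)" by (rule norm_cauchy_schwarz)
    also have "\<dots> \<le> norm x * (norm x * b)" by (intro mult_left_mono b) simp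
    finally show ?thesis by (simp add: power2_eq_square mult_ac)
  qed
  with b(1) show ?thesis by (rule that)
qed

lemma pos_def_ge:
  fixes S :: "real^'n^'n"
  assumes S: "pos_def S"
  obtains b where "0 < b" "\<And>x. b * (norm x)\<^sup>2 \<le> x \<bullet> (S *v x)"
proof -
  have "sphere 0 1 \<noteq> ({} :: (real^'n) set)" by simp
  moreover have "continuous_on (sphere 0 1) (\<lambda>x::real^'n. x \<bullet> (S *v x))"
    by (intro continuous_intros linear_continuous_on matrix_vector_mul_bounded_linear)
  ultimately obtain u where u: "u \<in> sphere 0 1" "\<forall>x\<in>sphere 0 1. u \<bullet> (S *v u) \<le> x \<bullet> (S *v x)"
    using continuous_attains_inf[OF compact_sphere] by blast
  have "u \<noteq> 0" using u by auto
  then have pos: "0 < u \<bullet> (S *v u)" using S by (simp add: pos_def_def)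
  have "u \<bullet> (S *v u) * (norm x)\<^sup>2 \<le> x \<bullet> (S *v x)" for x
  proof (cases "x = 0")
    case False
    define e where "e = x /\<^sub>R norm x"
    have "e \<in> sphere 0 1" using False by (simp add: e_def)
    then have "u \<bullet> (S *v u) \<le> e \<bullet> (S *v e)" using u by blast
    moreover have x: "x = norm x *\<^sub>R e" using False by (simp add: e_def)
    have "x \<bullet> (S *v x) = (norm x)\<^sup>2 * (e \<bullet> (S *v e))"
      by (subst (1 2) x) (simp add: matrix_vector_mult_scaleR power2_eq_square)
    ultimately show ?thesis by (simp add: mult.commute mult_right_mono)
  qed simp
  with pos show ?thesis by (rule that)
qed

text \<open>By the Joseph form the transpose of \<open>A - K C\<close> is a strict contraction for the quadratic form
    of \<open>P\<close>,
  as \<open>Sw\<close> dominates a multiple of \<open>P\<close>. The powers of \<open>A - K C\<close> itself are bounded by duality.\<close>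

lemma error_dynamics_stable:
  fixes P Sw :: "real^'n^'n" and C :: "real^'n^'p"
  assumes P: "pos_semidef P" "riccati A C Sw Sv P" and Sv: "pos_def Sv" and Sw: "pos_def Sw"
  defines "F \<equiv> A - kalman_gain A C Sv P ** C"
  obtains c \<gamma> where "0 < c" "0 \<le> \<gamma>" "\<gamma> < 1" "\<And>k s. norm (((*v) F ^^ k) s) \<le> c * \<gamma> ^ k * norm s"
proof -
  have pdP: "pos_def P" by (rule riccati_pos_def[OF assms(1-4)])
  obtain a where a: "0 < a" "\<And>x. a * (norm x)\<^sup>2 \<le> x \<bullet> (P *v x)" using pos_def_ge[OF pdP] by blast
  obtain b where b: "0 < b" "\<And>x. x \<bullet> (P *v x) \<le> b * (norm x)\<^sup>2" using quadratic_form_le[of P] by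
      blast
  obtain d where d: "0 < d" "\<And>x. d * (norm x)\<^sup>2 \<le> x \<bullet> (Sw *v x)" using pos_def_ge[OF Sw] by blast
  \<comment> \<open>The maximum makes the rate nonnegative without a comparison of \<open>d\<close> and \<open>b\<close>.\<close>
  define g where "g = max 0 (1 - d / b)"
  have g: "0 \<le> g" "g < 1" using b d by (auto simp: g_def)
  have step: "(transpose F *v y) \<bullet> (P *v (transpose F *v y)) \<le> g * (y \<bullet> (P *v y))" for y
  proof -
    have "0 \<le> z \<bullet> (Sv *v z)" for z
      using pos_def_imp_pos_semidef[OF Sv] by (simp add: pos_semidef_def)
    then have "(transpose F *v y) \<bullet> (P *v (transpose F *v y)) \<le> y \<bullet> (P *v y) - y \<bullet> (Sw *v y)"
      using riccati_joseph[OF P Sv, of y] by (simp add: F_def)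
    also have "\<dots> \<le> y \<bullet> (P *v y) - d / b * (y \<bullet> (P *v y))"
    proof -
      have "d / b * (y \<bullet> (P *v y)) \<le> d / b * (b * (norm y)\<^sup>2)"
        using b d by (intro mult_left_mono) auto
      also have "\<dots> \<le> y \<bullet> (Sw *v y)" using d b by simp
      finally show ?thesis by simp
    qed
    also have "\<dots> = (1 - d / b) * (y \<bullet> (P *v y))" by (simp add: algebra_simps)
    also have "\<dots> \<le> g * (y \<bullet> (P *v y))"
      using P by (intro mult_right_mono) (auto simp: g_def pos_semidef_def)
    finally show ?thesis .
  qed
  have iter: "(((*v) (transpose F) ^^ k) y) \<bullet> (P *v (((*v) (transpose F) ^^ k) y)) \<le> g ^ k * (y \<bullet>
      (P *v y))" for k y
  proof (induction k)
    case (Suc k)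
    then show ?case
      using step[of "((*v) (transpose F) ^^ k) y"] mult_left_mono[OF Suc g(1)] by (simp add:
          mult.assoc)
  qed simp
  define \<gamma> where "\<gamma> = sqrt g"
  have \<gamma>: "0 \<le> \<gamma>" "\<gamma> < 1" using g by (auto simp: \<gamma>_def)
  have transp: "norm (((*v) (transpose F) ^^ k) y) \<le> sqrt (b / a) * \<gamma> ^ k * norm y" for k y
  proof (rule power2_le_imp_le)
    have "a * (norm (((*v) (transpose F) ^^ k) y))\<^sup>2 \<le> g ^ k * (y \<bullet> (P *v y))"
      using a(2) iter order_trans by blast
    also have "\<dots> \<le> g ^ k * (b * (norm y)\<^sup>2)" using b g by (intro mult_left_mono) auto
    finally have "(norm (((*v) (transpose F) ^^ k) y))\<^sup>2 \<le> g ^ k * (b * (norm y)\<^sup>2) / a"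
      using a by (simp add: field_simps)
    also have "\<dots> = (sqrt (b / a) * \<gamma> ^ k * norm y)\<^sup>2"
    proof -
      have "(\<gamma> ^ k)\<^sup>2 = g ^ k"
        using g by (metis \<gamma>_def mult.commute power_mult real_sqrt_pow2)
      then show ?thesis using a b by (simp add: power_mult_distrib)
    qed
    finally show "(norm (((*v) (transpose F) ^^ k) y))\<^sup>2 \<le> (sqrt (b / a) * \<gamma> ^ k * norm y)\<^sup>2" .
  qed (use a b \<gamma> in auto)
  have adj: "((*v) F ^^ k) s \<bullet> y = s \<bullet> ((*v) (transpose F) ^^ k) y" for k s y
  proof (induction k arbitrary: y)
    case (Suc k)
    have "((*v) F ^^ Suc k) s \<bullet> y = ((*v) F ^^ k) s \<bullet> (transpose F *v y)"
      by (simp add: inner_matrix_vector)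
    also have "\<dots> = s \<bullet> ((*v) (transpose F) ^^ k) (transpose F *v y)" by (rule Suc.IH)
    finally show ?case by (simp add: funpow_swap1)
  qed simp
  have "norm (((*v) F ^^ k) s) \<le> sqrt (b / a) * \<gamma> ^ k * norm s" for k s
  proof (cases "((*v) F ^^ k) s = 0")
    case False
    define y where "y = ((*v) F ^^ k) s"
    have "norm y * norm y = y \<bullet> y" by (simp add: norm_eq_sqrt_inner)
    also have "\<dots> = s \<bullet> ((*v) (transpose F) ^^ k) y" unfolding y_def by (rule adj)
    also have "\<dots> \<le> norm s * norm (((*v) (transpose F) ^^ k) y)" by (rule norm_cauchy_schwarz)
    also have "\<dots> \<le> norm s * (sqrt (b / a) * \<gamma> ^ k * norm y)" by (intro mult_left_mono transp) simp
    finally have "norm y * norm y \<le> (sqrt (b / a) * \<gamma> ^ k * norm s) * norm y" by (simp add: mult_ac)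
    then show ?thesis using False by (simp add: y_def)
  qed (use a b \<gamma> in auto)
  then show ?thesis by (rule that[rotated 3]) (use a b \<gamma> in auto)
qed

section \<open>Independence of the innovations\<close>

lemma measurable_append [measurable (raw)]:
  fixes f :: "'a \<Rightarrow> nat \<Rightarrow> 'b::topological_space"
  assumes "f \<in> measurable N (PiM {1..k} (\<lambda>_. borel))" "g \<in> borel_measurable N"
  shows "(\<lambda>x. (f x)(Suc k := g x)) \<in> measurable N (PiM {1..Suc k} (\<lambda>_. borel))"
proof -
  have "(\<lambda>x. (\<lambda>(f, y). f(Suc k := y)) (f x, g x)) \<in>
      measurable N (PiM (insert (Suc k) {1..k}) (\<lambda>_. borel))"
    by (rule measurable_compose[OF measurable_Pair[OF assms] measurable_add_dim])
  then show ?thesis by (simp add: atLeastAtMostSuc_conv)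
qed

locale noise_sources = prob_space M
  for M :: "'a measure" and S :: "'s measure" and x1 :: "'a \<Rightarrow> real^'n"
    and w :: "nat \<Rightarrow> 'a \<Rightarrow> real^'n" and v \<zeta> :: "nat \<Rightarrow> 'a \<Rightarrow> real^'p" and \<rho> :: "'a \<Rightarrow> 's" +
  assumes indep: "independent_sources M S x1 w v \<zeta> \<rho>"
    and rho: "\<rho> \<in> measurable M S"
begin

definition all_sources :: "source set" where
  "all_sources = {Initial, Controller} \<union> Process ` {1..} \<union> Sensor ` {1..} \<union> Attacker ` {1..}"

definition known :: "source set \<Rightarrow> 'a measure" where
  "known I = sigma (space M) (\<Union>s\<in>I. source_sets M S x1 w v \<zeta> \<rho> s)"

lemma source_sets_events: "s \<in> all_sources \<Longrightarrow> source_sets M S x1 w v \<zeta> \<rho> s \<subseteq> events"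
  using indep unfolding independent_sources_def indep_sets_def all_sources_def by blast

lemma source_sets_space: "source_sets M S x1 w v \<zeta> \<rho> s \<subseteq> Pow (space M)"
  by (cases s; simp add: source_sets_def; metis sets.space_closed space_vimage_algebra)

lemma Int_stable_source_sets: "Int_stable (source_sets M S x1 w v \<zeta> \<rho> s)"
  by (cases s) (simp_all add: Int_stable_def source_sets_def sets.Int)

lemma space_known [simp]: "space (known I) = space M"
  unfolding known_def using source_sets_space by (intro space_measure_of) auto

lemma sets_known: "sets (known I) = sigma_sets (space M) (\<Union>s\<in>I. source_sets M S x1 w v \<zeta> \<rho> s)"
  unfolding known_def using source_sets_space by (intro sets_measure_of) auto

lemma measurable_mono_source:
  assumes f: "f \<in> measurable M1 N" and "space M1 = space M2" "sets M1 \<subseteq> sets M2"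
  shows "f \<in> measurable M2 N"
  using measurable_sets[OF f] measurable_space[OF f] assms(2,3) by (intro measurableI) auto

lemma known_mono:
  assumes "I \<subseteq> J" "f \<in> measurable (known I) N"
  shows "f \<in> measurable (known J) N"
proof (rule measurable_mono_source[OF assms(2)])
  show "sets (known I) \<subseteq> sets (known J)"
    unfolding sets_known using assms(1) by (intro sigma_sets_mono') auto
qed simp

lemma known_events:
  assumes "I \<subseteq> all_sources" "f \<in> measurable (known I) N"
  shows "f \<in> measurable M N"
proof (rule measurable_mono_source[OF assms(2)])
  show "sets (known I) \<subseteq> events"
    unfolding sets_known using assms(1) source_sets_events by (intro sets.sigma_sets_subset) blast
qed simp

lemma measurable_known:
  assumes "s \<in> I" "f \<in> space M \<rightarrow> space N"
    "source_sets M S x1 w v \<zeta> \<rho> s = sets (vimage_algebra (space M) f N)"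
  shows "f \<in> measurable (known I) N"
proof (rule measurableI)
  fix A assume "A \<in> sets N"
  then have "f -` A \<inter> space M \<in> source_sets M S x1 w v \<zeta> \<rho> s"
    unfolding assms(3) by (rule in_vimage_algebra)
  then show "f -` A \<inter> space (known I) \<in> sets (known I)"
    using \<open>s \<in> I\<close> by (auto simp: sets_known)
qed (use assms in auto)

lemma known_x1: "Initial \<in> I \<Longrightarrow> x1 \<in> borel_measurable (known I)"
  by (rule measurable_known[of Initial]) (simp_all add: source_sets_def)

lemma known_w: "Process k \<in> I \<Longrightarrow> w k \<in> borel_measurable (known I)"
  by (rule measurable_known[of "Process k"]) (simp_all add: source_sets_def)

lemma known_v: "Sensor k \<in> I \<Longrightarrow> v k \<in> borel_measurable (known I)"
  by (rule measurable_known[of "Sensor k"]) (simp_all add: source_sets_def)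

lemma known_zeta: "Attacker k \<in> I \<Longrightarrow> \<zeta> k \<in> borel_measurable (known I)"
  by (rule measurable_known[of "Attacker k"]) (simp_all add: source_sets_def)

lemma known_rho: "Controller \<in> I \<Longrightarrow> \<rho> \<in> measurable (known I) S"
  using measurable_space[OF rho]
  by (intro measurable_known[of Controller]) (simp_all add: source_sets_def)

text \<open>Disjoint blocks of independent sources generate independent \<open>\<sigma>\<close>-algebras. The conclusion is
    about the
  joint law because \<open>X\<close> and \<open>Y\<close> may have different types of values.\<close>

lemma indep_known:
  assumes X: "X \<in> measurable (known I) N" and Y: "Y \<in> measurable (known J) N'"
    and IJ: "I \<subseteq> all_sources" "J \<subseteq> all_sources" "I \<inter> J = {}"
  shows "distr M N X \<Otimes>\<^sub>M distr M N' Y = distr M (N \<Otimes>\<^sub>M N') (\<lambda>\<omega>. (X \<omega>, Y \<omega>))"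
proof -
  let ?F = "source_sets M S x1 w v \<zeta> \<rho>"
  have "indep_sets ?F (\<Union>b\<in>UNIV. case_bool I J b)"
    using indep IJ unfolding independent_sources_def all_sources_def
    by (elim indep_sets_mono_index[rotated]) (auto simp: UNIV_bool)
  then have "indep_sets (\<lambda>b. sigma_sets (space M) (\<Union>s\<in>case_bool I J b. ?F s)) UNIV"
    by (rule indep_sets_collect_sigma)
      (use IJ in \<open>auto simp: Int_stable_source_sets disjoint_family_on_def split: bool.splits\<close>)
  then have "indep_sets (case_bool (sets (known I)) (sets (known J))) UNIV"
    by (rule indep_sets_mono_sets) (auto simp: sets_known split: bool.splits)
  then have indep: "indep_set (sets (known I)) (sets (known J))"
    by (simp add: indep_set_def)
  note [measurable] = known_events[OF IJ(1) X] known_events[OF IJ(2) Y]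
  show ?thesis
  proof (rule pair_measure_eqI)
    fix A B assume "A \<in> sets (distr M N X)" "B \<in> sets (distr M N' Y)"
    then have [measurable]: "A \<in> sets N" "B \<in> sets N'" by auto
    have "prob ((X -` A \<inter> space M) \<inter> (Y -` B \<inter> space M)) =
        prob (X -` A \<inter> space M) * prob (Y -` B \<inter> space M)"
      using indep measurable_sets[OF X, of A] measurable_sets[OF Y, of B]
      by (simp add: indep_sets2_eq)
    moreover have "(X -` A \<inter> space M) \<inter> (Y -` B \<inter> space M) =
        (\<lambda>\<omega>. (X \<omega>, Y \<omega>)) -` (A \<times> B) \<inter> space M" by auto
    ultimately show "emeasure (distr M N X) A * emeasure (distr M N' Y) B =
        emeasure (distr M (N \<Otimes>\<^sub>M N') (\<lambda>\<omega>. (X \<omega>, Y \<omega>))) (A \<times> B)"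
      by (simp add: emeasure_distr emeasure_eq_measure flip: ennreal_mult)
  qed (auto intro!: prob_space_imp_sigma_finite prob_space_distr)
qed

lemma nn_integral_fresh:
  assumes X: "X \<in> measurable (known I) N" and Y: "Y \<in> measurable (known J) N'"
    and IJ: "I \<subseteq> all_sources" "J \<subseteq> all_sources" "I \<inter> J = {}"
    and F [measurable]: "F \<in> borel_measurable (N \<Otimes>\<^sub>M N')"
  shows "(\<integral>\<^sup>+\<omega>. F (X \<omega>, Y \<omega>) \<partial>M) = (\<integral>\<^sup>+\<omega>. \<integral>\<^sup>+y. F (X \<omega>, y) \<partial>distr M N' Y \<partial>M)"
proof -
  note [measurable] = known_events[OF IJ(1) X] known_events[OF IJ(2) Y]
  interpret Y: prob_space "distr M N' Y" by (rule prob_space_distr) simp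
  have "(\<integral>\<^sup>+\<omega>. F (X \<omega>, Y \<omega>) \<partial>M) = (\<integral>\<^sup>+p. F p \<partial>distr M (N \<Otimes>\<^sub>M N') (\<lambda>\<omega>. (X \<omega>, Y \<omega>)))"
    by (simp add: nn_integral_distr)
  also have "\<dots> = (\<integral>\<^sup>+p. F p \<partial>(distr M N X \<Otimes>\<^sub>M distr M N' Y))"
    by (simp add: indep_known[OF X Y IJ])
  also have "\<dots> = (\<integral>\<^sup>+x. \<integral>\<^sup>+y. F (x, y) \<partial>distr M N' Y \<partial>distr M N X)"
    by (rule Y.nn_integral_fst[symmetric]) simp
  also have "\<dots> = (\<integral>\<^sup>+\<omega>. \<integral>\<^sup>+y. F (X \<omega>, y) \<partial>distr M N' Y \<partial>M)"
    by (rule nn_integral_distr) measurable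
  finally show ?thesis .
qed

end

text \<open>Prediction error and innovation depend on the noise alone, since plant and filter receive
    the same
  input. Therefore no control law appears here. The measurement update has gain \<open>L\<close>, the filter \<open>A
      L\<close>.\<close>

locale kalman_filter = noise_sources M S x1 w v \<zeta> \<rho>
  for M :: "'a measure" and S :: "'s measure" and x1 :: "'a \<Rightarrow> real^'n"
    and w :: "nat \<Rightarrow> 'a \<Rightarrow> real^'n" and v \<zeta> :: "nat \<Rightarrow> 'a \<Rightarrow> real^'p" and \<rho> :: "'a \<Rightarrow> 's" +
  fixes A :: "real^'n^'n" and C :: "real^'n^'p" and P Sw :: "real^'n^'n" and Sv Sz :: "real^'p^'p"
    and err :: "nat \<Rightarrow> 'a \<Rightarrow> real^'n" and z :: "nat \<Rightarrow> 'a \<Rightarrow> real^'p" and L :: "real^'p \<Rightarrow> real^'n"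
  assumes pd: "pos_def P" "pos_def Sw" "pos_def Sv"
    and ric: "riccati A C Sw Sv P"
    and Sz_eq: "Sz = innovation_cov C Sv P"
    and L_eq: "L = (\<lambda>z. P *v (transpose C *v (matrix_inv Sz *v z)))"
    and x1_law: "gaussian M x1 P"
    and w_law: "\<And>k. 1 \<le> k \<Longrightarrow> gaussian M (w k) Sw"
    and v_law: "\<And>k. 1 \<le> k \<Longrightarrow> gaussian M (v k) Sv"
    and err_1: "\<And>\<omega>. \<omega> \<in> space M \<Longrightarrow> err 1 \<omega> = x1 \<omega>"
    and innovation: "\<And>k \<omega>. \<omega> \<in> space M \<Longrightarrow> 1 \<le> k \<Longrightarrow> z k \<omega> = v k \<omega> + C *v err k \<omega>"
    and err_Suc: "\<And>k \<omega>. \<omega> \<in> space M \<Longrightarrow> 1 \<le> k \<Longrightarrow>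
      err (k + 1) \<omega> = w k \<omega> + A *v (err k \<omega> - L (z k \<omega>))"
begin

lemma mass_finite:
  "gibbs_mass (mahal P) < \<infinity>" "gibbs_mass (mahal Sw) < \<infinity>" "gibbs_mass (mahal Sv) < \<infinity>"
  using gaussian_law(3)[OF prob_space_axioms x1_law] gaussian_law(3)[OF prob_space_axioms w_law[of
      1]]
    gaussian_law(3)[OF prob_space_axioms v_law[of 1]] by auto

lemma mass_finite_Sz: "gibbs_mass (mahal Sz) < \<infinity>"
  unfolding Sz_eq by (rule kalman_step(2)[OF pd(1) ric pd(2,3) mass_finite, of "\<lambda>_. 0"]) simp

lemma pos_def_Sz: "pos_def Sz"
  unfolding Sz_eq innovation_cov_def by (intro pos_def_innovation pd pos_def_imp_pos_semidef)

lemma prob_space_laws: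
  "prob_space (normal_law P)" "prob_space (normal_law Sw)" "prob_space (normal_law Sv)"
  "prob_space (normal_law Sz)"
  using mass_finite mass_finite_Sz by (auto intro!: prob_space_gibbs)

definition past :: "nat \<Rightarrow> source set" where
  "past n = {Initial} \<union> Process ` {1..<n} \<union> Sensor ` {1..<n}"

lemma L_measurable [measurable]: "L \<in> borel_measurable borel"
  unfolding L_eq by measurable

lemma known_err_z:
  assumes "1 \<le> n" "past n \<subseteq> I"
  shows "err n \<in> borel_measurable (known I)" "\<And>k. 1 \<le> k \<Longrightarrow> k < n \<Longrightarrow> z k \<in> borel_measurable (known I)"
proof -
  have "err n \<in> borel_measurable (known I) \<and> (\<forall>k. 1 \<le> k \<longrightarrow> k < n \<longrightarrow> z k \<in> borel_measurable (known I))"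
    using assms
  proof (induction n rule: nat_induct_at_least)
    case base
    have "x1 \<in> borel_measurable (known I)"
      by (rule known_x1) (use base in \<open>auto simp: past_def\<close>)
    then show ?case
      using err_1 measurable_cong[of "known I" "err 1" x1 borel] by simp
  next
    case (Suc n)
    have sub: "past n \<subseteq> I" using Suc.prems by (auto simp: past_def)
    note IH = Suc.IH[OF sub]
    have [measurable]: "err n \<in> borel_measurable (known I)" using IH by simp
    have [measurable]: "w n \<in> borel_measurable (known I)" "v n \<in> borel_measurable (known I)"
      using Suc.prems Suc.hyps by (auto intro!: known_w known_v simp: past_def)
    have "(\<lambda>\<omega>. v n \<omega> + C *v err n \<omega>) \<in> borel_measurable (known I)" by measurable
    then have zn [measurable]: "z n \<in> borel_measurable (known I)"
      using innovation Suc.hyps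
        measurable_cong[of "known I" "z n" "\<lambda>\<omega>. v n \<omega> + C *v err n \<omega>" borel] by simp
    have "(\<lambda>\<omega>. w n \<omega> + A *v (err n \<omega> - L (z n \<omega>))) \<in> borel_measurable (known I)" by measurable
    then have "err (Suc n) \<in> borel_measurable (known I)"
      using err_Suc Suc.hyps
        measurable_cong[of "known I" "err (Suc n)" "\<lambda>\<omega>. w n \<omega> + A *v (err n \<omega> - L (z n \<omega>))" borel]
      by simp
    then show ?case using IH zn by (auto simp: less_Suc_eq)
  qed
  then show "err n \<in> borel_measurable (known I)"
    "\<And>k. 1 \<le> k \<Longrightarrow> k < n \<Longrightarrow> z k \<in> borel_measurable (known I)" by auto
qed

lemma past_subset: "past n \<subseteq> all_sources"
  by (auto simp: past_def all_sources_def)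

end

text \<open>At the times in \<open>J\<close> the noise of the attacker masks the innovation, while the rest of that
    noise may
  enter \<open>c\<close> together with the seed of the controller. The empty \<open>J\<close> describes the nominal run. For
  the attacked run, \<open>J\<close> leaves out the finitely many times whose noise determines the transient.\<close>

locale masked_innovations = kalman_filter M S x1 w v \<zeta> \<rho> A C P Sw Sv Sz err z L
  for M :: "'a measure" and S :: "'s measure" and x1 :: "'a \<Rightarrow> real^'n"
    and w :: "nat \<Rightarrow> 'a \<Rightarrow> real^'n" and v \<zeta> :: "nat \<Rightarrow> 'a \<Rightarrow> real^'p" and \<rho> :: "'a \<Rightarrow> 's"
    and A :: "real^'n^'n" and C :: "real^'n^'p" and P Sw :: "real^'n^'n" and Sv Sz :: "real^'p^'p"
    and err :: "nat \<Rightarrow> 'a \<Rightarrow> real^'n" and z :: "nat \<Rightarrow> 'a \<Rightarrow> real^'p" and L :: "real^'p \<Rightarrow> real^'n" +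
  fixes J :: "nat set" and N\<zeta> N\<eta> :: "(real^'p) measure" and MC :: "'c measure" and c :: "'a \<Rightarrow> 'c"
    and \<eta> :: "nat \<Rightarrow> 'a \<Rightarrow> real^'p"
  assumes \<zeta>_law: "\<And>n. 1 \<le> n \<Longrightarrow> distr M borel (\<zeta> n) = N\<zeta>"
    and N\<zeta>: "prob_space N\<zeta>" "sets N\<zeta> = sets borel"
    and N\<eta>: "prob_space N\<eta>" "sets N\<eta> = sets borel"
    and convolution: "\<And>g :: real^'p \<Rightarrow> ennreal. g \<in> borel_measurable borel \<Longrightarrow>
      (\<integral>\<^sup>+z. \<integral>\<^sup>+y. g (z + y) \<partial>N\<zeta> \<partial>normal_law Sz) = (\<integral>\<^sup>+h. g h \<partial>N\<eta>)"
    and c: "c \<in> measurable (known ({Controller} \<union> Attacker ` ({1..} - J))) MC"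
    and \<eta>_def: "\<And>n \<omega>. \<eta> n \<omega> = (if n \<in> J then z n \<omega> + \<zeta> n \<omega> else z n \<omega>)"
begin

definition \<eta>_law :: "nat \<Rightarrow> (real^'p) measure" where
  "\<eta>_law n = (if n \<in> J then N\<eta> else normal_law Sz)"

definition \<xi>_law :: "nat \<Rightarrow> (real^'p) measure" where
  "\<xi>_law n = (if n \<in> J then N\<zeta> else return borel 0)"

definition seen :: "nat \<Rightarrow> source set" where
  "seen n = past n \<union> {Controller} \<union> Attacker ` ({1..} - J) \<union> Attacker ` (J \<inter> {1..<n})"

lemma sets_\<eta>_law [measurable_cong, simp]: "sets (\<eta>_law n) = sets borel"
  using N\<eta> by (simp add: \<eta>_law_def)

lemma sets_\<xi>_law [measurable_cong, simp]: "sets (\<xi>_law n) = sets borel"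
  using N\<zeta> by (simp add: \<xi>_law_def)

lemma prob_space_\<eta>_law: "prob_space (\<eta>_law n)"
  using N\<eta> prob_space_laws by (simp add: \<eta>_law_def)

lemma prob_space_\<xi>_law: "prob_space (\<xi>_law n)"
  using N\<zeta> by (simp add: \<xi>_law_def prob_space_return)

lemma convolution_\<eta>:
  fixes g :: "real^'p \<Rightarrow> ennreal"
  assumes g [measurable]: "g \<in> borel_measurable borel"
  shows "(\<integral>\<^sup>+z. \<integral>\<^sup>+y. g (z + y) \<partial>\<xi>_law n \<partial>normal_law Sz) = (\<integral>\<^sup>+h. g h \<partial>\<eta>_law n)"
  using convolution[OF g] by (auto simp: \<xi>_law_def \<eta>_law_def nn_integral_return)

lemma seen_subset: "seen n \<subseteq> all_sources"
  using past_subset[of n] by (auto simp: seen_def all_sources_def)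

lemma product_sigma_finite_\<eta>_law: "product_sigma_finite \<eta>_law"
  by (intro product_sigma_finite.intro prob_space_imp_sigma_finite prob_space_\<eta>_law)

lemma sets_PiM_\<eta>_law: "sets (PiM K \<eta>_law) = sets (PiM K (\<lambda>_. borel))"
  by (intro sets_PiM_cong) auto

lemma known_\<eta>: "1 \<le> k \<Longrightarrow> k < n \<Longrightarrow> \<eta> k \<in> borel_measurable (known (seen n))"
proof -
  assume k: "1 \<le> k" "k < n"
  have [measurable]: "z k \<in> borel_measurable (known (seen n))"
    by (rule known_err_z(2)) (use k in \<open>auto simp: seen_def\<close>)
  show ?thesis
  proof (cases "k \<in> J")
    case True
    then have [measurable]: "\<zeta> k \<in> borel_measurable (known (seen n))"
      using k by (intro known_zeta) (auto simp: seen_def)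
    show ?thesis using True by (simp add: \<eta>_def cong: measurable_cong)
  qed (simp add: \<eta>_def cong: measurable_cong)
qed

lemma known_c: "c \<in> measurable (known (seen n)) MC"
  by (rule known_mono[OF _ c]) (auto simp: seen_def)

text \<open>Induction over time. The noise of the next time step is fresh and can be integrated out,
    after which
  \<open>kalman_step\<close> produces an independent innovation and the next prediction error. The prediction
  error belongs to the statement because the next step starts from its law.\<close>

theorem innovations_law:
  fixes F :: "'c \<times> (nat \<Rightarrow> real^'p) \<times> (real^'n) \<Rightarrow> ennreal"
  assumes "F \<in> borel_measurable (MC \<Otimes>\<^sub>M PiM {1..k} (\<lambda>_. borel) \<Otimes>\<^sub>M borel)"
  shows "(\<integral>\<^sup>+\<omega>. F (c \<omega>, (\<lambda>n\<in>{1..k}. \<eta> n \<omega>), err (k + 1) \<omega>) \<partial>M) =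
    (\<integral>\<^sup>+\<omega>. \<integral>\<^sup>+h. \<integral>\<^sup>+e. F (c \<omega>, h, e) \<partial>normal_law P \<partial>PiM {1..k} \<eta>_law \<partial>M)"
  using assms
proof (induction k arbitrary: F)
  case 0
  interpret product_sigma_finite \<eta>_law by (rule product_sigma_finite_\<eta>_law)
  have F [measurable]: "F \<in> borel_measurable (MC \<Otimes>\<^sub>M PiM {} (\<lambda>_. borel) \<Otimes>\<^sub>M borel)"
    using 0 by simp
  have u [measurable]: "(\<lambda>_. undefined) \<in> space (PiM {} (\<lambda>_. borel))" by (simp add: space_PiM)
  have "(\<integral>\<^sup>+\<omega>. F (c \<omega>, (\<lambda>_. undefined), x1 \<omega>) \<partial>M) =
      (\<integral>\<^sup>+\<omega>. \<integral>\<^sup>+e. F (c \<omega>, (\<lambda>_. undefined), e) \<partial>distr M borel x1 \<partial>M)"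
    using nn_integral_fresh[OF c known_x1[of "{Initial}"], of "\<lambda>(c, e). F (c, (\<lambda>_. undefined), e)"]
    by (auto simp: all_sources_def)
  moreover have "(\<integral>\<^sup>+h. \<integral>\<^sup>+e. F (c \<omega>, h, e) \<partial>normal_law P \<partial>PiM {1..0} \<eta>_law) =
      (\<integral>\<^sup>+e. F (c \<omega>, (\<lambda>_. undefined), e) \<partial>normal_law P)" for \<omega>
    by (simp add: PiM_empty nn_integral_count_space_finite)
  moreover have "(\<lambda>n\<in>{1..0}. \<eta> n \<omega>) = (\<lambda>_. undefined)" for \<omega> by (simp add: fun_eq_iff)
  ultimately show ?case
    unfolding gaussian_law(2)[OF prob_space_axioms x1_law] using err_1
    by (simp cong: nn_integral_cong_simp)
next
  case (Suc k)
  interpret product_sigma_finite \<eta>_law by (rule product_sigma_finite_\<eta>_law)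
  interpret P: prob_space "normal_law P" by (rule prob_space_laws)
  interpret Sw: prob_space "normal_law Sw" by (rule prob_space_laws)
  interpret Sv: prob_space "normal_law Sv" by (rule prob_space_laws)
  interpret Sz: prob_space "normal_law Sz" by (rule prob_space_laws)
  interpret \<xi>: prob_space "\<xi>_law (Suc k)" by (rule prob_space_\<xi>_law)
  interpret \<eta>: prob_space "\<eta>_law (Suc k)" by (rule prob_space_\<eta>_law)
  define n where "n = Suc k"
  note F [measurable] = Suc.prems
  define \<xi> where "\<xi> \<omega> = (if n \<in> J then \<zeta> n \<omega> else 0)" for \<omega>
  define H where "H = (\<lambda>\<omega>. \<lambda>i\<in>{1..k}. \<eta> i \<omega>)"
  define X where "X \<omega> = (c \<omega>, H \<omega>, err n \<omega>)" for \<omega>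
  define N where "N = MC \<Otimes>\<^sub>M PiM {1..k} (\<lambda>_. borel :: (real^'p) measure) \<Otimes>\<^sub>M (borel :: (real^'n)
      measure)"
  define G where "G = (\<lambda>((((c, h, e), v), w), y). F (c, h(n := v + C *v e + y), w + A *v (e - L (v
      + C *v e))))"
  have G [measurable]: "G \<in> borel_measurable (((N \<Otimes>\<^sub>M borel) \<Otimes>\<^sub>M borel) \<Otimes>\<^sub>M borel)"
    unfolding G_def N_def n_def case_prod_unfold by measurable
  have X: "X \<in> measurable (known (seen n)) N"
    unfolding X_def N_def H_def
    by (intro measurable_Pair known_c measurable_restrict known_\<eta> known_err_z)
       (auto simp: n_def seen_def)
  have v: "v n \<in> borel_measurable (known {Sensor n})" by (simp add: known_v)
  have w: "w n \<in> borel_measurable (known {Process n})" by (simp add: known_w)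
  have y: "\<xi> \<in> borel_measurable (known (Attacker ` (J \<inter> {n})))"
    unfolding \<xi>_def by (cases "n \<in> J") (auto intro: known_zeta)
  have Xv: "(\<lambda>\<omega>. (X \<omega>, v n \<omega>)) \<in> measurable (known (seen n \<union> {Sensor n})) (N \<Otimes>\<^sub>M borel)"
    by (intro measurable_Pair known_mono[OF _ X] known_mono[OF _ v]) auto
  have Xvw: "(\<lambda>\<omega>. ((X \<omega>, v n \<omega>), w n \<omega>)) \<in>
      measurable (known (seen n \<union> {Sensor n} \<union> {Process n})) ((N \<Otimes>\<^sub>M borel) \<Otimes>\<^sub>M borel)"
    by (intro measurable_Pair known_mono[OF _ Xv] known_mono[OF _ w]) auto
  have n: "1 \<le> n" by (simp add: n_def)
  have y_law: "distr M borel \<xi> = \<xi>_law n"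
  proof (cases "n \<in> J")
    case True
    then have "\<xi> = \<zeta> n" by (simp add: \<xi>_def fun_eq_iff)
    then show ?thesis using True \<zeta>_law[OF n] by (simp add: \<xi>_law_def)
  next
    case False
    then have "\<xi> = (\<lambda>_. 0)" by (simp add: \<xi>_def fun_eq_iff)
    then show ?thesis using False by (simp add: \<xi>_law_def distr_const)
  qed
  have G2 [measurable]: "(\<lambda>x. \<integral>\<^sup>+y. G (x, y) \<partial>\<xi>_law n) \<in> borel_measurable ((N \<Otimes>\<^sub>M borel) \<Otimes>\<^sub>M borel)"
    unfolding n_def[symmetric] using \<xi>.borel_measurable_nn_integral_fst[of "\<lambda>p. G p"] by (simp
        add: n_def)
  have G3 [measurable]: "(\<lambda>x. \<integral>\<^sup>+w. \<integral>\<^sup>+y. G ((x, w), y) \<partial>\<xi>_law n \<partial>normal_law Sw) \<in>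
      borel_measurable (N \<Otimes>\<^sub>M borel)"
    using Sw.borel_measurable_nn_integral_fst[of "\<lambda>p. \<integral>\<^sup>+y. G (p, y) \<partial>\<xi>_law n"] by simp
  have G4 [measurable]: "(\<lambda>x. \<integral>\<^sup>+v. \<integral>\<^sup>+w. \<integral>\<^sup>+y. G (((x, v), w), y) \<partial>\<xi>_law n \<partial>normal_law Sw
      \<partial>normal_law Sv)
      \<in> borel_measurable N"
    using Sv.borel_measurable_nn_integral_fst[of "\<lambda>p. \<integral>\<^sup>+w. \<integral>\<^sup>+y. G ((p, w), y) \<partial>\<xi>_law n
        \<partial>normal_law Sw"] by simp
  have "(\<integral>\<^sup>+\<omega>. F (c \<omega>, (\<lambda>i\<in>{1..Suc k}. \<eta> i \<omega>), err (Suc k + 1) \<omega>) \<partial>M) =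
      (\<integral>\<^sup>+\<omega>. G (((X \<omega>, v n \<omega>), w n \<omega>), \<xi> \<omega>) \<partial>M)"
  proof (intro nn_integral_cong)
    fix \<omega> assume \<omega>: "\<omega> \<in> space M"
    have "(\<lambda>i\<in>{1..Suc k}. \<eta> i \<omega>) = (H \<omega>)(n := v n \<omega> + C *v err n \<omega> + \<xi> \<omega>)"
      using innovation[OF \<omega> n] by (auto simp: H_def fun_eq_iff \<eta>_def \<xi>_def n_def)
    then show "F (c \<omega>, (\<lambda>i\<in>{1..Suc k}. \<eta> i \<omega>), err (Suc k + 1) \<omega>) =
        G (((X \<omega>, v n \<omega>), w n \<omega>), \<xi> \<omega>)"
      using err_Suc[OF \<omega> n] innovation[OF \<omega> n] by (simp add: G_def X_def n_def)
  qed
  also have "\<dots> = (\<integral>\<^sup>+\<omega>. \<integral>\<^sup>+y. G (((X \<omega>, v n \<omega>), w n \<omega>), y) \<partial>\<xi>_law n \<partial>M)"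
    unfolding y_law[symmetric]
    by (rule nn_integral_fresh[OF Xvw y])
       (use n seen_subset[of n] in \<open>auto simp: all_sources_def seen_def past_def\<close>)
  also have "\<dots> = (\<integral>\<^sup>+\<omega>. \<integral>\<^sup>+w. \<integral>\<^sup>+y. G (((X \<omega>, v n \<omega>), w), y) \<partial>\<xi>_law n \<partial>normal_law Sw \<partial>M)"
    unfolding gaussian_law(2)[OF prob_space_axioms w_law[OF n], symmetric]
    by (rule nn_integral_fresh[OF Xv w])
       (use n seen_subset[of n] in \<open>auto simp: all_sources_def seen_def past_def\<close>)
  also have "\<dots> = (\<integral>\<^sup>+\<omega>. \<integral>\<^sup>+v. \<integral>\<^sup>+w. \<integral>\<^sup>+y. G (((X \<omega>, v), w), y) \<partial>\<xi>_law n \<partial>normal_law Sw \<partial>normal_law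
      Sv \<partial>M)"
    unfolding gaussian_law(2)[OF prob_space_axioms v_law[OF n], symmetric]
    by (rule nn_integral_fresh[OF X v])
       (use n seen_subset[of n] in \<open>auto simp: all_sources_def seen_def past_def\<close>)
  also have "\<dots> = (\<integral>\<^sup>+\<omega>. \<integral>\<^sup>+h. \<integral>\<^sup>+e. \<integral>\<^sup>+v. \<integral>\<^sup>+w. \<integral>\<^sup>+y. G ((((c \<omega>, h, e), v), w), y)
      \<partial>\<xi>_law n \<partial>normal_law Sw \<partial>normal_law Sv \<partial>normal_law P \<partial>PiM {1..k} \<eta>_law \<partial>M)"
    unfolding X_def H_def n_def Suc_eq_plus1[of k]
    by (rule Suc.IH) (use G4 in \<open>simp add: N_def n_def\<close>)
  also have "\<dots> = (\<integral>\<^sup>+\<omega>. \<integral>\<^sup>+h. \<integral>\<^sup>+e. F (c \<omega>, h, e) \<partial>normal_law P \<partial>PiM {1..Suc k} \<eta>_law \<partial>M)"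
  proof (intro nn_integral_cong)
    fix \<omega> assume \<omega>: "\<omega> \<in> space M"
    have c_space [measurable]: "c \<omega> \<in> space MC"
      using measurable_space[OF known_c] \<omega> by simp
    have "(\<integral>\<^sup>+e. \<integral>\<^sup>+v. \<integral>\<^sup>+w. \<integral>\<^sup>+y. G ((((c \<omega>, h, e), v), w), y)
        \<partial>\<xi>_law n \<partial>normal_law Sw \<partial>normal_law Sv \<partial>normal_law P) =
       (\<integral>\<^sup>+y. \<integral>\<^sup>+e. F (c \<omega>, h(n := y), e) \<partial>normal_law P \<partial>\<eta>_law n)"
      if h: "h \<in> space (PiM {1..k} \<eta>_law)" for h
    proof -
      have [measurable]: "h \<in> space (PiM {1..k} (\<lambda>_. borel))"
        using h sets_eq_imp_space_eq[OF sets_PiM_\<eta>_law[of "{1..k}"]] by simp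
      have Fh [measurable]: "(\<lambda>(y, e). F (c \<omega>, h(n := y), e)) \<in> borel_measurable (borel \<Otimes>\<^sub>M borel)"
        unfolding n_def by measurable
      have "(\<integral>\<^sup>+e. \<integral>\<^sup>+v. \<integral>\<^sup>+w. \<integral>\<^sup>+y. G ((((c \<omega>, h, e), v), w), y)
          \<partial>\<xi>_law n \<partial>normal_law Sw \<partial>normal_law Sv \<partial>normal_law P) =
        (\<integral>\<^sup>+e. \<integral>\<^sup>+v. \<integral>\<^sup>+w. (\<lambda>(z, e). \<integral>\<^sup>+y. F (c \<omega>, h(n := z + y), e) \<partial>\<xi>_law n)
            (v + C *v e, w + A *v (e - L (v + C *v e)))
          \<partial>normal_law Sw \<partial>normal_law Sv \<partial>normal_law P)"
        by (simp add: G_def)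
      also have "\<dots> = (\<integral>\<^sup>+z. \<integral>\<^sup>+e. (\<lambda>(z, e). \<integral>\<^sup>+y. F (c \<omega>, h(n := z + y), e) \<partial>\<xi>_law n) (z, e)
          \<partial>normal_law P \<partial>normal_law Sz)"
        unfolding L_eq Sz_eq
        by (rule kalman_step(1)[OF pd(1) ric pd(2,3) mass_finite]) (unfold n_def, measurable)
      also have "\<dots> = (\<integral>\<^sup>+z. \<integral>\<^sup>+y. \<integral>\<^sup>+e. F (c \<omega>, h(n := z + y), e) \<partial>normal_law P \<partial>\<xi>_law n
          \<partial>normal_law Sz)"
        unfolding prod.case
        by (intro nn_integral_cong pair_sigma_finite.Fubini')
           (unfold n_def, auto intro!: pair_sigma_finite.intro
             P.sigma_finite_measure_axioms \<xi>.sigma_finite_measure_axioms)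
      also have "\<dots> = (\<integral>\<^sup>+y. \<integral>\<^sup>+e. F (c \<omega>, h(n := y), e) \<partial>normal_law P \<partial>\<eta>_law n)"
        by (rule convolution_\<eta>) measurable
      finally show ?thesis .
    qed
    then have "(\<integral>\<^sup>+h. \<integral>\<^sup>+e. \<integral>\<^sup>+v. \<integral>\<^sup>+w. \<integral>\<^sup>+y. G ((((c \<omega>, h, e), v), w), y)
        \<partial>\<xi>_law n \<partial>normal_law Sw \<partial>normal_law Sv \<partial>normal_law P \<partial>PiM {1..k} \<eta>_law) =
      (\<integral>\<^sup>+h. \<integral>\<^sup>+y. \<integral>\<^sup>+e. F (c \<omega>, h(n := y), e) \<partial>normal_law P \<partial>\<eta>_law n \<partial>PiM {1..k} \<eta>_law)"
      by (intro nn_integral_cong) auto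
    also have "\<dots> = (\<integral>\<^sup>+h. \<integral>\<^sup>+e. F (c \<omega>, h, e) \<partial>normal_law P \<partial>PiM (insert n {1..k}) \<eta>_law)"
    proof (rule product_nn_integral_insert[symmetric])
      have "(\<lambda>h. \<integral>\<^sup>+e. F (c \<omega>, h, e) \<partial>normal_law P) \<in> borel_measurable (PiM {1..Suc k} (\<lambda>_. borel))"
        by measurable
      then show "(\<lambda>h. \<integral>\<^sup>+e. F (c \<omega>, h, e) \<partial>normal_law P) \<in> borel_measurable (PiM (insert n {1..k})
          \<eta>_law)"
        by (simp add: n_def atLeastAtMostSuc_conv measurable_cong_sets[OF sets_PiM_\<eta>_law refl])
    qed (auto simp: n_def)
    finally show "(\<integral>\<^sup>+h. \<integral>\<^sup>+e. \<integral>\<^sup>+v. \<integral>\<^sup>+w. \<integral>\<^sup>+y. G ((((c \<omega>, h, e), v), w), y)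
        \<partial>\<xi>_law n \<partial>normal_law Sw \<partial>normal_law Sv \<partial>normal_law P \<partial>PiM {1..k} \<eta>_law) =
       (\<integral>\<^sup>+h. \<integral>\<^sup>+e. F (c \<omega>, h, e) \<partial>normal_law P \<partial>PiM {1..Suc k} \<eta>_law)"
      by (simp add: n_def atLeastAtMostSuc_conv)
  qed
  finally show ?case .
qed

end

section \<open>Change of measure along a Gaussian sequence\<close>

text \<open>Densities multiply and maps act coordinatewise, so it suffices to compare both sides on
    rectangles.\<close>

lemma PiM_change_of_measure:
  fixes N N' :: "'i \<Rightarrow> 'b measure" and g :: "'i \<Rightarrow> 'b \<Rightarrow> ennreal" and T :: "'i \<Rightarrow> 'b \<Rightarrow> 'b"
  assumes I: "finite I"
    and N: "\<And>i. prob_space (N i)" "\<And>i. sets (N i) = sets B"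
    and N': "\<And>i. prob_space (N' i)" "\<And>i. sets (N' i) = sets B"
    and T: "\<And>i. T i \<in> measurable B B" and g: "\<And>i. g i \<in> borel_measurable B"
    and change: "\<And>i f. f \<in> borel_measurable B \<Longrightarrow>
      (\<integral>\<^sup>+x. f (T i x) * g i x \<partial>N i) = (\<integral>\<^sup>+x. f x \<partial>N' i)"
    and F: "F \<in> borel_measurable (PiM I (\<lambda>_. B))"
  shows "(\<integral>\<^sup>+x. F (\<lambda>i\<in>I. T i (x i)) * (\<Prod>i\<in>I. g i (x i)) \<partial>PiM I N) = (\<integral>\<^sup>+x. F x \<partial>PiM I N')"
proof -
  interpret N: product_sigma_finite N
    by (intro product_sigma_finite.intro prob_space_imp_sigma_finite N)
  interpret N': product_sigma_finite N'
    by (intro product_sigma_finite.intro prob_space_imp_sigma_finite N')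
  note [measurable_cong] = N(2) N'(2)
  note [measurable] = T g
  have sets_N: "sets (PiM I N) = sets (PiM I (\<lambda>_. B))"
    and sets_N': "sets (PiM I N') = sets (PiM I (\<lambda>_. B))"
    by (auto intro!: sets_PiM_cong simp: N N')
  have TI [measurable]: "(\<lambda>x. \<lambda>i\<in>I. T i (x i)) \<in> measurable (PiM I N) (PiM I N')"
    by measurable
  define Q where "Q = distr (density (PiM I N) (\<lambda>x. \<Prod>i\<in>I. g i (x i))) (PiM I N') (\<lambda>x. \<lambda>i\<in>I. T i (x
      i))"
  have gm [measurable]: "(\<lambda>x. \<Prod>i\<in>I. g i (x i)) \<in> borel_measurable (PiM I N)"
    by measurable
  have "Q = PiM I N'"
  proof (rule N'.PiM_eqI[OF I])
    show "sets Q = sets (PiM I N')" by (simp add: Q_def)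
    fix A assume A: "\<And>i. i \<in> I \<Longrightarrow> A i \<in> sets (N' i)"
    then have A_B: "\<And>i. i \<in> I \<Longrightarrow> A i \<in> sets B" by (simp add: N')
    have PA [measurable]: "Pi\<^sub>E I A \<in> sets (PiM I N')" by (intro sets_PiM_I_finite I A)
    have "emeasure Q (Pi\<^sub>E I A) = (\<integral>\<^sup>+x. indicator (Pi\<^sub>E I A) x \<partial>Q)"
      by (simp add: Q_def)
    also have "\<dots> = (\<integral>\<^sup>+x. (\<Prod>i\<in>I. g i (x i)) * indicator (Pi\<^sub>E I A) (\<lambda>i\<in>I. T i (x i)) \<partial>PiM I N)"
      unfolding Q_def by (subst nn_integral_distr) (simp_all add: nn_integral_density)
    also have "\<dots> = (\<integral>\<^sup>+x. (\<Prod>i\<in>I. indicator (A i) (T i (x i)) * g i (x i)) \<partial>PiM I N)"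
    proof (intro nn_integral_cong)
      fix x
      have "indicator (Pi\<^sub>E I A) (\<lambda>i\<in>I. T i (x i)) = (\<Prod>i\<in>I. indicator (A i) (T i (x i)) :: ennreal)"
        using I by (auto simp: indicator_def PiE_iff prod_zero_iff intro!: prod.neutral)
      then show "(\<Prod>i\<in>I. g i (x i)) * indicator (Pi\<^sub>E I A) (\<lambda>i\<in>I. T i (x i)) =
          (\<Prod>i\<in>I. indicator (A i) (T i (x i)) * g i (x i))"
        by (simp add: prod.distrib mult.commute)
    qed
    also have "\<dots> = (\<Prod>i\<in>I. \<integral>\<^sup>+x. indicator (A i) (T i x) * g i x \<partial>N i)"
    proof (rule N.product_nn_integral_prod[OF I])
      fix i assume "i \<in> I"
      then have [measurable]: "A i \<in> sets B" by (rule A_B)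
      show "(\<lambda>x. indicator (A i) (T i x) * g i x) \<in> borel_measurable (N i)" by measurable
    qed
    also have "\<dots> = (\<Prod>i\<in>I. emeasure (N' i) (A i))"
      using A A_B by (intro prod.cong) (auto simp: change)
    finally show "emeasure Q (Pi\<^sub>E I A) = (\<Prod>i\<in>I. emeasure (N' i) (A i))" .
  qed
  moreover have "F \<in> borel_measurable (PiM I N')"
    using F by (simp add: measurable_cong_sets[OF sets_N' refl])
  ultimately have "(\<integral>\<^sup>+x. F x \<partial>PiM I N') = (\<integral>\<^sup>+x. F x \<partial>Q)" and
    [measurable]: "F \<in> borel_measurable (PiM I N')"
    by auto
  then show ?thesis
    unfolding Q_def by (subst (asm) nn_integral_distr) (simp_all add: nn_integral_density
        mult.commute)
qed

text \<open>The cross term is absorbed by the inequality of Young with weight \<open>a\<close>. A small \<open>a\<close> keeps the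
    factor
  of \<open>x\<close> close to 1, at the expense of the factor of \<open>y\<close>.\<close>

lemma mahal_add_le:
  assumes S: "pos_def S" and a: "0 < a"
  shows "mahal S (x + y) \<le> (1 + a) * mahal S x + (1 + 1 / a) * mahal S y"
proof -
  note iS = pos_def_inverse[OF S]
  define b where "b = sqrt a"
  have b: "0 < b" "b * b = a" using a by (auto simp: b_def)
  have comm: "y \<bullet> (matrix_inv S *v x) = x \<bullet> (matrix_inv S *v y)" for x y
    by (metis iS(3) inner_commute inner_matrix_vector)
  have "0 \<le> mahal S (b *\<^sub>R x - (1 / b) *\<^sub>R y)"
    using pos_def_imp_pos_semidef[OF iS(4)] by (simp add: mahal_def pos_semidef_def)
  also have "\<dots> = b * b * mahal S x + (1 / (b * b)) * mahal S y - 2 * (x \<bullet> (matrix_inv S *v y))"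
    using b(1) by (simp add: mahal_def matrix_vector_mult_diff_distrib matrix_vector_mult_scaleR
      inner_diff_left inner_diff_right comm[of y x] algebra_simps)
  finally have "2 * (x \<bullet> (matrix_inv S *v y)) \<le> a * mahal S x + (1 / a) * mahal S y"
    unfolding b(2) by simp
  moreover have "mahal S (x + y) = mahal S x + mahal S y + 2 * (x \<bullet> (matrix_inv S *v y))"
    by (simp add: mahal_def matrix_vector_right_distrib inner_add_left inner_add_right comm[of y x])
  ultimately show ?thesis by (simp add: algebra_simps)
qed

lemma mahal_nonneg: "pos_def S \<Longrightarrow> 0 \<le> mahal S x"
  by (drule pos_def_inverse(4)[THEN pos_def_imp_pos_semidef]) (simp add: mahal_def pos_semidef_def)

lemma mahal_scaleR:
  assumes S: "pos_def S" and c: "0 < c"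
  shows "mahal (c *\<^sub>R S) x = mahal S x / c"
proof -
  have "(c *\<^sub>R S) ** ((1 / c) *\<^sub>R matrix_inv S) = mat 1"
    using matrix_vector_left_inverse[OF pos_def_inverse(1)[OF S]] c
    by (simp add: matrix_eq matrix_vector_mul_assoc[symmetric] scaleR_matrix_vector_assoc[symmetric]
        matrix_vector_mult_scaleR)
  then have "matrix_inv (c *\<^sub>R S) = (1 / c) *\<^sub>R matrix_inv S" by (rule matrix_inv_unique)
  then show ?thesis by (simp add: mahal_def scaleR_matrix_vector_assoc[symmetric])
qed

lemma pos_def_scaleR: "pos_def S \<Longrightarrow> 0 < c \<Longrightarrow> pos_def (c *\<^sub>R S)"
  by (auto simp: pos_def_def transpose_scalar scaleR_matrix_vector_assoc[symmetric])

locale scaled_normal =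
  fixes S :: "real^'p^'p"
  assumes S: "pos_def S" and fin: "gibbs_mass (mahal S) < \<infinity>"
begin

text \<open>The normal law with covariance \<open>c *\<^sub>R S\<close>, written with the exponent of \<open>S\<close> so that the
    constants for
  different \<open>c\<close> can be compared by scaling.\<close>

definition law :: "real \<Rightarrow> (real^'p) measure" where
  "law c = gibbs (\<lambda>x. mahal S x / c)"

lemma law_1: "law 1 = normal_law S" by (simp add: law_def)

lemma sets_law [simp, measurable_cong]: "sets (law c) = sets borel" by (simp add: law_def)

lemma mass_scaled: "0 < c \<Longrightarrow> gibbs_mass (\<lambda>x. mahal S x / c) = ennreal (sqrt c ^ CARD('p)) *
    gibbs_mass (mahal S)"
  using gibbs_mass_scale[of "mahal S" "1 / c"] by (simp add: mahal_scale real_sqrt_divide)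

lemma prob_space_law: "0 < c \<Longrightarrow> prob_space (law c)"
  unfolding law_def using fin by (intro prob_space_gibbs) (auto simp: mass_scaled
      ennreal_mult_less_top)

lemma nn_integral_law:
  assumes c: "0 < c" and [measurable]: "f \<in> borel_measurable borel"
  shows "(\<integral>\<^sup>+x. f x \<partial>law c) =
    (\<integral>\<^sup>+x. f x * ennreal (exp (- mahal S x / (2 * c)) / sqrt c ^ CARD('p)) \<partial>lborel) *
      inverse (gibbs_mass (mahal S))"
proof -
  have inv: "inverse (gibbs_mass (\<lambda>x. mahal S x / c)) =
      ennreal (1 / sqrt c ^ CARD('p)) * inverse (gibbs_mass (mahal S))"
    unfolding mass_scaled[OF c] using c fin
    by (subst ennreal_inverse_mult) (auto simp: inverse_ennreal inverse_eq_divide)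
  have "(\<integral>\<^sup>+x. f x \<partial>law c) = (\<integral>\<^sup>+x. f x * ennreal (exp (- (mahal S x / c) / 2)) \<partial>lborel) *
      ennreal (1 / sqrt c ^ CARD('p)) * inverse (gibbs_mass (mahal S))"
    unfolding law_def by (subst nn_integral_gibbs) (simp_all add: inv mult.assoc)
  also have "(\<integral>\<^sup>+x. f x * ennreal (exp (- (mahal S x / c) / 2)) \<partial>lborel) * ennreal (1 / sqrt c ^
      CARD('p)) =
     (\<integral>\<^sup>+x. f x * ennreal (exp (- mahal S x / (2 * c)) / sqrt c ^ CARD('p)) \<partial>lborel)"
    using c by (subst nn_integral_multc[symmetric])
      (simp_all add: mult.assoc ac_simps flip: ennreal_mult)
  finally show ?thesis .
qed

lemma nn_integral_law_exp:
  assumes c: "0 < c" and t: "c * t < 1"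
  shows "(\<integral>\<^sup>+x. ennreal (exp (t * mahal S x / 2)) \<partial>law c) = ennreal ((1 / sqrt (1 - c * t)) ^
      CARD('p))"
proof -
  define l where "l = 1 / c - t"
  have l: "0 < l" "c * l = 1 - c * t" using c t by (auto simp: l_def field_simps)
  have "(\<integral>\<^sup>+x. ennreal (exp (t * mahal S x / 2)) \<partial>law c) =
     (\<integral>\<^sup>+x. ennreal (exp (- (l * mahal S x) / 2)) * ennreal (1 / sqrt c ^ CARD('p)) \<partial>lborel) *
      inverse (gibbs_mass (mahal S))"
  proof -
    have "exp (t * mahal S x / 2) * (exp (- mahal S x / (2 * c)) / sqrt c ^ CARD('p)) =
        exp (- (l * mahal S x) / 2) * (1 / sqrt c ^ CARD('p))" for x
    proof -
      have "t * mahal S x / 2 + - mahal S x / (2 * c) = - (l * mahal S x) / 2"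
        using c by (simp add: l_def field_simps)
      then show ?thesis by (simp flip: exp_add)
    qed
    then show ?thesis
      using c by (subst nn_integral_law) (simp_all flip: ennreal_mult)
  qed
  also have "\<dots> = gibbs_mass (\<lambda>x. l * mahal S x) * ennreal (1 / sqrt c ^ CARD('p)) * inverse
      (gibbs_mass (mahal S))"
    unfolding gibbs_mass_def[of "\<lambda>x. l * mahal S x"] by (subst nn_integral_multc) simp_all
  also have "\<dots> = ennreal ((1 / sqrt l) ^ CARD('p) * (1 / sqrt c ^ CARD('p))) *
      (gibbs_mass (mahal S) * inverse (gibbs_mass (mahal S)))"
    using l c
    by (subst ennreal_mult, simp, simp, subst gibbs_mass_scale) (simp_all add: mahal_scale mult_ac)
  also have "gibbs_mass (mahal S) * inverse (gibbs_mass (mahal S)) = 1"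
    using fin gibbs_mass_nonzero[of "mahal S"] by (simp flip: divide_ennreal_def)
  also have "(1 / sqrt l) ^ CARD('p) * (1 / sqrt c ^ CARD('p)) = (1 / sqrt (1 - c * t)) ^ CARD('p)"
    by (simp add: power_divide real_sqrt_mult flip: l(2) power_mult_distrib) (simp add:
        mult.commute)
  finally show ?thesis by simp
qed

lemma law_convolution:
  assumes a: "0 < a" and b: "0 < b" and g [measurable]: "g \<in> borel_measurable borel"
  shows "(\<integral>\<^sup>+z. \<integral>\<^sup>+y. g (z + y) \<partial>law b \<partial>law a) = (\<integral>\<^sup>+h. g h \<partial>law (a + b))"
proof -
  interpret gibbs_observation "\<lambda>x. mahal S x / a" "\<lambda>x. (1 / a + 1 / b) * mahal S x" "\<lambda>x. mahal S x
      / b"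
    "\<lambda>x. mahal S x / (a + b)" "\<lambda>e. e" "\<lambda>z. (a / (a + b)) *\<^sub>R z"
  proof unfold_locales
    fix r z
    define l where "l = a / (a + b)"
    have l: "l / a = 1 / (a + b)" "(1 - l) / b = 1 / (a + b)"
    proof -
      have ab: "a + b \<noteq> 0" using a b by simp
      then show "l / a = 1 / (a + b)" using a by (simp add: l_def)
      have "1 - l = b / (a + b)" using ab by (simp add: l_def field_simps)
      then show "(1 - l) / b = 1 / (a + b)" using b by simp
    qed
    define t where "t = r \<bullet> (matrix_inv S *v z)"
    have comm: "y \<bullet> (matrix_inv S *v x) = x \<bullet> (matrix_inv S *v y)" for x y
      by (metis pos_def_inverse(3)[OF S] inner_commute inner_matrix_vector)
    have 1: "mahal S (r + l *\<^sub>R z) = mahal S r + 2 * l * t + l * l * mahal S z"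
      by (simp add: mahal_def t_def matrix_vector_right_distrib matrix_vector_mult_scaleR
          inner_add_left inner_add_right comm[of z r] algebra_simps)
    have 2: "mahal S (z - (r + l *\<^sub>R z)) = mahal S r - 2 * (1 - l) * t + (1 - l) * (1 - l) * mahal
        S z"
      by (simp add: mahal_def t_def matrix_vector_right_distrib matrix_vector_mult_scaleR
          matrix_vector_mult_diff_distrib inner_diff_left inner_diff_right
          inner_add_left inner_add_right comm[of z r] algebra_simps)
    have "mahal S (r + l *\<^sub>R z) / a + mahal S (z - (r + l *\<^sub>R z)) / b =
        (1 / a + 1 / b) * mahal S r + 2 * t * (l / a - (1 - l) / b) +
        (l * (l / a) + (1 - l) * ((1 - l) / b)) * mahal S z"
      unfolding 1 2 by (simp add: add_divide_distrib diff_divide_distrib algebra_simps)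
    also have "\<dots> = (1 / a + 1 / b) * mahal S r + mahal S z / (a + b)"
    proof -
      have "l * x + (1 - l) * x = x" for x :: real by (simp add: algebra_simps)
      then show ?thesis unfolding l by (simp only:) simp
    qed
    finally show "mahal S (r + (a / (a + b)) *\<^sub>R z) / a + mahal S (z - (r + (a / (a + b)) *\<^sub>R z))
        / b =
        (1 / a + 1 / b) * mahal S r + mahal S z / (a + b)"
      by (simp only: l_def)
  qed (use a b fin in \<open>simp_all add: mass_scaled ennreal_mult_less_top\<close>)
  show ?thesis
    using nn_integral_observation1[OF g] by (simp add: law_def add.commute)
qed

text \<open>The logarithm of the density of \<open>normal_law S\<close> at \<open>x + m\<close> divided by the density of \<open>law c\<close>
    at \<open>x\<close>.\<close>

definition log_ratio :: "real \<Rightarrow> real^'p \<Rightarrow> real^'p \<Rightarrow> real" where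
  "log_ratio c m x = real CARD('p) / 2 * ln c + mahal S x / (2 * c) - mahal S (x + m) / 2"

lemma log_ratio_measurable [measurable]: "log_ratio c m \<in> borel_measurable borel"
  unfolding log_ratio_def by measurable

lemma exp_half_ln:
  assumes "0 < c" shows "exp (real n / 2 * ln c) = sqrt c ^ n"
proof -
  have "real n / 2 * ln c = real n * ln (sqrt c)" using assms by (simp add: ln_sqrt)
  then show ?thesis using assms by (simp only: exp_of_nat_mult exp_ln real_sqrt_gt_zero)
qed

lemma change_of_measure:
  assumes c: "0 < c" and [measurable]: "f \<in> borel_measurable borel"
  shows "(\<integral>\<^sup>+x. f (x + m) * ennreal (exp (log_ratio c m x)) \<partial>law c) = (\<integral>\<^sup>+x. f x \<partial>normal_law S)"
proof -
  have e: "ennreal (exp (log_ratio c m x)) * ennreal (exp (- mahal S x / (2 * c)) / sqrt c ^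
      CARD('p)) =
     ennreal (exp (- mahal S (x + m) / 2))" for x
  proof -
    have "log_ratio c m x + - mahal S x / (2 * c) = real CARD('p) / 2 * ln c + - mahal S (x + m) /
        2"
      by (simp add: log_ratio_def)
    then have "exp (log_ratio c m x) * exp (- mahal S x / (2 * c)) =
        sqrt c ^ CARD('p) * exp (- mahal S (x + m) / 2)"
      unfolding exp_half_ln[OF c, symmetric] by (simp only: exp_add[symmetric])
    then have "exp (log_ratio c m x) * (exp (- mahal S x / (2 * c)) / sqrt c ^ CARD('p)) =
        exp (- mahal S (x + m) / 2)"
      using c by simp
    then show ?thesis
      using c by (simp flip: ennreal_mult)
  qed
  have "(\<integral>\<^sup>+x. f (x + m) * ennreal (exp (log_ratio c m x)) \<partial>law c) =
    (\<integral>\<^sup>+x. f (x + m) * ennreal (exp (- mahal S (x + m) / 2)) \<partial>lborel) * inverse (gibbs_mass (mahal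
        S))"
    using c by (subst nn_integral_law) (simp_all only: mult.assoc e, measurable)
  also have "\<dots> = (\<integral>\<^sup>+x. f x * ennreal (exp (- mahal S x / 2)) \<partial>lborel) * inverse (gibbs_mass
      (mahal S))"
    by (subst nn_integral_lborel_translate[of "\<lambda>x. f x * ennreal (exp (- mahal S x / 2))" m])
        simp_all
  also have "\<dots> = (\<integral>\<^sup>+x. f x \<partial>normal_law S)"
    by (subst nn_integral_gibbs) simp_all
  finally show ?thesis .
qed

text \<open>For \<open>a = 0\<close> this is the moment of order \<open>s\<close> of the likelihood ratio of \<open>law c\<close> with respect to
  \<open>normal_law S\<close>, taken under \<open>law c\<close>. A positive \<open>a\<close> pays for a shift of the mean.\<close>

definition ratio_bound :: "real \<Rightarrow> real \<Rightarrow> real \<Rightarrow> real" where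
  "ratio_bound a s c = exp (- s * (real CARD('p) / 2 * ln c)) *
     (1 / sqrt (1 - s * ((1 + a) * c - 1))) ^ CARD('p)"

lemma ratio_moment:
  assumes c: "0 < c" and a: "0 < a" and s: "0 < s" "s * ((1 + a) * c - 1) < 1"
  shows "(\<integral>\<^sup>+x. ennreal (exp (- s * log_ratio c m x)) \<partial>law c) \<le>
    ennreal (ratio_bound a s c * exp (s / 2 * (1 + 1 / a) * mahal S m))"
proof -
  define t where "t = s * (1 + a - 1 / c)"
  have ct: "c * t = s * ((1 + a) * c - 1)" using c by (simp add: t_def field_simps)
  define b where "b = exp (- s * (real CARD('p) / 2 * ln c)) * exp (s / 2 * (1 + 1 / a) * mahal S
      m)"
  have "(\<integral>\<^sup>+x. ennreal (exp (- s * log_ratio c m x)) \<partial>law c) \<le>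
     (\<integral>\<^sup>+x. ennreal b * ennreal (exp (t * mahal S x / 2)) \<partial>law c)"
  proof (intro nn_integral_mono)
    fix x
    have "- s * log_ratio c m x = - s * (real CARD('p) / 2 * ln c) + s / 2 * (mahal S (x + m) -
        mahal S x / c)"
      by (simp add: log_ratio_def algebra_simps)
    also have "s / 2 * (mahal S (x + m) - mahal S x / c) \<le>
        s / 2 * ((1 + a) * mahal S x + (1 + 1 / a) * mahal S m - mahal S x / c)"
      using mahal_add_le[OF S a, of x m] s by (intro mult_left_mono) auto
    also have "\<dots> = s / 2 * (1 + 1 / a) * mahal S m + t * mahal S x / 2"
      by (simp add: t_def add_divide_distrib diff_divide_distrib algebra_simps)
    finally have "exp (- s * log_ratio c m x) \<le> exp (- s * (real CARD('p) / 2 * ln c) +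
        (s / 2 * (1 + 1 / a) * mahal S m + t * mahal S x / 2))" by simp
    also have "\<dots> = b * exp (t * mahal S x / 2)"
      unfolding b_def exp_add by (simp only: mult.assoc)
    finally show "ennreal (exp (- s * log_ratio c m x)) \<le> ennreal b * ennreal (exp (t * mahal S x
        / 2))"
      by (simp add: b_def flip: ennreal_mult)
  qed
  also have "\<dots> = ennreal b * ennreal ((1 / sqrt (1 - c * t)) ^ CARD('p))"
    using s c ct by (subst nn_integral_cmult) (simp_all add: nn_integral_law_exp)
  also have "\<dots> = ennreal (ratio_bound a s c * exp (s / 2 * (1 + 1 / a) * mahal S m))"
    using s(2) by (simp add: b_def ratio_bound_def ct mult_ac flip: ennreal_mult)
  finally show ?thesis .
qed

text \<open>Let \<open>l\<close> be the likelihood ratio of the shifted laws with respect to \<open>normal_law S\<close>. Pointwise,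
  \<open>F \<le> exp (k \<tau>) F / l + (l / exp (k \<tau>)) powr s\<close>: if \<open>l \<le> exp (k \<tau>)\<close>, the first term is at least
      \<open>F\<close>,
  otherwise the second one is at least 1. The first term integrates to the probability of the test
  under \<open>normal_law S\<close>, and the second one is the Chernoff bound for a large likelihood ratio.\<close>

theorem testing_bound:
  fixes F :: "(nat \<Rightarrow> real^'p) \<Rightarrow> real" and m :: "nat \<Rightarrow> real^'p" and c :: "nat \<Rightarrow> real"
  assumes F [measurable]: "F \<in> borel_measurable (PiM {1..k} (\<lambda>_. borel))"
    and F01: "\<And>x. 0 \<le> F x" "\<And>x. F x \<le> 1"
    and c: "\<And>n. 0 < c n" and a: "0 < a" and s: "0 < s" "\<And>n. s * ((1 + a) * c n - 1) < 1"
  shows "(\<integral>\<^sup>+x. ennreal (F (\<lambda>n\<in>{1..k}. x n + m n)) \<partial>PiM {1..k} (\<lambda>n. law (c n))) \<le>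
    ennreal (exp (real k * \<tau>)) * (\<integral>\<^sup>+x. ennreal (F x) \<partial>PiM {1..k} (\<lambda>n. normal_law S)) +
    ennreal (\<Prod>n=1..k. exp (- s * \<tau>) * ratio_bound a s (c n) * exp (s / 2 * (1 + 1 / a) * mahal S
        (m n)))"
proof -
  note [simp del] = One_nat_def
  interpret N: product_sigma_finite "\<lambda>n. law (c n)"
    by (intro product_sigma_finite.intro prob_space_imp_sigma_finite prob_space_law c)
  let ?N = "PiM {1..k} (\<lambda>n. law (c n))"
  define G where "G = (\<lambda>x. \<Sum>n=1..k. log_ratio (c n) (m n) (x n))"
  have [measurable]: "(\<lambda>x. \<lambda>n\<in>{1..k}. x n + m n) \<in> measurable ?N (PiM {1..k} (\<lambda>_. borel))"
    by measurable
  have [measurable]: "G \<in> borel_measurable ?N" unfolding G_def by measurable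
  have point: "F y \<le> exp (real k * \<tau>) * (F y * exp (G x)) + exp (- s * (real k * \<tau>)) * exp (- s *
      G x)" for x y
  proof -
    define u where "u = real k * \<tau> + G x"
    have "1 \<le> exp u + exp (- s * u)"
    proof (cases "u \<ge> 0")
      case True
      then have "1 \<le> exp u" by simp
      then show ?thesis by (simp add: add_increasing2)
    next
      case False
      then have "0 \<le> - s * u" using s by (simp add: mult_nonneg_nonpos)
      then have "1 \<le> exp (- s * u)" by simp
      then show ?thesis by (simp add: add_increasing)
    qed
    then have "F y * 1 \<le> F y * (exp u + exp (- s * u))" by (intro mult_left_mono F01)
    also have "\<dots> \<le> F y * exp u + exp (- s * u)"
      using mult_right_mono[OF F01(2)[of y], of "exp (- s * u)"] by (simp add: algebra_simps)
    finally have "F y \<le> F y * exp u + exp (- s * u)" by simp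
    moreover have "exp u = exp (real k * \<tau>) * exp (G x)" by (simp add: u_def exp_add)
    moreover have "- s * u = - s * (real k * \<tau>) + - s * G x" by (simp add: u_def algebra_simps)
    then have "exp (- s * u) = exp (- s * (real k * \<tau>)) * exp (- s * G x)" by (simp only: exp_add)
    ultimately show ?thesis by (simp add: mult_ac)
  qed
  have "(\<integral>\<^sup>+x. ennreal (exp (- s * G x)) \<partial>?N) =
      (\<Prod>n=1..k. \<integral>\<^sup>+x. ennreal (exp (- s * log_ratio (c n) (m n) x)) \<partial>law (c n))"
  proof -
    have "ennreal (exp (- s * G x)) = (\<Prod>n=1..k. ennreal (exp (- s * log_ratio (c n) (m n) (x
        n))))" for x
      by (simp add: G_def sum_distrib_left exp_sum prod_ennreal flip: sum_negf)
    then show ?thesis by (simp only:) (rule N.product_nn_integral_prod, auto)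
  qed
  also have "\<dots> \<le> (\<Prod>n=1..k. ennreal (ratio_bound a s (c n) * exp (s / 2 * (1 + 1 / a) * mahal S (m
      n))))"
  proof -
    have "(\<Prod>n\<in>I. f n) \<le> (\<Prod>n\<in>I. g n)" if "\<And>n. f n \<le> g n" for I and f g :: "nat \<Rightarrow> ennreal"
      using that by (induction I rule: infinite_finite_induct) (auto intro: mult_mono)
    then show ?thesis by (simp only: ratio_moment c a s)
  qed
  also have "\<dots> = ennreal (\<Prod>n=1..k. ratio_bound a s (c n) * exp (s / 2 * (1 + 1 / a) * mahal S (m
      n)))"
    using s(2) by (intro prod_ennreal) (auto simp: ratio_bound_def less_imp_le)
  finally have moment: "(\<integral>\<^sup>+x. ennreal (exp (- s * G x)) \<partial>?N) \<le>
    ennreal (\<Prod>n=1..k. ratio_bound a s (c n) * exp (s / 2 * (1 + 1 / a) * mahal S (m n)))" .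
  have "(\<integral>\<^sup>+x. ennreal (F (\<lambda>n\<in>{1..k}. x n + m n)) \<partial>?N) \<le>
    (\<integral>\<^sup>+x. ennreal (exp (real k * \<tau>)) * (ennreal (F (\<lambda>n\<in>{1..k}. x n + m n)) * ennreal (exp (G x))) +
       ennreal (exp (- s * (real k * \<tau>))) * ennreal (exp (- s * G x)) \<partial>?N)"
    using point F01 by (intro nn_integral_mono) (simp flip: ennreal_mult ennreal_plus)
  also have "\<dots> = ennreal (exp (real k * \<tau>)) * (\<integral>\<^sup>+x. ennreal (F (\<lambda>n\<in>{1..k}. x n + m n)) * ennreal
      (exp (G x)) \<partial>?N) +
       ennreal (exp (- s * (real k * \<tau>))) * (\<integral>\<^sup>+x. ennreal (exp (- s * G x)) \<partial>?N)"
    by (subst nn_integral_add) (simp_all add: nn_integral_cmult)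
  also have "(\<integral>\<^sup>+x. ennreal (F (\<lambda>n\<in>{1..k}. x n + m n)) * ennreal (exp (G x)) \<partial>?N) =
      (\<integral>\<^sup>+x. ennreal (F x) \<partial>PiM {1..k} (\<lambda>n. normal_law S))"
  proof -
    have "ennreal (exp (G x)) = (\<Prod>n=1..k. ennreal (exp (log_ratio (c n) (m n) (x n))))" for x
      by (simp add: G_def exp_sum prod_ennreal)
    then show ?thesis
      by (simp only:) (rule PiM_change_of_measure[where T="\<lambda>n x. x + m n" and B=borel and
          g="\<lambda>n x. ennreal (exp (log_ratio (c n) (m n) x))"],
        use c prob_space_law[OF c] prob_space_gibbs[of "mahal S"] fin in \<open>auto simp:
            change_of_measure\<close>)
  qed
  also have "ennreal (exp (real k * \<tau>)) * (\<integral>\<^sup>+x. ennreal (F x) \<partial>PiM {1..k} (\<lambda>n. normal_law S)) +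
      ennreal (exp (- s * (real k * \<tau>))) * (\<integral>\<^sup>+x. ennreal (exp (- s * G x)) \<partial>?N) \<le>
    ennreal (exp (real k * \<tau>)) * (\<integral>\<^sup>+x. ennreal (F x) \<partial>PiM {1..k} (\<lambda>n. normal_law S)) +
      ennreal (exp (- s * (real k * \<tau>))) *
        ennreal (\<Prod>n=1..k. ratio_bound a s (c n) * exp (s / 2 * (1 + 1 / a) * mahal S (m n)))"
    by (intro add_left_mono mult_left_mono moment) simp
  also have "ennreal (exp (- s * (real k * \<tau>))) * ennreal (\<Prod>n=1..k. ratio_bound a s (c n) * exp (s
      / 2 * (1 + 1 / a) * mahal S (m n))) =
      ennreal (\<Prod>n=1..k. exp (- s * \<tau>) * ratio_bound a s (c n) * exp (s / 2 * (1 + 1 / a) * mahal S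
          (m n)))"
  proof -
    have "exp (- s * (real k * \<tau>)) = (\<Prod>n=1..k. exp (- s * \<tau>))"
      by (simp add: mult_ac flip: exp_of_nat_mult)
    then show ?thesis
      using s(2) by (simp add: prod.distrib ratio_bound_def less_imp_le prod_nonneg mult.assoc
          flip: ennreal_mult)
  qed
  finally show ?thesis .
qed

text \<open>The logarithm of the product vanishes at \<open>s = 0\<close>, where its derivative is the relative entropy
  \<open>p (D - 1 - ln D) / 2\<close> minus \<open>\<tau>\<close> plus \<open>p a D / 2\<close>. For small \<open>a\<close> this is negative.\<close>

lemma ratio_bound_less_one:
  fixes D \<tau> :: real
  assumes D: "1 \<le> D" and \<tau>: "real CARD('p) / 2 * (D - 1 - ln D) < \<tau>"
  obtains a s where "0 < a" "0 < s" "s * ((1 + a) * D - 1) < 1" "exp (- s * \<tau>) * ratio_bound a s D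
      < 1"
proof -
  define p where "p = real CARD('p)"
  have p: "0 < p" by (simp add: p_def)
  \<comment> \<open>With this choice the term \<open>p a D / 2\<close> takes up half of the gap below \<open>\<tau>\<close>.\<close>
  define a where "a = (\<tau> - p / 2 * (D - 1 - ln D)) / (p * D)"
  have a: "0 < a" using \<tau> D p by (simp add: a_def p_def)
  define B where "B = (1 + a) * D - 1"
  have "0 \<le> (1 + a) * (D - 1)" using a D by simp
  then have B: "0 < B" using a by (simp add: B_def algebra_simps)
  define f where "f s = - s * \<tau> - s * (p / 2 * ln D) - p / 2 * ln (1 - s * B)" for s
  have "(f has_real_derivative (- \<tau> - p / 2 * ln D + p / 2 * B)) (at 0)"
    unfolding f_def by (auto intro!: derivative_eq_intros)
  moreover have "- \<tau> - p / 2 * ln D + p / 2 * B < 0"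
  proof -
    define E where "E = p / 2 * (D - 1 - ln D)"
    have "- \<tau> - p / 2 * ln D + p / 2 * B = - \<tau> + E + p / 2 * (a * D)"
      by (simp add: E_def B_def algebra_simps add_divide_distrib)
    also have "p / 2 * (a * D) = (\<tau> - E) / 2"
      using p D by (simp add: a_def E_def)
    also have "E < \<tau>" using \<tau> by (simp only: E_def p_def)
    then have "- \<tau> + E + (\<tau> - E) / 2 < 0" by (simp add: field_simps)
    finally show ?thesis .
  qed
  ultimately obtain d where d: "0 < d" "\<And>h. 0 < h \<Longrightarrow> h < d \<Longrightarrow> f (0 + h) < f 0"
    using DERIV_neg_dec_right by blast
  define s where "s = min (d / 2) (1 / (2 * B))"
  have s: "0 < s" "s < d" using d B by (auto simp: s_def)
  have "s * B \<le> 1 / (2 * B) * B" using B by (intro mult_right_mono) (auto simp: s_def)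
  then have sB: "s * B < 1" using B by simp
  have "exp (- s * \<tau>) * ratio_bound a s D = exp (f s)"
  proof -
    have "exp (- (p / 2 * ln (1 - s * B))) = inverse (exp (p / 2 * ln (1 - s * B)))"
      by (rule exp_minus)
    also have "\<dots> = (1 / sqrt (1 - s * B)) ^ CARD('p)"
      using exp_half_ln[of "1 - s * B" "CARD('p)"] sB by (simp only: p_def) (simp add:
          power_one_over inverse_eq_divide)
    finally have "exp (- (p / 2 * ln (1 - s * B))) = (1 / sqrt (1 - s * B)) ^ CARD('p)" .
    moreover have "f s = - s * \<tau> + (- s * (p / 2 * ln D) + - (p / 2 * ln (1 - s * B)))"
      by (simp add: f_def)
    ultimately have "exp (f s) =
        exp (- s * \<tau>) * (exp (- s * (p / 2 * ln D)) * (1 / sqrt (1 - s * B)) ^ CARD('p))"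
      by (simp only: exp_add)
    then show ?thesis
      by (simp only: ratio_bound_def B_def[symmetric] p_def[symmetric])
  qed
  also have "\<dots> < 1" using d(2)[OF s] by (simp add: f_def)
  finally show ?thesis using a s sB by (intro that[of a s]) (auto simp: B_def)
qed

end

section \<open>Second moments\<close>

definition square_integrable :: "'a measure \<Rightarrow> ('a \<Rightarrow> 'b::euclidean_space) \<Rightarrow> bool" where
  "square_integrable M X \<longleftrightarrow> X \<in> borel_measurable M \<and> integrable M (\<lambda>\<omega>. (norm (X \<omega>))\<^sup>2)"

lemma square_integrable_bound:
  assumes X: "square_integrable M X" and [measurable]: "Y \<in> borel_measurable M"
    and le: "\<And>\<omega>. norm (Y \<omega>) \<le> K * norm (X \<omega>)"
  shows "square_integrable M Y"
proof -
  have "integrable M (\<lambda>\<omega>. K\<^sup>2 * (norm (X \<omega>))\<^sup>2)" using X by (simp add: square_integrable_def)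
  then have "integrable M (\<lambda>\<omega>. (norm (Y \<omega>))\<^sup>2)"
  proof (rule Bochner_Integration.integrable_bound)
    show "AE \<omega> in M. norm ((norm (Y \<omega>))\<^sup>2) \<le> norm (K\<^sup>2 * (norm (X \<omega>))\<^sup>2)"
      using power_mono[OF le, of _ 2] by (auto simp: power_mult_distrib)
  qed measurable
  then show ?thesis by (simp add: square_integrable_def)
qed

lemma square_integrable_add:
  assumes X: "square_integrable M X" and Y: "square_integrable M Y"
  shows "square_integrable M (\<lambda>\<omega>. X \<omega> + Y \<omega>)"
proof -
  have [measurable]: "X \<in> borel_measurable M" "Y \<in> borel_measurable M"
    using X Y by (auto simp: square_integrable_def)
  have "integrable M (\<lambda>\<omega>. 2 * (norm (X \<omega>))\<^sup>2 + 2 * (norm (Y \<omega>))\<^sup>2)"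
    using X Y by (simp add: square_integrable_def)
  then have "integrable M (\<lambda>\<omega>. (norm (X \<omega> + Y \<omega>))\<^sup>2)"
  proof (rule Bochner_Integration.integrable_bound)
    have "(norm (X \<omega> + Y \<omega>))\<^sup>2 \<le> 2 * (norm (X \<omega>))\<^sup>2 + 2 * (norm (Y \<omega>))\<^sup>2" for \<omega>
    proof -
      have "(norm (X \<omega> + Y \<omega>))\<^sup>2 \<le> (norm (X \<omega>) + norm (Y \<omega>))\<^sup>2"
        by (intro power_mono norm_triangle_ineq) simp
      also have "\<dots> \<le> 2 * (norm (X \<omega>))\<^sup>2 + 2 * (norm (Y \<omega>))\<^sup>2"
        using zero_le_power2[of "norm (X \<omega>) - norm (Y \<omega>)"] by (simp add: power2_eq_square
            algebra_simps)
      finally show ?thesis .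
    qed
    then show "AE \<omega> in M. norm ((norm (X \<omega> + Y \<omega>))\<^sup>2) \<le> norm (2 * (norm (X \<omega>))\<^sup>2 + 2 * (norm (Y
        \<omega>))\<^sup>2)"
      by auto
  qed measurable
  then show ?thesis by (simp add: square_integrable_def)
qed

lemma square_integrable_zero: "square_integrable M (\<lambda>_. 0)"
  by (simp add: square_integrable_def)

lemma square_integrable_sum:
  "(\<And>i. i \<in> I \<Longrightarrow> square_integrable M (X i)) \<Longrightarrow> square_integrable M (\<lambda>\<omega>. \<Sum>i\<in>I. X i \<omega>)"
proof (induction I rule: infinite_finite_induct)
  case (insert i I)
  then have "square_integrable M (\<lambda>\<omega>. X i \<omega> + (\<Sum>i\<in>I. X i \<omega>))"
    by (intro square_integrable_add) simp_all
  then show ?case using insert.hyps by simp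
qed (simp_all add: square_integrable_zero)

lemma square_integrable_matrix:
  fixes X :: "'a \<Rightarrow> real^'n" and A :: "real^'n^'m"
  assumes X: "square_integrable M X"
  shows "square_integrable M (\<lambda>\<omega>. A *v X \<omega>)"
proof -
  have [measurable]: "X \<in> borel_measurable M" using X by (simp add: square_integrable_def)
  show ?thesis
    by (rule square_integrable_bound[OF X, of _ "onorm ((*v) A)"])
       (measurable, rule onorm, rule matrix_vector_mul_bounded_linear)
qed

lemma square_integrable_scale:
  fixes X :: "'a \<Rightarrow> real"
  shows "square_integrable M X \<Longrightarrow> square_integrable M (\<lambda>\<omega>. c * X \<omega>)"
  by (rule square_integrable_bound[of M X _ "\<bar>c\<bar>"]) (auto simp: square_integrable_def abs_mult)

lemma borel_measurable_vec_nth [measurable (raw)]: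
  fixes f :: "'a \<Rightarrow> real^'n"
  assumes "f \<in> borel_measurable M"
  shows "(\<lambda>x. f x $ i) \<in> borel_measurable M"
  by (rule measurable_compose[OF assms borel_measurable_continuous_onI])
     (intro continuous_intros)

lemma square_integrable_component:
  fixes X :: "'a \<Rightarrow> real^'n"
  assumes X: "square_integrable M X"
  shows "square_integrable M (\<lambda>\<omega>. X \<omega> $ i)"
proof -
  have [measurable]: "X \<in> borel_measurable M" using X by (simp add: square_integrable_def)
  show ?thesis
    by (rule square_integrable_bound[OF X, of _ 1]) (auto simp: component_le_norm_cart)
qed

lemma square_integrable_vec:
  fixes X :: "'i::finite \<Rightarrow> 'a \<Rightarrow> real"
  assumes X: "\<And>i. square_integrable M (X i)"
  shows "square_integrable M (\<lambda>\<omega>. \<chi> i. X i \<omega>)"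
proof -
  have [measurable]: "X i \<in> borel_measurable M" for i using X by (simp add: square_integrable_def)
  have [measurable]: "(\<lambda>\<omega>. \<chi> i. X i \<omega>) \<in> borel_measurable M"
    by (subst borel_measurable_euclidean_space) (auto simp: Basis_vec_def inner_axis)
  have "integrable M (\<lambda>\<omega>. \<Sum>i\<in>UNIV. (norm (X i \<omega>))\<^sup>2)"
    using X by (simp add: square_integrable_def)
  then show ?thesis
    by (simp add: square_integrable_def norm_vec_def L2_set_def sum_nonneg)
qed

lemma integrable_inner:
  fixes X Y :: "'a \<Rightarrow> 'b::euclidean_space"
  assumes X: "square_integrable M X" and Y: "square_integrable M Y"
  shows "integrable M (\<lambda>\<omega>. X \<omega> \<bullet> Y \<omega>)"
proof -
  have [measurable]: "X \<in> borel_measurable M" "Y \<in> borel_measurable M"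
    using X Y by (auto simp: square_integrable_def)
  have "integrable M (\<lambda>\<omega>. (norm (X \<omega>))\<^sup>2 + (norm (Y \<omega>))\<^sup>2)"
    using X Y by (simp add: square_integrable_def)
  then show ?thesis
  proof (rule Bochner_Integration.integrable_bound)
    have "\<bar>X \<omega> \<bullet> Y \<omega>\<bar> \<le> (norm (X \<omega>))\<^sup>2 + (norm (Y \<omega>))\<^sup>2" for \<omega>
    proof -
      have "\<bar>X \<omega> \<bullet> Y \<omega>\<bar> \<le> norm (X \<omega>) * norm (Y \<omega>)" by (rule Cauchy_Schwarz_ineq2)
      also have "\<dots> \<le> (norm (X \<omega>))\<^sup>2 + (norm (Y \<omega>))\<^sup>2"
        using zero_le_power2[of "norm (X \<omega>) - norm (Y \<omega>)"]
          mult_nonneg_nonneg[OF norm_ge_zero[of "X \<omega>"] norm_ge_zero[of "Y \<omega>"]]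
        unfolding power2_diff by linarith
      finally show ?thesis .
    qed
    then show "AE \<omega> in M. norm (X \<omega> \<bullet> Y \<omega>) \<le> norm ((norm (X \<omega>))\<^sup>2 + (norm (Y \<omega>))\<^sup>2)" by auto
  qed measurable
qed

locale normal_vector = prob_space M for M :: "'a measure" +
  fixes X :: "'a \<Rightarrow> real^'n" and S :: "real^'n^'n"
  assumes X [measurable]: "X \<in> borel_measurable M" and law: "distr M borel X = normal_law S"
    and S: "pos_def S" and fin: "gibbs_mass (mahal S) < \<infinity>"
begin

lemma second_moment: "has_bochner_integral M (\<lambda>\<omega>. (a \<bullet> X \<omega>)\<^sup>2) (a \<bullet> (S *v a))"
proof (rule has_bochner_integral_nn_integral)
  show "0 \<le> a \<bullet> (S *v a)"
    using pos_def_imp_pos_semidef[OF S] by (simp add: pos_semidef_def)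
  have "(\<integral>\<^sup>+\<omega>. ennreal ((a \<bullet> X \<omega>)\<^sup>2) \<partial>M) = (\<integral>\<^sup>+x. ennreal ((a \<bullet> x)\<^sup>2) \<partial>distr M borel X)"
    by (simp add: nn_integral_distr)
  then show "(\<integral>\<^sup>+\<omega>. ennreal ((a \<bullet> X \<omega>)\<^sup>2) \<partial>M) = ennreal (a \<bullet> (S *v a))"
    by (simp add: law normal_second_moment[OF S fin])
qed auto

lemma square_integrable: "square_integrable M X"
proof -
  have "square_integrable M (\<lambda>\<omega>. X \<omega> $ i)" for i
    using second_moment[of "axis i 1"]
    by (auto simp: square_integrable_def inner_axis' has_bochner_integral_iff)
  then have "square_integrable M (\<lambda>\<omega>. \<chi> i. X \<omega> $ i)" by (rule square_integrable_vec)
  then show ?thesis by simp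
qed

lemma covariance: "expectation (\<lambda>\<omega>. (a \<bullet> X \<omega>) * (b \<bullet> X \<omega>)) = a \<bullet> (S *v b)"
proof -
  have comm: "b \<bullet> (S *v a) = a \<bullet> (S *v b)"
    using S by (metis inner_commute inner_matrix_vector pos_def_def)
  have "has_bochner_integral M (\<lambda>\<omega>. (((a + b) \<bullet> X \<omega>)\<^sup>2 - (a \<bullet> X \<omega>)\<^sup>2 - (b \<bullet> X \<omega>)\<^sup>2) / 2)
      (((a + b) \<bullet> (S *v (a + b)) - a \<bullet> (S *v a) - b \<bullet> (S *v b)) / 2)"
    by (intro has_bochner_integral_divide_zero has_bochner_integral_diff second_moment)
  then have "has_bochner_integral M (\<lambda>\<omega>. (a \<bullet> X \<omega>) * (b \<bullet> X \<omega>)) (a \<bullet> (S *v b))"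
    by (simp add: inner_add_left matrix_vector_right_distrib inner_add_right comm power2_sum)
  then show ?thesis by (rule has_bochner_integral_integral_eq)
qed

lemma expectation_quadratic: "expectation (\<lambda>\<omega>. X \<omega> \<bullet> (Q *v X \<omega>)) = trace (S ** Q)"
proof -
  have "X \<omega> \<bullet> (Q *v X \<omega>) = (\<Sum>i\<in>UNIV. \<Sum>j\<in>UNIV. Q $ i $ j * (X \<omega> $ i * X \<omega> $ j))" for \<omega>
    by (simp add: inner_vec_def matrix_vector_mult_def sum_distrib_left mult_ac)
  moreover have int: "integrable M (\<lambda>\<omega>. X \<omega> $ i * X \<omega> $ j)" for i j
    using integrable_inner[OF square_integrable_component[OF square_integrable, of i]
        square_integrable_component[OF square_integrable, of j]] by simp
  moreover have "expectation (\<lambda>\<omega>. X \<omega> $ i * X \<omega> $ j) = S $ i $ j" for i j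
    using covariance[of "axis i 1" "axis j 1"]
    by (simp add: inner_axis' matrix_vector_mult_basis column_def)
  ultimately have "expectation (\<lambda>\<omega>. X \<omega> \<bullet> (Q *v X \<omega>)) = (\<Sum>i\<in>UNIV. \<Sum>j\<in>UNIV. Q $ i $ j * S $ i $ j)"
    by simp
  also have "\<dots> = (\<Sum>i\<in>UNIV. \<Sum>j\<in>UNIV. S $ j $ i * Q $ i $ j)"
    using S by (intro sum.cong refl) (simp add: pos_def_def transpose_def vec_eq_iff mult.commute)
  also have "\<dots> = trace (S ** Q)"
    by (subst sum.swap) (simp add: trace_def matrix_matrix_mult_def)
  finally show ?thesis .
qed

lemma distr_uminus: "distr M borel (\<lambda>\<omega>. - X \<omega>) = distr M borel X"
proof -
  have "distr M borel (\<lambda>\<omega>. - X \<omega>) = distr (distr M borel X) borel uminus"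
    by (subst distr_distr) (simp_all add: comp_def)
  also have "\<dots> = normal_law S"
    unfolding law using mahal_scale[of S "-1"] by (intro gibbs_uminus) simp_all
  finally show ?thesis by (simp add: law)
qed

end

lemma trace_error_cov:
  fixes X :: "'a \<Rightarrow> real^'n"
  assumes X: "square_integrable M X"
  shows "trace ((\<integral>\<omega>. outer (X \<omega>) (X \<omega>) \<partial>M) ** W) = (\<integral>\<omega>. X \<omega> \<bullet> (W *v X \<omega>) \<partial>M)"
proof -
  have [measurable]: "X \<in> borel_measurable M" using X by (simp add: square_integrable_def)
  have comp: "integrable M (\<lambda>\<omega>. X \<omega> $ i * X \<omega> $ j)" for i j
    using integrable_inner[OF square_integrable_component[OF X, of i]
        square_integrable_component[OF X, of j]] by simp
  have outer: "integrable M (\<lambda>\<omega>. outer (X \<omega>) (X \<omega>))"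
  proof -
    have eq: "outer (X \<omega>) (X \<omega>) = (\<Sum>i\<in>UNIV. \<Sum>j\<in>UNIV. (X \<omega> $ i * X \<omega> $ j) *\<^sub>R axis i (axis j 1))"
        for \<omega>
    proof -
      have "(\<Sum>k\<in>UNIV. \<Sum>l\<in>UNIV. (X \<omega> $ k * X \<omega> $ l) *\<^sub>R axis k (axis l 1)) $ i $ j =
          (\<Sum>k\<in>UNIV. (if i = k then \<Sum>l\<in>UNIV. (if j = l then X \<omega> $ k * X \<omega> $ l else 0) else 0))" for
              i j
        unfolding sum_component by (intro sum.cong refl) (simp add: axis_def if_distrib[of "(*)
            _"] cong: if_cong)
      then show ?thesis by (simp add: vec_eq_iff outer_def)
    qed
    show ?thesis unfolding eq
      by (intro Bochner_Integration.integrable_sum integrable_scaleR_left comp)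
  qed
  have lin: "linear (\<lambda>Y::real^'n^'n. trace (Y ** W))"
    by (rule linearI) (simp_all add: trace_def matrix_matrix_mult_def sum.distrib distrib_right
        sum_distrib_left mult.assoc)
  have "trace ((\<integral>\<omega>. outer (X \<omega>) (X \<omega>) \<partial>M) ** W) = (\<integral>\<omega>. trace (outer (X \<omega>) (X \<omega>) ** W) \<partial>M)"
    using integral_bounded_linear[OF linear_conv_bounded_linear[THEN iffD1, OF lin] outer] by simp
  moreover have "trace (outer (X \<omega>) (X \<omega>) ** W) = X \<omega> \<bullet> (W *v X \<omega>)" for \<omega>
  proof -
    have "trace (outer (X \<omega>) (X \<omega>) ** W) = (\<Sum>i\<in>UNIV. \<Sum>j\<in>UNIV. X \<omega> $ i * X \<omega> $ j * W $ j $ i)"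
      by (simp add: trace_def matrix_matrix_mult_def outer_def)
    also have "\<dots> = (\<Sum>j\<in>UNIV. \<Sum>i\<in>UNIV. X \<omega> $ j * (W $ j $ i * X \<omega> $ i))"
      by (subst sum.swap) (simp add: mult_ac)
    also have "\<dots> = X \<omega> \<bullet> (W *v X \<omega>)"
      by (simp add: inner_vec_def matrix_vector_mult_def sum_distrib_left)
    finally show ?thesis .
  qed
  ultimately show ?thesis by simp
qed

lemma sum_power_pred_le:
  fixes \<gamma> :: real
  assumes \<gamma>: "0 \<le> \<gamma>" "\<gamma> < 1"
  shows "(\<Sum>n=1..k. \<gamma> ^ (n - 1)) \<le> 1 / (1 - \<gamma>)"
proof -
  have "(\<Sum>n=1..k. \<gamma> ^ (n - 1)) = (\<Sum>n<k. \<gamma> ^ n)"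
    by (rule sum.reindex_bij_witness[of _ Suc "\<lambda>n. n - 1"]) auto
  also have "\<dots> \<le> (\<Sum>n. \<gamma> ^ n)"
    using \<gamma> by (intro sum_le_suminf summable_geometric) auto
  finally show ?thesis using \<gamma> by (simp add: suminf_geometric)
qed

lemma cesaro_geometric:
  fixes r :: "nat \<Rightarrow> real"
  assumes r: "\<And>n. 1 \<le> n \<Longrightarrow> \<bar>r n\<bar> \<le> c * \<gamma> ^ (n - 1)" and \<gamma>: "0 \<le> \<gamma>" "\<gamma> < 1"
  shows "(\<lambda>k. 1 / real k * (\<Sum>n=1..k. L + r n)) \<longlonglongrightarrow> L"
proof -
  have c: "0 \<le> c" using r[of 1] by simp
  have bound: "\<bar>\<Sum>n=1..k. r n\<bar> \<le> c * (1 / (1 - \<gamma>))" for k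
  proof -
    have "\<bar>\<Sum>n=1..k. r n\<bar> \<le> (\<Sum>n=1..k. c * \<gamma> ^ (n - 1))"
      by (intro order_trans[OF sum_abs] sum_mono r) simp
    also have "\<dots> = c * (\<Sum>n=1..k. \<gamma> ^ (n - 1))" by (simp only: sum_distrib_left)
    also have "\<dots> \<le> c * (1 / (1 - \<gamma>))"
      by (intro mult_left_mono sum_power_pred_le \<gamma> c)
    finally show ?thesis .
  qed
  have "(\<lambda>k. 1 / real k * (\<Sum>n=1..k. r n)) \<longlonglongrightarrow> 0"
  proof (rule Lim_null_comparison)
    show "\<forall>\<^sub>F k in sequentially. norm (1 / real k * (\<Sum>n=1..k. r n)) \<le> c * (1 / (1 - \<gamma>)) * (1 /
        real k)"
    proof (intro always_eventually allI)
      fix k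
      have "norm (1 / real k * (\<Sum>n=1..k. r n)) = \<bar>\<Sum>n=1..k. r n\<bar> * (1 / real k)"
        by (simp add: abs_mult)
      also have "\<dots> \<le> c * (1 / (1 - \<gamma>)) * (1 / real k)" by (intro mult_right_mono bound) simp
      finally show "norm (1 / real k * (\<Sum>n=1..k. r n)) \<le> c * (1 / (1 - \<gamma>)) * (1 / real k)" .
    qed
    show "(\<lambda>k. c * (1 / (1 - \<gamma>)) * (1 / real k)) \<longlonglongrightarrow> 0"
      by (rule tendsto_mult_right_zero) (rule lim_1_over_n)
  qed
  then have "(\<lambda>k. L + 1 / real k * (\<Sum>n=1..k. r n)) \<longlonglongrightarrow> L + 0"
    by (intro tendsto_add tendsto_const)
  moreover have "\<forall>\<^sub>F k in sequentially. L + 1 / real k * (\<Sum>n=1..k. r n) = 1 / real k * (\<Sum>n=1..k. L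
      + r n)"
    using eventually_gt_at_top[of 0] by eventually_elim (simp add: sum.distrib distrib_left)
  ultimately have "(\<lambda>k. 1 / real k * (\<Sum>n=1..k. L + r n)) \<longlonglongrightarrow> L + 0"
    by (rule Lim_transform_eventually)
  then show ?thesis by (simp only: add_0_right)
qed

lemma outer_uminus: "outer (- x) (- y) = outer x y"
  by (simp add: outer_def)

section \<open>The effect of an independent perturbation of the innovations\<close>

locale attacked_filter = kalman_filter M S x1 w v \<zeta> \<rho> A C P Sw Sv Sz err z L
  for M :: "'a measure" and S :: "'s measure" and x1 :: "'a \<Rightarrow> real^'n"
    and w :: "nat \<Rightarrow> 'a \<Rightarrow> real^'n" and v \<zeta> :: "nat \<Rightarrow> 'a \<Rightarrow> real^'p" and \<rho> :: "'a \<Rightarrow> 's"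
    and A :: "real^'n^'n" and C :: "real^'n^'p" and P Sw :: "real^'n^'n" and Sv Sz :: "real^'p^'p"
    and err :: "nat \<Rightarrow> 'a \<Rightarrow> real^'n" and z :: "nat \<Rightarrow> 'a \<Rightarrow> real^'p" and L :: "real^'p \<Rightarrow> real^'n" +
  fixes D :: real
  assumes D: "1 < D" and \<zeta>_gaussian: "\<And>k. 1 \<le> k \<Longrightarrow> gaussian M (\<zeta> k) ((D - 1) *\<^sub>R Sz)"
begin

sublocale innovation: scaled_normal Sz
  by unfold_locales (rule pos_def_Sz, rule mass_finite_Sz)

lemma \<zeta>_distr: "1 \<le> n \<Longrightarrow> distr M borel (\<zeta> n) = innovation.law (D - 1)"
  using gaussian_law(2)[OF prob_space_axioms \<zeta>_gaussian, of n]
  unfolding innovation.law_def mahal_scaleR[OF pos_def_Sz, symmetric, of "D - 1", simplified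
      diff_gt_0_iff_gt, OF D] .

lemma masked:
  assumes "c \<in> measurable (known ({Controller} \<union> Attacker ` ({1..} - J))) MC"
  shows "masked_innovations M S x1 w v \<zeta> \<rho> A C P Sw Sv Sz err z L J (innovation.law (D - 1))
    (innovation.law D) MC c (\<lambda>n \<omega>. if n \<in> J then z n \<omega> + \<zeta> n \<omega> else z n \<omega>)"
proof (intro masked_innovations.intro masked_innovations_axioms.intro)
  show "kalman_filter M S x1 w v \<zeta> \<rho> A C P Sw Sv Sz err z L" by (rule kalman_filter_axioms)
  show "distr M borel (\<zeta> n) = innovation.law (D - 1)" if "1 \<le> n" for n using that by (rule \<zeta>_distr)
  show "prob_space (innovation.law (D - 1))" "prob_space (innovation.law D)"
    using D by (simp_all add: innovation.prob_space_law)
  fix g :: "real^'p \<Rightarrow> ennreal" assume "g \<in> borel_measurable borel"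
  then show "(\<integral>\<^sup>+z. \<integral>\<^sup>+y. g (z + y) \<partial>innovation.law (D - 1) \<partial>normal_law Sz) = (\<integral>\<^sup>+h. g h
      \<partial>innovation.law D)"
    using innovation.law_convolution[of 1 "D - 1" g] D by (simp add: innovation.law_1)
qed (rule assms | simp)+

text \<open>Given the noise of the attacker up to time \<open>d\<close>, the attacked innovations are independent
    Gaussians,
  so \<open>testing_bound\<close> applies. Its last term decays geometrically, with a constant that depends on
      that
  noise through \<open>V\<close>; averaged over the noise it still tends to 0, by dominated convergence.\<close>

theorem detection_bound:
  fixes \<Phi> :: "nat \<Rightarrow> 's \<times> (nat \<Rightarrow> real^'p) \<Rightarrow> real" and m :: "nat \<Rightarrow> (nat \<Rightarrow> real^'p) \<Rightarrow> real^'p"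
    and V :: "(nat \<Rightarrow> real^'p) \<Rightarrow> real" and zt :: "nat \<Rightarrow> 'a \<Rightarrow> real^'p" and d :: nat
  assumes \<Phi>: "\<And>k. 1 \<le> k \<Longrightarrow> \<Phi> k \<in> borel_measurable (S \<Otimes>\<^sub>M PiM {1..k} (\<lambda>_. borel))"
      "\<And>k x. 0 \<le> \<Phi> k x" "\<And>k x. 1 \<le> k \<Longrightarrow> \<Phi> k x \<le> 1"
    and m: "\<And>n. m n \<in> borel_measurable (PiM {1..d} (\<lambda>_. borel))"
    and V: "V \<in> borel_measurable (PiM {1..d} (\<lambda>_. borel))"
      "\<And>k \<theta>. (\<Sum>n=1..k. mahal Sz (m n \<theta>)) \<le> V \<theta>"
    and zt: "\<And>n \<omega>. \<omega> \<in> space M \<Longrightarrow> 1 \<le> n \<Longrightarrow>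
      zt n \<omega> = (if d < n then z n \<omega> + \<zeta> n \<omega> else z n \<omega>) + m n (\<lambda>j\<in>{1..d}. \<zeta> j \<omega>)"
    and \<delta>: "\<delta> < 1"
    and detects: "\<And>k. 1 \<le> k \<Longrightarrow> 1 - (\<integral>\<omega>. \<Phi> k (\<rho> \<omega>, \<lambda>n\<in>{1..k}. zt n \<omega>) \<partial>M) \<le> \<delta>"
    and \<tau>: "real CARD('p) / 2 * (D - 1 - ln D) < \<tau>"
  shows "\<forall>\<^sub>F k in sequentially.
    (1 - \<delta>) / 2 \<le> exp (real k * \<tau>) * (\<integral>\<omega>. \<Phi> k (\<rho> \<omega>, \<lambda>n\<in>{1..k}. z n \<omega>) \<partial>M)"
proof -
  note [simp del] = One_nat_def
  obtain a s where as: "0 < a" "0 < s" "s * ((1 + a) * D - 1) < 1"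
      "exp (- s * \<tau>) * innovation.ratio_bound a s D < 1"
    using innovation.ratio_bound_less_one[of D \<tau>] D \<tau> by auto
  have sa: "s * ((1 + a) * c - 1) < 1" if "c \<in> {1, D}" for c
  proof -
    have "(1 + a) * c \<le> (1 + a) * D" using that D as by (intro mult_left_mono) auto
    then have "s * ((1 + a) * c - 1) \<le> s * ((1 + a) * D - 1)" using as by (intro mult_left_mono)
        auto
    with as(3) show ?thesis by linarith
  qed
  define \<beta> where "\<beta> c = exp (- s * \<tau>) * innovation.ratio_bound a s c" for c
  have \<beta>_nonneg: "0 \<le> \<beta> c" if "c \<in> {1, D}" for c
    using sa[OF that] by (simp add: \<beta>_def innovation.ratio_bound_def)
  define cc where "cc n = (if d < n then D else 1)" for n
  have cc: "cc n \<in> {1, D}" "0 < cc n" for n using D by (auto simp: cc_def)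
  define \<kappa> where "\<kappa> = s / 2 * (1 + 1 / a)"
  have \<kappa>: "0 \<le> \<kappa>" using as by (simp add: \<kappa>_def)
  define MC where "MC = S \<Otimes>\<^sub>M PiM {1..d} (\<lambda>_. borel :: (real^'p) measure)"
  define \<theta> where "\<theta> \<omega> = (\<lambda>j\<in>{1..d}. \<zeta> j \<omega>)" for \<omega>
  define c where "c \<omega> = (\<rho> \<omega>, \<theta> \<omega>)" for \<omega>
  have c: "c \<in> measurable (known ({Controller} \<union> Attacker ` ({1..} - J))) MC" if "J \<subseteq> {d<..}" for J
    unfolding c_def MC_def \<theta>_def using that
    by (intro measurable_Pair measurable_restrict known_rho known_zeta) auto
  have [measurable]: "c \<in> measurable M MC"
    using known_events[OF _ c[of "{}"]] by (auto simp: all_sources_def)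
  have \<theta> [measurable]: "\<theta> \<in> measurable M (PiM {1..d} (\<lambda>_. borel))"
    using measurable_compose[OF \<open>c \<in> measurable M MC\<close>[unfolded MC_def] measurable_snd] by (simp
        add: c_def)
  interpret m0: masked_innovations M S x1 w v \<zeta> \<rho> A C P Sw Sv Sz err z L "{}" "innovation.law (D -
      1)"
    "innovation.law D" MC c "\<lambda>n \<omega>. if n \<in> {} then z n \<omega> + \<zeta> n \<omega> else z n \<omega>"
    by (rule masked[OF c]) simp
  interpret m1: masked_innovations M S x1 w v \<zeta> \<rho> A C P Sw Sv Sz err z L "{d<..}" "innovation.law
      (D - 1)"
    "innovation.law D" MC c "\<lambda>n \<omega>. if n \<in> {d<..} then z n \<omega> + \<zeta> n \<omega> else z n \<omega>"
    by (rule masked[OF c]) simp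
  interpret NP: prob_space "normal_law P" by (rule prob_space_laws)
  have law0: "m0.\<eta>_law = (\<lambda>n. normal_law Sz)" by (simp add: m0.\<eta>_law_def fun_eq_iff)
  have law1: "m1.\<eta>_law = (\<lambda>n. innovation.law (cc n))"
    by (auto simp: m1.\<eta>_law_def fun_eq_iff cc_def innovation.law_1)
  have z_meas: "z n \<in> borel_measurable M" if "1 \<le> n" for n
    by (rule known_events[of "past (Suc n)"], rule past_subset, rule known_err_z(2)[of "Suc n"])
        (use that in auto)
  have \<zeta>_meas: "\<zeta> n \<in> borel_measurable M" if "1 \<le> n" for n
    by (rule known_events[of "{Attacker n}"]) (use that in \<open>auto simp: all_sources_def intro:
        known_zeta\<close>)
  have [measurable]: "\<rho> \<in> measurable M S" by (rule rho)
  define pF where "pF k = (\<integral>\<omega>. \<Phi> k (\<rho> \<omega>, \<lambda>n\<in>{1..k}. z n \<omega>) \<partial>M)" for k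
  define pD where "pD k = (\<integral>\<omega>. \<Phi> k (\<rho> \<omega>, \<lambda>n\<in>{1..k}. zt n \<omega>) \<partial>M)" for k
  \<comment> \<open>The cut-off at 1 is allowed because the tests are bounded by 1; it provides the dominating
      function.\<close>
  define g where "g k \<omega> = min 1 (\<beta> 1 ^ d * \<beta> D ^ (k - d) * exp (\<kappa> * V (\<theta> \<omega>)))" for k \<omega>
  have [measurable]: "g k \<in> borel_measurable M" for k
    unfolding g_def using V(1) by measurable
  have g01: "0 \<le> g k \<omega>" "g k \<omega> \<le> 1" for k \<omega>
    using \<beta>_nonneg by (auto simp: g_def)
  have g_lim: "(\<lambda>k. \<integral>\<omega>. g k \<omega> \<partial>M) \<longlonglongrightarrow> (\<integral>\<omega>. 0 \<partial>M)"
  proof (rule integral_dominated_convergence[where w="\<lambda>_. 1"])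
    show "AE \<omega> in M. (\<lambda>k. g k \<omega>) \<longlonglongrightarrow> 0"
    proof (intro always_eventually allI)
      fix \<omega>
      have r: "0 \<le> \<beta> D" "\<beta> D < 1" using \<beta>_nonneg[of D] as by (auto simp: \<beta>_def)
      have "(\<lambda>k. \<beta> D ^ (k - d)) \<longlonglongrightarrow> 0"
        by (rule LIMSEQ_offset[where k=d]) (use r in \<open>simp add: LIMSEQ_realpow_zero\<close>)
      then have "(\<lambda>k. \<beta> 1 ^ d * \<beta> D ^ (k - d) * exp (\<kappa> * V (\<theta> \<omega>))) \<longlonglongrightarrow> \<beta> 1 ^ d * 0 * exp (\<kappa> * V (\<theta>
          \<omega>))"
        by (intro tendsto_intros)
      then have "(\<lambda>k. g k \<omega>) \<longlonglongrightarrow> min 1 (\<beta> 1 ^ d * 0 * exp (\<kappa> * V (\<theta> \<omega>)))"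
        unfolding g_def by (intro tendsto_min tendsto_const)
      then show "(\<lambda>k. g k \<omega>) \<longlonglongrightarrow> 0" by simp
    qed
    show "AE \<omega> in M. norm (g k \<omega>) \<le> 1" for k using g01 by auto
  qed auto
  have main: "1 - \<delta> \<le> exp (real k * \<tau>) * pF k + (\<integral>\<omega>. g k \<omega> \<partial>M)" if k: "1 \<le> k" "d \<le> k" for k
  proof -
    note \<Phi>k [measurable] = \<Phi>(1)[OF k(1)]
    have zk [measurable]: "(\<lambda>\<omega>. \<lambda>n\<in>{1..k}. z n \<omega>) \<in> measurable M (PiM {1..k} (\<lambda>_. borel))"
      by (intro measurable_restrict z_meas) simp
    have shift [measurable]: "(\<lambda>(h, \<theta>). \<lambda>n\<in>{1..k}. h n + m n \<theta>) \<in>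
        measurable (PiM {1..k} (\<lambda>_. borel) \<Otimes>\<^sub>M PiM {1..d} (\<lambda>_. borel)) (PiM {1..k} (\<lambda>_. borel ::
            (real^'p) measure))"
      unfolding case_prod_unfold
      by (intro measurable_restrict borel_measurable_add measurable_compose[OF measurable_snd m]
          measurable_compose[OF measurable_fst measurable_component_singleton])
    define \<eta> where "\<eta> n \<omega> = (if n \<in> {d<..} then z n \<omega> + \<zeta> n \<omega> else z n \<omega>)" for n \<omega>
    have \<eta>_meas: "\<eta> n \<in> borel_measurable M" if "1 \<le> n" for n
      using z_meas[OF that] borel_measurable_add[OF z_meas[OF that] \<zeta>_meas[OF that]]
      by (cases "n \<in> {d<..}") (simp_all add: \<eta>_def[abs_def])
    have \<eta>k [measurable]: "(\<lambda>\<omega>. \<lambda>n\<in>{1..k}. \<eta> n \<omega>) \<in> measurable M (PiM {1..k} (\<lambda>_. borel))"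
      by (intro measurable_restrict \<eta>_meas) simp
    have zt_eq: "(\<lambda>n\<in>{1..k}. zt n \<omega>) = (\<lambda>n\<in>{1..k}. (\<lambda>n\<in>{1..k}. \<eta> n \<omega>) n + m n (\<theta> \<omega>))" if "\<omega> \<in>
        space M" for \<omega>
      using zt[OF that] by (auto simp: fun_eq_iff \<eta>_def \<theta>_def)
    have [measurable]: "(\<lambda>\<omega>. \<Phi> k (\<rho> \<omega>, \<lambda>n\<in>{1..k}. z n \<omega>)) \<in> borel_measurable M"
      by (rule measurable_compose[OF _ \<Phi>k]) measurable
    have fD [measurable]: "(\<lambda>\<omega>. \<Phi> k (\<rho> \<omega>, \<lambda>n\<in>{1..k}. (\<lambda>n\<in>{1..k}. \<eta> n \<omega>) n + m n (\<theta> \<omega>))) \<in>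
        borel_measurable M"
      using measurable_compose[OF measurable_Pair[OF \<eta>k \<theta>] shift]
      by (intro measurable_compose[OF _ \<Phi>k] measurable_Pair rho) simp
    have pF: "ennreal (pF k) = (\<integral>\<^sup>+\<omega>. \<integral>\<^sup>+h. ennreal (\<Phi> k (\<rho> \<omega>, h)) \<partial>PiM {1..k} (\<lambda>n. normal_law Sz)
        \<partial>M)"
    proof -
      have "ennreal (pF k) = (\<integral>\<^sup>+\<omega>. ennreal (\<Phi> k (\<rho> \<omega>, \<lambda>n\<in>{1..k}. z n \<omega>)) \<partial>M)"
        unfolding pF_def using \<Phi>(2,3) k
        by (intro nn_integral_eq_integral[symmetric] integrable_const_bound[of _ 1]) auto
      also have "\<dots> = (\<integral>\<^sup>+\<omega>. \<integral>\<^sup>+h. \<integral>\<^sup>+e. ennreal (\<Phi> k (\<rho> \<omega>, h)) \<partial>normal_law P \<partial>PiM {1..k} (\<lambda>n.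
          normal_law Sz) \<partial>M)"
        using m0.innovations_law[of "\<lambda>p. ennreal (\<Phi> k (fst (fst p), fst (snd p)))" k]
        by (simp add: c_def law0 MC_def)
      finally show ?thesis using NP.emeasure_space_1 by simp
    qed
    have pD: "ennreal (pD k) = (\<integral>\<^sup>+\<omega>. \<integral>\<^sup>+h. ennreal (\<Phi> k (\<rho> \<omega>, \<lambda>n\<in>{1..k}. h n + m n (\<theta> \<omega>)))
        \<partial>PiM {1..k} (\<lambda>n. innovation.law (cc n)) \<partial>M)"
    proof -
      have "pD k = (\<integral>\<omega>. \<Phi> k (\<rho> \<omega>, \<lambda>n\<in>{1..k}. (\<lambda>n\<in>{1..k}. \<eta> n \<omega>) n + m n (\<theta> \<omega>)) \<partial>M)"
        unfolding pD_def by (intro Bochner_Integration.integral_cong refl) (simp only: zt_eq)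
      then have "ennreal (pD k) = (\<integral>\<^sup>+\<omega>. ennreal (\<Phi> k (\<rho> \<omega>, \<lambda>n\<in>{1..k}. (\<lambda>n\<in>{1..k}. \<eta> n \<omega>) n + m n
          (\<theta> \<omega>))) \<partial>M)"
        using \<Phi>(2,3) k fD
        by (simp only:) (intro nn_integral_eq_integral[symmetric] integrable_const_bound[of _ 1],
            auto)
      also have "\<dots> = (\<integral>\<^sup>+\<omega>. \<integral>\<^sup>+h. \<integral>\<^sup>+e. ennreal (\<Phi> k (\<rho> \<omega>, \<lambda>n\<in>{1..k}. h n + m n (\<theta> \<omega>)))
          \<partial>normal_law P \<partial>PiM {1..k} (\<lambda>n. innovation.law (cc n)) \<partial>M)"
      proof -
        have "(\<lambda>p. (\<lambda>(h, \<theta>). \<lambda>n\<in>{1..k}. h n + m n \<theta>) (fst (snd p), snd (fst p))) \<in>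
            measurable (MC \<Otimes>\<^sub>M PiM {1..k} (\<lambda>_. borel) \<Otimes>\<^sub>M (borel :: (real^'n) measure)) (PiM
                {1..k} (\<lambda>_. borel))"
          unfolding MC_def by (intro measurable_compose[OF _ shift]) measurable
        then have "(\<lambda>p. ennreal (\<Phi> k (fst (fst p), \<lambda>n\<in>{1..k}. fst (snd p) n + m n (snd (fst p))))) \<in>
            borel_measurable (MC \<Otimes>\<^sub>M PiM {1..k} (\<lambda>_. borel) \<Otimes>\<^sub>M (borel :: (real^'n) measure))"
          unfolding MC_def by (intro measurable_compose[OF _ measurable_ennreal]
              measurable_compose[OF _ \<Phi>k] measurable_Pair) simp_all
        from m1.innovations_law[OF this] show ?thesis
          by (simp add: c_def law1 \<eta>_def)
      qed
      finally show ?thesis using NP.emeasure_space_1 by simp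
    qed
    have point: "(\<integral>\<^sup>+h. ennreal (\<Phi> k (\<rho> \<omega>, \<lambda>n\<in>{1..k}. h n + m n (\<theta> \<omega>))) \<partial>PiM {1..k} (\<lambda>n.
        innovation.law (cc n))) \<le>
        ennreal (exp (real k * \<tau>)) * (\<integral>\<^sup>+h. ennreal (\<Phi> k (\<rho> \<omega>, h)) \<partial>PiM {1..k} (\<lambda>n. normal_law
            Sz)) + ennreal (g k \<omega>)"
      if \<omega>: "\<omega> \<in> space M" for \<omega>
    proof -
      have rs: "\<rho> \<omega> \<in> space S" using measurable_space[OF rho \<omega>] .
      have F: "(\<lambda>h. \<Phi> k (\<rho> \<omega>, h)) \<in> borel_measurable (PiM {1..k} (\<lambda>_. borel))"
        using measurable_compose[OF measurable_Pair1'[OF rs] \<Phi>k] by simp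
      let ?I = "\<integral>\<^sup>+h. ennreal (\<Phi> k (\<rho> \<omega>, \<lambda>n\<in>{1..k}. h n + m n (\<theta> \<omega>))) \<partial>PiM {1..k} (\<lambda>n.
          innovation.law (cc n))"
      let ?B = "ennreal (exp (real k * \<tau>)) * (\<integral>\<^sup>+h. ennreal (\<Phi> k (\<rho> \<omega>, h)) \<partial>PiM {1..k} (\<lambda>n.
          normal_law Sz))"
      let ?R = "\<Prod>n=1..k. exp (- s * \<tau>) * innovation.ratio_bound a s (cc n) * exp (s / 2 * (1 + 1 /
          a) * mahal Sz (m n (\<theta> \<omega>)))"
      have 1: "?I \<le> ?B + ennreal ?R"
        by (rule innovation.testing_bound[OF F]) (use \<Phi>(2,3) k cc sa as in auto)
      interpret pp: prob_space "PiM {1..k} (\<lambda>n. innovation.law (cc n))"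
        by (intro prob_space_PiM innovation.prob_space_law cc)
      have "?I \<le> (\<integral>\<^sup>+h. 1 \<partial>PiM {1..k} (\<lambda>n. innovation.law (cc n)))"
        using \<Phi>(3)[OF k(1)] by (intro nn_integral_mono) simp
      then have 2: "?I \<le> 1" using pp.emeasure_space_1 by simp
      have "?R = (\<Prod>n=1..k. \<beta> (cc n)) * exp (\<kappa> * (\<Sum>n=1..k. mahal Sz (m n (\<theta> \<omega>))))"
        by (simp add: \<beta>_def \<kappa>_def prod.distrib exp_sum sum_distrib_left)
      also have "(\<Prod>n=1..k. \<beta> (cc n)) = (\<Prod>n=1..d. \<beta> (cc n)) * (\<Prod>n=d+1..k. \<beta> (cc n))"
      proof -
        have "{1..k} = {1..d} \<union> {d+1..k}" using k by auto
        then show ?thesis by (simp add: prod.union_disjoint)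
      qed
      also have "\<dots> = \<beta> 1 ^ d * \<beta> D ^ (k - d)"
        by (simp add: cc_def)
      also have "\<beta> 1 ^ d * \<beta> D ^ (k - d) * exp (\<kappa> * (\<Sum>n=1..k. mahal Sz (m n (\<theta> \<omega>)))) \<le>
          \<beta> 1 ^ d * \<beta> D ^ (k - d) * exp (\<kappa> * V (\<theta> \<omega>))"
        using \<beta>_nonneg \<kappa> V(2) by (intro mult_left_mono) (auto intro!: mult_left_mono)
      finally have 3: "?I \<le> ?B + ennreal (\<beta> 1 ^ d * \<beta> D ^ (k - d) * exp (\<kappa> * V (\<theta> \<omega>)))"
        using 1 by (meson add_left_mono ennreal_leI order_trans)
      show ?thesis
        using 2 3 by (cases "1 \<le> \<beta> 1 ^ d * \<beta> D ^ (k - d) * exp (\<kappa> * V (\<theta> \<omega>))")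
          (auto simp: g_def min_def intro: add_increasing)
    qed
    have "ennreal (pD k) \<le> (\<integral>\<^sup>+\<omega>. ennreal (exp (real k * \<tau>)) *
        (\<integral>\<^sup>+h. ennreal (\<Phi> k (\<rho> \<omega>, h)) \<partial>PiM {1..k} (\<lambda>n. normal_law Sz)) + ennreal (g k \<omega>) \<partial>M)"
      unfolding pD by (intro nn_integral_mono point)
    also have "\<dots> = ennreal (exp (real k * \<tau>)) * ennreal (pF k) + ennreal (\<integral>\<omega>. g k \<omega> \<partial>M)"
    proof -
      interpret pp: prob_space "PiM {1..k} (\<lambda>n. normal_law Sz)"
        by (intro prob_space_PiM prob_space_laws)
      have [measurable]: "(\<lambda>\<omega>. \<integral>\<^sup>+h. ennreal (\<Phi> k (\<rho> \<omega>, h)) \<partial>PiM {1..k} (\<lambda>n. normal_law Sz)) \<in>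
          borel_measurable M"
      proof -
        have eq: "sets (S \<Otimes>\<^sub>M PiM {1..k} (\<lambda>n. normal_law Sz)) = sets (S \<Otimes>\<^sub>M PiM {1..k} (\<lambda>_. borel))"
          by (intro sets_pair_measure_cong sets_PiM_cong) auto
        have "(\<lambda>x. ennreal (\<Phi> k x)) \<in> borel_measurable (S \<Otimes>\<^sub>M PiM {1..k} (\<lambda>n. normal_law Sz))"
          unfolding measurable_cong_sets[OF eq refl] by measurable
        from measurable_compose[OF rho pp.borel_measurable_nn_integral_fst[OF this]] show ?thesis .
      qed
      have "(\<integral>\<^sup>+\<omega>. ennreal (g k \<omega>) \<partial>M) = ennreal (\<integral>\<omega>. g k \<omega> \<partial>M)"
        using g01 by (intro nn_integral_eq_integral integrable_const_bound[of _ 1]) auto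
      then show ?thesis by (simp add: nn_integral_add nn_integral_cmult pF)
    qed
    also have "\<dots> = ennreal (exp (real k * \<tau>) * pF k + (\<integral>\<omega>. g k \<omega> \<partial>M))"
    proof -
      have "0 \<le> pF k" "0 \<le> (\<integral>\<omega>. g k \<omega> \<partial>M)"
        unfolding pF_def using \<Phi>(2) g01 by (auto intro!: Bochner_Integration.integral_nonneg)
      then show ?thesis by (subst ennreal_plus) (simp_all add: ennreal_mult)
    qed
    finally have "pD k \<le> exp (real k * \<tau>) * pF k + (\<integral>\<omega>. g k \<omega> \<partial>M)"
      by (subst (asm) ennreal_le_iff) (use \<Phi>(2) g01 in \<open>auto simp: pF_def\<close>)
    then show ?thesis using detects[OF k(1)] by (simp add: pD_def)
  qed
  have "\<forall>\<^sub>F k in sequentially. (\<integral>\<omega>. g k \<omega> \<partial>M) < (1 - \<delta>) / 2"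
    using g_lim \<delta> by (intro order_tendstoD) auto
  then have "\<forall>\<^sub>F k in sequentially. (1 - \<delta>) / 2 \<le> exp (real k * \<tau>) * pF k"
    using eventually_ge_at_top[of 1] eventually_ge_at_top[of d]
  proof eventually_elim
    case (elim k)
    then show ?case using main[of k] by (simp add: field_simps)
  qed
  then show ?thesis by (simp add: pF_def)
qed

lemma err_law:
  assumes "1 \<le> n"
  shows "distr M borel (err n) = normal_law P"
proof (rule measure_eqI)
  note [simp del] = One_nat_def
  have err [measurable]: "err n \<in> borel_measurable M"
    using known_events[OF past_subset known_err_z(1)[OF assms subset_refl]] .
  interpret m: masked_innovations M S x1 w v \<zeta> \<rho> A C P Sw Sv Sz err z L "{}" "innovation.law (D -
      1)"
    "innovation.law D" "count_space UNIV" "\<lambda>_. ()" "\<lambda>n \<omega>. if n \<in> {} then z n \<omega> + \<zeta> n \<omega> else z n \<omega>"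
    by (rule masked) simp
  interpret pp: prob_space "PiM {1..n - 1} m.\<eta>_law"
    by (intro prob_space_PiM m.prob_space_\<eta>_law)
  fix X assume "X \<in> sets (distr M borel (err n))"
  then have [measurable]: "X \<in> sets borel" by simp
  have "emeasure (distr M borel (err n)) X = (\<integral>\<^sup>+\<omega>. indicator X (err n \<omega>) \<partial>M)"
    by (simp add: nn_integral_distr flip: nn_integral_indicator)
  also have "\<dots> = (\<integral>\<^sup>+\<omega>. \<integral>\<^sup>+h. \<integral>\<^sup>+e. indicator X e \<partial>normal_law P \<partial>PiM {1..n - 1} m.\<eta>_law \<partial>M)"
    using m.innovations_law[of "\<lambda>p. indicator X (snd (snd p))" "n - 1"] assms by simp
  also have "\<dots> = emeasure (normal_law P) X"
    using pp.emeasure_space_1 by (simp add: emeasure_space_1)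
  finally show "emeasure (distr M borel (err n)) X = emeasure (normal_law P) X" .
qed simp

lemma normal_err: "1 \<le> n \<Longrightarrow> normal_vector M (err n) P"
  using known_events[OF past_subset known_err_z(1)[OF _ subset_refl]] err_law pd mass_finite
  by (intro normal_vector.intro normal_vector_axioms.intro prob_space_axioms) auto

lemma normal_\<zeta>: "1 \<le> n \<Longrightarrow> normal_vector M (\<zeta> n) ((D - 1) *\<^sub>R Sz)"
  using gaussian_law[OF prob_space_axioms \<zeta>_gaussian[of n]] pos_def_scaleR[OF pos_def_Sz, of "D -
      1"] D
  by (intro normal_vector.intro normal_vector_axioms.intro prob_space_axioms) auto

text \<open>The law of \<open>err n\<close> is symmetric and independent of \<open>Y\<close>, so the expectation does not change
    if \<open>err n\<close>
  is replaced by \<open>- err n\<close>.\<close>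

lemma cross_term:
  assumes n: "1 \<le> n" and Y: "Y \<in> borel_measurable (known (Attacker ` {1..}))"
  shows "expectation (\<lambda>\<omega>. err n \<omega> \<bullet> (W *v Y \<omega>)) = 0"
proof -
  interpret E: normal_vector M "err n" P by (rule normal_err[OF n])
  have X: "err n \<in> borel_measurable (known (past n))" by (rule known_err_z(1)[OF n subset_refl])
  then have X': "(\<lambda>\<omega>. - err n \<omega>) \<in> borel_measurable (known (past n))" by simp
  have sub: "past n \<subseteq> all_sources" "Attacker ` {1..} \<subseteq> all_sources" "past n \<inter> Attacker ` {1..} = {}"
    by (auto simp: past_def all_sources_def)
  have [measurable]: "Y \<in> borel_measurable M" by (rule known_events[OF sub(2) Y])
  have same: "distr M (borel \<Otimes>\<^sub>M borel) (\<lambda>\<omega>. (err n \<omega>, Y \<omega>)) =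
      distr M (borel \<Otimes>\<^sub>M borel) (\<lambda>\<omega>. (- err n \<omega>, Y \<omega>))"
    unfolding indep_known[OF X Y sub, symmetric] indep_known[OF X' Y sub, symmetric]
        E.distr_uminus ..
  have "expectation (\<lambda>\<omega>. err n \<omega> \<bullet> (W *v Y \<omega>)) =
      (\<integral>p. fst p \<bullet> (W *v snd p) \<partial>distr M (borel \<Otimes>\<^sub>M borel) (\<lambda>\<omega>. (err n \<omega>, Y \<omega>)))"
    by (subst integral_distr) simp_all
  also have "\<dots> = expectation (\<lambda>\<omega>. (- err n \<omega>) \<bullet> (W *v Y \<omega>))"
    unfolding same by (subst integral_distr) simp_all
  also have "\<dots> = - expectation (\<lambda>\<omega>. err n \<omega> \<bullet> (W *v Y \<omega>))" by simp
  finally show ?thesis by simp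
qed

text \<open>The two parts of the error are uncorrelated, and \<open>W\<close> measures \<open>C f\<close> in the metric of the
    inverse of
  \<open>Sz\<close>, where \<open>C f\<close> is \<open>\<zeta>\<close> up to the transient \<open>g\<close>.\<close>

theorem mean_square_error:
  fixes f :: "nat \<Rightarrow> 'a \<Rightarrow> real^'n" and g :: "nat \<Rightarrow> 'a \<Rightarrow> real^'p" and s :: "'a \<Rightarrow> real^'n"
  assumes f: "\<And>n. 1 \<le> n \<Longrightarrow> f n \<in> borel_measurable (known (Attacker ` {1..}))"
      "\<And>n. 1 \<le> n \<Longrightarrow> square_integrable M (f n)"
    and Cf: "\<And>n \<omega>. \<omega> \<in> space M \<Longrightarrow> 1 \<le> n \<Longrightarrow> C *v f n \<omega> = \<zeta> n \<omega> - g n \<omega>"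
    and g: "\<And>n \<omega>. \<omega> \<in> space M \<Longrightarrow> 1 \<le> n \<Longrightarrow> norm (g n \<omega>) \<le> c0 * \<gamma> ^ (n - 1) * norm (s \<omega>)"
    and s: "square_integrable M s" and c0: "0 \<le> c0" and \<gamma>: "0 \<le> \<gamma>" "\<gamma> \<le> 1"
    and W: "W = transpose C ** matrix_inv Sz ** C"
  shows "\<exists>b. \<forall>n\<ge>1. \<bar>expectation (\<lambda>\<omega>. (err n \<omega> + f n \<omega>) \<bullet> (W *v (err n \<omega> + f n \<omega>))) -
    (trace (P ** W) + real CARD('p) * (D - 1))\<bar> \<le> b * \<gamma> ^ (n - 1)"
proof -
  define Q where "Q = matrix_inv Sz"
  note iSz = pos_def_inverse[OF pos_def_Sz, folded Q_def]
  have symQ: "(Q *v a) \<bullet> b = a \<bullet> (Q *v b)" for a b by (simp add: inner_matrix_vector iSz(3))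
  have WQ: "a \<bullet> (W *v b) = (C *v a) \<bullet> (Q *v (C *v b))" for a b
    by (simp add: W inner_matrix_vector Q_def flip: matrix_vector_mul_assoc)
  have symW: "a \<bullet> (W *v b) = b \<bullet> (W *v a)" for a b
    by (metis WQ symQ inner_commute)
  define q where "q = onorm ((*v) Q)"
  have q: "norm (Q *v x) \<le> q * norm x" "0 \<le> q" for x
    by (auto simp: q_def intro!: onorm onorm_pos_le)
  define es where "es = expectation (\<lambda>\<omega>. (norm (s \<omega>))\<^sup>2)"
  define ez where "ez = trace ((D - 1) *\<^sub>R Sz)"
  define b where "b = c0 * q * ((1 + c0) * es + ez)"
  have "\<bar>expectation (\<lambda>\<omega>. (err n \<omega> + f n \<omega>) \<bullet> (W *v (err n \<omega> + f n \<omega>))) -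
    (trace (P ** W) + real CARD('p) * (D - 1))\<bar> \<le> b * \<gamma> ^ (n - 1)" if n: "1 \<le> n" for n
  proof -
    interpret E: normal_vector M "err n" P by (rule normal_err[OF n])
    interpret Z: normal_vector M "\<zeta> n" "(D - 1) *\<^sub>R Sz" by (rule normal_\<zeta>[OF n])
    note sq = E.square_integrable f(2)[OF n] Z.square_integrable
    define r where "r \<omega> = f n \<omega> \<bullet> (W *v f n \<omega>) - \<zeta> n \<omega> \<bullet> (Q *v \<zeta> n \<omega>)" for \<omega>
    have int: "integrable M (\<lambda>\<omega>. err n \<omega> \<bullet> (W *v err n \<omega>))" "integrable M (\<lambda>\<omega>. err n \<omega> \<bullet> (W *v f n
        \<omega>))"
        "integrable M (\<lambda>\<omega>. \<zeta> n \<omega> \<bullet> (Q *v \<zeta> n \<omega>))" "integrable M r"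
      unfolding r_def by (intro Bochner_Integration.integrable_diff integrable_inner
          square_integrable_matrix sq)+
    have "(err n \<omega> + f n \<omega>) \<bullet> (W *v (err n \<omega> + f n \<omega>)) = err n \<omega> \<bullet> (W *v err n \<omega>) +
        2 * (err n \<omega> \<bullet> (W *v f n \<omega>)) + \<zeta> n \<omega> \<bullet> (Q *v \<zeta> n \<omega>) + r \<omega>" for \<omega>
      by (simp add: r_def matrix_vector_right_distrib inner_add_left inner_add_right symW[of "f n
          \<omega>" "err n \<omega>"])
    then have "expectation (\<lambda>\<omega>. (err n \<omega> + f n \<omega>) \<bullet> (W *v (err n \<omega> + f n \<omega>))) =
        expectation (\<lambda>\<omega>. err n \<omega> \<bullet> (W *v err n \<omega>)) + 2 * expectation (\<lambda>\<omega>. err n \<omega> \<bullet> (W *v f n \<omega>)) +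
        expectation (\<lambda>\<omega>. \<zeta> n \<omega> \<bullet> (Q *v \<zeta> n \<omega>)) + expectation r"
      using int by simp
    also have "\<dots> = trace (P ** W) + trace (((D - 1) *\<^sub>R Sz) ** Q) + expectation r"
      by (simp add: E.expectation_quadratic Z.expectation_quadratic cross_term[OF n f(1)[OF n]])
    also have "trace (((D - 1) *\<^sub>R Sz) ** Q) = real CARD('p) * (D - 1)"
    proof -
      have "((D - 1) *\<^sub>R Sz) ** Q = (D - 1) *\<^sub>R mat 1"
        by (simp add: matrix_eq matrix_vector_mul_assoc[symmetric]
            scaleR_matrix_vector_assoc[symmetric]
            matrix_vector_left_inverse[OF iSz(1)])
      then show ?thesis by (simp add: trace_def mat_def mult.commute)
    qed
    finally have "\<bar>expectation (\<lambda>\<omega>. (err n \<omega> + f n \<omega>) \<bullet> (W *v (err n \<omega> + f n \<omega>))) -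
        (trace (P ** W) + real CARD('p) * (D - 1))\<bar> = \<bar>expectation r\<bar>" by simp
    also have "\<dots> \<le> expectation (\<lambda>\<omega>. \<bar>r \<omega>\<bar>)" by (rule integral_abs_bound)
    also have "\<dots> \<le> expectation (\<lambda>\<omega>. c0 * \<gamma> ^ (n - 1) * q * ((1 + c0) * (norm (s \<omega>))\<^sup>2 + \<zeta> n \<omega> \<bullet>
        (mat 1 *v \<zeta> n \<omega>)))"
    proof (rule integral_mono)
      show "integrable M (\<lambda>\<omega>. \<bar>r \<omega>\<bar>)" using int(4) by (rule integrable_abs)
      show "integrable M (\<lambda>\<omega>. c0 * \<gamma> ^ (n - 1) * q * ((1 + c0) * (norm (s \<omega>))\<^sup>2 + \<zeta> n \<omega> \<bullet> (mat 1
          *v \<zeta> n \<omega>)))"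
        using s integrable_inner[OF sq(3) square_integrable_matrix[OF sq(3)], of "mat 1"]
        by (auto simp only: square_integrable_def intro!: Bochner_Integration.integrable_add
            integrable_mult_right)
      fix \<omega> assume \<omega>: "\<omega> \<in> space M"
      define G where "G = norm (g n \<omega>)"
      define h where "h = c0 * \<gamma> ^ (n - 1)"
      define \<sigma> where "\<sigma> = norm (s \<omega>)"
      define Zn where "Zn = norm (\<zeta> n \<omega>)"
      have nn: "0 \<le> G" "0 \<le> h" "0 \<le> \<sigma>" "0 \<le> Zn" using c0 \<gamma> by (auto simp: G_def h_def \<sigma>_def Zn_def)
      have Gh: "G \<le> h * \<sigma>" using g[OF \<omega> n] by (simp add: G_def h_def \<sigma>_def)
      have h1: "h \<le> c0" using mult_left_mono[OF power_le_one[OF \<gamma>] c0] by (simp add: h_def)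
      have "r \<omega> = g n \<omega> \<bullet> (Q *v g n \<omega>) - 2 * (g n \<omega> \<bullet> (Q *v \<zeta> n \<omega>))"
        by (simp add: r_def WQ Cf[OF \<omega> n] matrix_vector_mult_diff_distrib inner_diff_left
            inner_diff_right)
          (metis symQ inner_commute)
      then have "\<bar>r \<omega>\<bar> \<le> \<bar>g n \<omega> \<bullet> (Q *v g n \<omega>)\<bar> + 2 * \<bar>g n \<omega> \<bullet> (Q *v \<zeta> n \<omega>)\<bar>" by simp
      also have "\<dots> \<le> G * (q * G) + 2 * (G * (q * Zn))"
      proof (intro add_mono mult_left_mono)
        have "\<bar>g n \<omega> \<bullet> (Q *v x)\<bar> \<le> G * (q * norm x)" for x
          unfolding G_def by (rule order_trans[OF Cauchy_Schwarz_ineq2]) (intro mult_left_mono q,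
              simp)
        then show "\<bar>g n \<omega> \<bullet> (Q *v g n \<omega>)\<bar> \<le> G * (q * G)" "\<bar>g n \<omega> \<bullet> (Q *v \<zeta> n \<omega>)\<bar> \<le> G * (q * Zn)"
          by (simp_all add: G_def Zn_def)
      qed simp
      also have "\<dots> = q * (G * G + 2 * (G * Zn))" by (simp add: algebra_simps)
      also have "\<dots> \<le> q * ((h * \<sigma>) * (h * \<sigma>) + 2 * ((h * \<sigma>) * Zn))"
        using nn Gh q by (intro mult_left_mono add_mono mult_mono) auto
      also have "\<dots> = q * h * (h * \<sigma>\<^sup>2 + 2 * (\<sigma> * Zn))" by (simp add: algebra_simps power2_eq_square)
      also have "\<dots> \<le> q * h * (c0 * \<sigma>\<^sup>2 + (\<sigma>\<^sup>2 + Zn\<^sup>2))"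
      proof (intro mult_left_mono add_mono mult_right_mono h1)
        show "2 * (\<sigma> * Zn) \<le> \<sigma>\<^sup>2 + Zn\<^sup>2"
          using zero_le_power2[of "\<sigma> - Zn"] by (simp add: power2_diff)
      qed (use nn q in auto)
      also have "\<dots> = c0 * \<gamma> ^ (n - 1) * q * ((1 + c0) * (norm (s \<omega>))\<^sup>2 + \<zeta> n \<omega> \<bullet> (mat 1 *v \<zeta> n \<omega>))"
        by (simp add: h_def \<sigma>_def Zn_def power2_norm_eq_inner algebra_simps)
      finally show "\<bar>r \<omega>\<bar> \<le> c0 * \<gamma> ^ (n - 1) * q * ((1 + c0) * (norm (s \<omega>))\<^sup>2 + \<zeta> n \<omega> \<bullet> (mat 1 *v
          \<zeta> n \<omega>))" .
    qed
    also have "\<dots> = c0 * \<gamma> ^ (n - 1) * q * ((1 + c0) * es + ez)"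
    proof -
      have "integrable M (\<lambda>\<omega>. (1 + c0) * (norm (s \<omega>))\<^sup>2)"
        "integrable M (\<lambda>\<omega>. \<zeta> n \<omega> \<bullet> (mat 1 *v \<zeta> n \<omega>))"
        using s integrable_inner[OF sq(3) square_integrable_matrix[OF sq(3)], of "mat 1"]
        by (auto simp only: square_integrable_def intro!: integrable_mult_right)
      then have "expectation (\<lambda>\<omega>. (1 + c0) * (norm (s \<omega>))\<^sup>2 + \<zeta> n \<omega> \<bullet> (mat 1 *v \<zeta> n \<omega>)) = (1 + c0)
          * es + ez"
        using Z.expectation_quadratic[of "mat 1"] unfolding es_def ez_def
        by (subst Bochner_Integration.integral_add) (simp_all only: integral_mult_right_zero
            matrix_mul_rid)
      then show ?thesis by (simp only: integral_mult_right_zero)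
    qed
    also have "\<dots> = b * \<gamma> ^ (n - 1)" by (simp add: b_def)
    finally show ?thesis .
  qed
  then show ?thesis by blast
qed

end

section \<open>The controller as a function of its innovations\<close>

text \<open>The predicted state for time \<open>k + 1\<close> and the measurements up to time \<open>k\<close>, recovered from the
    seed and
  the innovations. The nominal and the attacked run share this function, because the input that the
  plant receives does not enter. The value \<open>undefined\<close> is the one that \<open>restrict\<close> uses off the
      range.\<close>

primrec decoder ::
  "real^'n^'n \<Rightarrow> real^'m^'n \<Rightarrow> real^'n^'p \<Rightarrow> real^'p^'n \<Rightarrow>
   (nat \<Rightarrow> 's \<Rightarrow> (nat \<Rightarrow> real^'p) \<Rightarrow> real^'m) \<Rightarrow> 's \<Rightarrow> (nat \<Rightarrow> real^'p) \<Rightarrow> nat \<Rightarrow>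
   (real^'n) \<times> (nat \<Rightarrow> real^'p)" where
  "decoder A B C K \<mu> s z 0 = (0, \<lambda>_. undefined)"
| "decoder A B C K \<mu> s z (Suc k) =
    (let (xh, Y) = decoder A B C K \<mu> s z k; Y' = Y(Suc k := z (Suc k) + C *v xh)
     in (A *v xh + K *v z (Suc k) + B *v \<mu> (Suc k) s Y', Y'))"

lemma decoder_correct:
  assumes cl: "closed_loop M A B C K \<mu> \<rho> x1 w v x u ua y xh z" and \<omega>: "\<omega> \<in> space M"
  shows "k \<le> N \<Longrightarrow> decoder A B C K \<mu> (\<rho> \<omega>) (\<lambda>n\<in>{1..N}. z n \<omega>) k =
    (xh (k + 1) \<omega>, \<lambda>n\<in>{1..k}. y n \<omega>)"
proof (induction k)
  case 0
  then show ?case using cl \<omega> by (auto simp: closed_loop_def fun_eq_iff)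
next
  case (Suc k)
  have eq: "z (k + 1) \<omega> = y (k + 1) \<omega> - C *v xh (k + 1) \<omega>"
    "u (k + 1) \<omega> = \<mu> (k + 1) (\<rho> \<omega>) (\<lambda>n\<in>{1..k + 1}. y n \<omega>)"
    "xh (k + 1 + 1) \<omega> = A *v xh (k + 1) \<omega> + K *v z (k + 1) \<omega> + B *v u (k + 1) \<omega>"
    using cl \<omega> unfolding closed_loop_def by (auto dest!: spec[of _ "k + 1"])
  have Y: "(\<lambda>n\<in>{1..k}. y n \<omega>)(Suc k := y (Suc k) \<omega>) = (\<lambda>n\<in>{1..Suc k}. y n \<omega>)"
    by (auto simp: fun_eq_iff)
  have d: "decoder A B C K \<mu> (\<rho> \<omega>) (\<lambda>n\<in>{1..N}. z n \<omega>) k = (xh (k + 1) \<omega>, \<lambda>n\<in>{1..k}. y n \<omega>)"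
    by (rule Suc.IH[OF Suc_leD[OF Suc.prems]])
  have z: "(\<lambda>n\<in>{1..N}. z n \<omega>) (Suc k) = z (Suc k) \<omega>" using Suc.prems by simp
  have zy: "z (Suc k) \<omega> + C *v xh (k + 1) \<omega> = y (Suc k) \<omega>" using eq(1) by simp
  have "decoder A B C K \<mu> (\<rho> \<omega>) (\<lambda>n\<in>{1..N}. z n \<omega>) (Suc k) =
      (A *v xh (k + 1) \<omega> + K *v z (Suc k) \<omega> + B *v \<mu> (Suc k) (\<rho> \<omega>) (\<lambda>n\<in>{1..Suc k}. y n \<omega>),
       \<lambda>n\<in>{1..Suc k}. y n \<omega>)"
    by (simp only: decoder.simps d Let_def prod.case z zy Y)
  then show ?case
    using eq(2,3) by (simp only: Suc_eq_plus1)
qed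

lemma decoder_measurable:
  fixes \<mu> :: "nat \<Rightarrow> 's \<Rightarrow> (nat \<Rightarrow> real^'p) \<Rightarrow> real^'m"
  assumes law: "control_law S \<mu>"
  shows "k \<le> N \<Longrightarrow> (\<lambda>p. fst (decoder A B C K \<mu> (fst p) (snd p) k)) \<in>
      borel_measurable (S \<Otimes>\<^sub>M PiM {1..N} (\<lambda>_. borel)) \<and>
    (\<lambda>p. snd (decoder A B C K \<mu> (fst p) (snd p) k)) \<in>
      measurable (S \<Otimes>\<^sub>M PiM {1..N} (\<lambda>_. borel)) (PiM {1..k} (\<lambda>_. borel))"
proof (induction k)
  case 0
  then show ?case by (simp add: space_PiM)
next
  case (Suc k)
  let ?M = "S \<Otimes>\<^sub>M PiM {1..N} (\<lambda>_. borel :: (real^'p) measure)"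
  define xh where "xh = (\<lambda>p. fst (decoder A B C K \<mu> (fst p) (snd p) k))"
  define Y where "Y = (\<lambda>p. snd (decoder A B C K \<mu> (fst p) (snd p) k))"
  have [measurable]: "xh \<in> borel_measurable ?M" "Y \<in> measurable ?M (PiM {1..k} (\<lambda>_. borel))"
    using Suc by (auto simp: xh_def Y_def)
  have z [measurable]: "(\<lambda>p. snd p (Suc k)) \<in> borel_measurable ?M"
    by (rule measurable_compose[OF measurable_snd measurable_component_singleton]) (use Suc in auto)
  define Y' where "Y' = (\<lambda>p. (Y p)(Suc k := snd p (Suc k) + C *v xh p))"
  have Y' [measurable]: "Y' \<in> measurable ?M (PiM {1..Suc k} (\<lambda>_. borel))"
    unfolding Y'_def by measurable
  have "(\<lambda>(s, y). \<mu> (Suc k) s y) \<in> borel_measurable (S \<Otimes>\<^sub>M PiM {1..Suc k} (\<lambda>_. borel))"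
    using law by (simp add: control_law_def)
  from measurable_compose[OF measurable_Pair[OF measurable_fst Y'] this]
  have [measurable]: "(\<lambda>p. \<mu> (Suc k) (fst p) (Y' p)) \<in> borel_measurable ?M" by simp
  have "(\<lambda>p. A *v xh p + K *v snd p (Suc k) + B *v \<mu> (Suc k) (fst p) (Y' p)) \<in> borel_measurable ?M"
    by measurable
  moreover have "fst (decoder A B C K \<mu> (fst p) (snd p) (Suc k)) =
      A *v xh p + K *v snd p (Suc k) + B *v \<mu> (Suc k) (fst p) (Y' p)"
    and "snd (decoder A B C K \<mu> (fst p) (snd p) (Suc k)) = Y' p" for p
    by (simp_all add: Let_def case_prod_unfold xh_def Y_def Y'_def)
  ultimately show ?case using Y' by (simp only:)
qed

lemma borel_measurable_funpow_matrix [measurable (raw)]: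
  fixes f :: "'a \<Rightarrow> real^'n" and F :: "real^'n^'n"
  assumes f: "f \<in> borel_measurable M"
  shows "(\<lambda>x. ((*v) F ^^ k) (f x)) \<in> borel_measurable M"
  using f by (induction k) simp_all

lemma limsup_error_exponent_le:
  assumes c: "0 < c" and ev: "\<forall>\<^sub>F k in sequentially. c \<le> exp (real k * \<tau>) * p k"
  shows "limsup (\<lambda>k. ereal (1 / real k) * neg_log (p k)) \<le> ereal \<tau>"
proof -
  have "limsup (\<lambda>k. ereal (1 / real k) * neg_log (p k)) \<le> limsup (\<lambda>k. ereal (\<tau> + (- ln c) * (1 /
      real k)))"
  proof (rule Limsup_mono)
    show "\<forall>\<^sub>F k in sequentially. ereal (1 / real k) * neg_log (p k) \<le> ereal (\<tau> + (- ln c) * (1 /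
        real k))"
      using ev eventually_gt_at_top[of 0]
    proof eventually_elim
      case (elim k)
      have "0 < exp (real k * \<tau>) * p k" using elim c by linarith
      then have p: "0 < p k" by (simp add: zero_less_mult_iff)
      have "ln c \<le> ln (exp (real k * \<tau>) * p k)" using elim c by simp
      also have "\<dots> = real k * \<tau> + ln (p k)" using p by (simp add: ln_mult)
      finally have "- ln (p k) \<le> real k * \<tau> - ln c" by simp
      then have "1 / real k * (- ln (p k)) \<le> 1 / real k * (real k * \<tau> - ln c)"
        by (intro mult_left_mono) auto
      also have "\<dots> = \<tau> + (- ln c) * (1 / real k)" using elim by (simp add: field_simps)
      finally show ?case using p by (simp add: neg_log_def)
    qed
  qed
  also have "\<dots> = ereal (\<tau> + (- ln c) * 0)"
    by (intro lim_imp_Limsup tendsto_ereal tendsto_add tendsto_mult tendsto_const lim_1_over_n) simp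
  finally show ?thesis by simp
qed

section \<open>Stealthiness and performance of the attack\<close>

text \<open>On \<open>{1..}\<close> the function \<open>d - ln d\<close> is strictly increasing and unbounded.\<close>

lemma delta_bar:
  assumes t: "0 < t"
  shows "1 < delta_bar t" "delta_bar t = 2 * t + 1 + ln (delta_bar t)"
proof -
  have inc: "a - ln a < b - ln b" if "1 \<le> a" "a < b" for a b :: real
  proof -
    have "ln b - ln a = ln (b / a)" using that by (simp add: ln_div)
    also have "\<dots> < b / a - 1"
    proof -
      have "b / a \<noteq> 1" "0 < b / a" using that by auto
      then show ?thesis using ln_le_minus_one[of "b / a"] ln_eq_minus_one[of "b / a"] by linarith
    qed
    also have "\<dots> = (b - a) / a" using that by (simp add: diff_divide_distrib)
    also have "\<dots> \<le> (b - a) / 1" using that by (intro divide_left_mono) auto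
    finally show ?thesis by simp
  qed
  \<comment> \<open>By \<open>ln X \<le> X / 2\<close>, the function \<open>d - ln d\<close> has reached \<open>2 * t + 1\<close> at \<open>X\<close>.\<close>
  define X where "X = 4 * t + 2"
  have X: "1 \<le> X" "0 < X" using t by (auto simp: X_def)
  have "\<exists>d\<ge>1. d \<le> X \<and> d - ln d = 2 * t + 1"
  proof (rule IVT')
    have "ln X = ln (X / 2) + ln 2" using X by (simp add: ln_div)
    also have "\<dots> \<le> X / 2" using ln_le_minus_one[of "X / 2"] ln_le_minus_one[of "2::real"] X by simp
    finally show "2 * t + 1 \<le> X - ln X" by (simp add: X_def)
  qed (use t X in \<open>auto intro!: continuous_intros\<close>)
  then obtain d where d: "1 \<le> d" "d - ln d = 2 * t + 1" by blast
  have "delta_bar t = d"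
    unfolding delta_bar_def
  proof (rule the_equality)
    fix e assume "1 \<le> e \<and> e = 2 * t + 1 + ln e"
    then have e: "1 \<le> e" "e - ln e = d - ln d" using d by auto
    show "e = d" using inc[of e d] inc[of d e] e d by (cases e d rule: linorder_cases) auto
  qed (use d in auto)
  moreover have "d \<noteq> 1" using d t by auto
  ultimately show "1 < delta_bar t" "delta_bar t = 2 * t + 1 + ln (delta_bar t)" using d by auto
qed

theorem theorem14:
  fixes M :: "'a measure" and S :: "'s measure"
    and A :: "real^'n^'n" and B :: "real^'m^'n" and C :: "real^'n^'p"
    and Sw P W :: "real^'n^'n" and Sv Sz :: "real^'p^'p" and K :: "real^'p^'n"
    and x1 :: "'a \<Rightarrow> real^'n" and w :: "nat \<Rightarrow> 'a \<Rightarrow> real^'n" and v :: "nat \<Rightarrow> 'a \<Rightarrow> real^'p"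
    and \<mu> :: "nat \<Rightarrow> 's \<Rightarrow> (nat \<Rightarrow> real^'p) \<Rightarrow> real^'m" and \<rho> :: "'a \<Rightarrow> 's"
    and x xh xt xht :: "nat \<Rightarrow> 'a \<Rightarrow> real^'n"
    and y z yt zt \<zeta> :: "nat \<Rightarrow> 'a \<Rightarrow> real^'p"
    and u ut ua \<phi> :: "nat \<Rightarrow> 'a \<Rightarrow> real^'m"
    and \<I> :: "nat \<Rightarrow> 'a measure"
    and G :: "(real poly fract)^'p^'m"
    and \<epsilon> \<delta> :: real
  assumes prob: "prob_space M"
    and eps: "0 < \<epsilon>" and delta: "0 < \<delta>" "\<delta> < 1"
    and noise_cov: "pos_def Sw" "pos_def Sv"
    and no_zeros: "\<And>s. \<not> invariant_zero A B C s"
    and minimal: "controllable A B" "observable A C"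
    and right_inv: "right_invertible A B C"
    and P: "pos_semidef P" "riccati A C Sw Sv P"
    and Sz: "Sz = innovation_cov C Sv P"
    and K: "K = kalman_gain A C Sv P"
    and W: "W = transpose C ** matrix_inv Sz ** C"
    and x1: "gaussian M x1 P"
    and w: "\<And>k. 1 \<le> k \<Longrightarrow> gaussian M (w k) Sw"
    and v: "\<And>k. 1 \<le> k \<Longrightarrow> gaussian M (v k) Sv"
    and \<zeta>: "\<And>k. 1 \<le> k \<Longrightarrow>
          gaussian M (\<zeta> k) ((delta_bar (\<epsilon> / real CARD('p)) - 1) *\<^sub>R Sz)"
    and \<rho>: "\<rho> \<in> measurable M S"
    and indep: "independent_sources M S x1 w v \<zeta> \<rho>"
    and law: "control_law S \<mu>"
    and nominal: "closed_loop M A B C K \<mu> \<rho> x1 w v x u u y xh z"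
    \<comment> \<open>operation under the attack: the controller computes \<open>ut\<close>, the plant receives \<open>ua\<close>\<close>
    and attacked: "closed_loop M A B C K \<mu> \<rho> x1 w v xt ut ua yt xht zt"
    and info: "information_pattern M w v ut \<I>"
    and G: "right_inverse (A - K ** C) B C G"
    and \<phi>: "\<And>k \<omega>. 1 \<le> k \<Longrightarrow> \<omega> \<in> space M \<Longrightarrow>
          \<phi> k \<omega> = system_output G (\<lambda>n. \<zeta> n \<omega>) k"
    and attack: "\<And>k \<omega>. 1 \<le> k \<Longrightarrow> \<omega> \<in> space M \<Longrightarrow> ua k \<omega> = ut k \<omega> + \<phi> k \<omega>"
  shows "stealthy M \<epsilon> \<delta> y yt \<and>
    weighted_mse M W xt xht =
      ereal (trace (P ** W) + real CARD('p) * (delta_bar (\<epsilon> / real CARD('p)) - 1))"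
proof -
  note [simp del] = One_nat_def
  define D where "D = delta_bar (\<epsilon> / real CARD('p))"
  have Dbar: "1 < D" "real CARD('p) / 2 * (D - 1 - ln D) = \<epsilon>"
  proof -
    have t: "0 < \<epsilon> / real CARD('p)" using eps by simp
    show "1 < D" unfolding D_def by (rule delta_bar(1)[OF t])
    have "D - 1 - ln D = 2 * (\<epsilon> / real CARD('p))"
      using delta_bar(2)[OF t] unfolding D_def[symmetric] by linarith
    then show "real CARD('p) / 2 * (D - 1 - ln D) = \<epsilon>" by simp
  qed
  have pdP: "pos_def P" by (rule riccati_pos_def[OF P noise_cov(2,1)])
  define err where "err k \<omega> = x k \<omega> - xh k \<omega>" for k \<omega>
  define L where "L = (\<lambda>z. P *v (transpose C *v (matrix_inv Sz *v z)))"
  have AL: "A *v L z = K *v z" for z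
    by (simp add: L_def K kalman_gain_def Sz matrix_vector_mul_assoc matrix_mul_assoc)
  interpret prob_space M by (rule prob)
  interpret attacked_filter M S x1 w v \<zeta> \<rho> A C P Sw Sv Sz err z L D
  proof (intro attacked_filter.intro kalman_filter.intro noise_sources.intro
      noise_sources_axioms.intro kalman_filter_axioms.intro attacked_filter_axioms.intro)
    show "prob_space M" by (rule prob)
    show "independent_sources M S x1 w v \<zeta> \<rho>" by (rule indep)
    show "\<rho> \<in> measurable M S" by (rule \<rho>)
    show "pos_def P" by (rule pdP)
    show "pos_def Sw" "pos_def Sv" by (rule noise_cov)+
    show "riccati A C Sw Sv P" by (rule P)
    show "Sz = innovation_cov C Sv P" by (rule Sz)
    show "L = (\<lambda>z. P *v (transpose C *v (matrix_inv Sz *v z)))" by (rule L_def)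
    show "gaussian M x1 P" by (rule x1)
    show "gaussian M (w k) Sw" if "1 \<le> k" for k using that by (rule w)
    show "gaussian M (v k) Sv" if "1 \<le> k" for k using that by (rule v)
    show "1 < D" by (rule Dbar)
    show "gaussian M (\<zeta> k) ((D - 1) *\<^sub>R Sz)" if "1 \<le> k" for k
      unfolding D_def using that by (rule \<zeta>)
  next
    fix k \<omega> assume \<omega>: "\<omega> \<in> space M" and k: "1 \<le> (k::nat)"
    have eq: "x (k + 1) \<omega> = A *v x k \<omega> + B *v u k \<omega> + w k \<omega>" "y k \<omega> = C *v x k \<omega> + v k \<omega>"
        "z k \<omega> = y k \<omega> - C *v xh k \<omega>" "xh (k + 1) \<omega> = A *v xh k \<omega> + K *v z k \<omega> + B *v u k \<omega>"
      using nominal \<omega> k unfolding closed_loop_def by blast+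
    show "z k \<omega> = v k \<omega> + C *v err k \<omega>"
      by (simp add: eq(2,3) err_def matrix_vector_mult_diff_distrib)
    show "err (k + 1) \<omega> = w k \<omega> + A *v (err k \<omega> - L (z k \<omega>))"
      by (simp add: eq(1,4) err_def matrix_vector_mult_diff_distrib AL)
  next
    fix \<omega> assume "\<omega> \<in> space M"
    then show "err 1 \<omega> = x1 \<omega>" using nominal unfolding closed_loop_def by (simp add: err_def)
  qed
  define F' where "F' = A - K ** C"
  obtain d \<Gamma> where traj: "\<And>f. \<exists>F. F 1 = (\<Sum>n=1..d. \<Gamma> n *v f n) \<and>
       (\<forall>k\<ge>1. C *v F k = f k \<and> F (k + 1) = F' *v F k + B *v system_output G f k)"
    by (rule right_inverse_trajectory[OF G, folded F'_def], rule that, drule meta_spec, assumption)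
  obtain c \<gamma> where c: "0 < c" "0 \<le> \<gamma>" "\<gamma> < 1" and stable: "\<And>k s. norm (((*v) F' ^^ k) s) \<le> c * \<gamma> ^
      k * norm s"
    by (rule error_dynamics_stable[OF P noise_cov(2,1), folded K, folded F'_def], rule that,
        assumption, assumption, assumption, drule meta_spec, drule meta_spec, assumption)
  define \<phi>' where "\<phi>' k \<omega> = system_output G (\<lambda>n. \<zeta> n \<omega>) k" for k \<omega>
  \<comment> \<open>The difference of the attacked and the nominal prediction error, with time shifted by one.\<close>
  define dev where "dev = rec_nat (\<lambda>_. 0) (\<lambda>k f \<omega>. F' *v f \<omega> + B *v \<phi>' (Suc k) \<omega>)"
  have dev_simps: "dev 0 = (\<lambda>_. 0)" "dev (Suc k) = (\<lambda>\<omega>. F' *v dev k \<omega> + B *v \<phi>' (Suc k) \<omega>)" for k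
    by (simp_all add: dev_def)
  define f where "f n = dev (n - 1)" for n
  have f_1: "f 1 = (\<lambda>_. 0)" by (simp add: f_def dev_simps)
  have f_Suc: "f (n + 1) \<omega> = F' *v f n \<omega> + B *v \<phi>' n \<omega>" if "1 \<le> n" for n \<omega>
    using that by (cases n) (simp_all add: f_def dev_simps One_nat_def)
  have attacked_err: "xt n \<omega> - xht n \<omega> = err n \<omega> + f n \<omega>" "zt n \<omega> = z n \<omega> + C *v f n \<omega>"
    if \<omega>: "\<omega> \<in> space M" and n: "1 \<le> n" for n \<omega>
  proof -
    have zt_err: "zt n \<omega> = v n \<omega> + C *v (xt n \<omega> - xht n \<omega>)" if n: "1 \<le> n" for n
    proof -
      have "yt n \<omega> = C *v xt n \<omega> + v n \<omega>" "zt n \<omega> = yt n \<omega> - C *v xht n \<omega>"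
        using attacked \<omega> n unfolding closed_loop_def by blast+
      then show ?thesis by (simp add: matrix_vector_mult_diff_distrib)
    qed
    show 1: "xt n \<omega> - xht n \<omega> = err n \<omega> + f n \<omega>" using n
    proof (induction n rule: nat_induct_at_least)
      case base
      have "xt 1 \<omega> = x1 \<omega>" "xht 1 \<omega> = 0" using attacked \<omega> unfolding closed_loop_def by blast+
      then show ?case using err_1[OF \<omega>] by (simp add: f_1)
    next
      case (Suc n)
      have eq: "xt (n + 1) \<omega> = A *v xt n \<omega> + B *v ua n \<omega> + w n \<omega>"
          "xht (n + 1) \<omega> = A *v xht n \<omega> + K *v zt n \<omega> + B *v ut n \<omega>"
        using attacked \<omega> Suc.hyps unfolding closed_loop_def by blast+
      have ua: "ua n \<omega> = ut n \<omega> + \<phi>' n \<omega>" using attack \<phi> \<omega> Suc.hyps by (simp add: \<phi>'_def)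
      have "xt (n + 1) \<omega> - xht (n + 1) \<omega> =
          A *v (xt n \<omega> - xht n \<omega>) + B *v \<phi>' n \<omega> + w n \<omega> - K *v zt n \<omega>"
        by (simp add: eq ua matrix_vector_right_distrib matrix_vector_mult_diff_distrib)
      also have "\<dots> = (w n \<omega> + A *v (err n \<omega> - L (z n \<omega>))) + (F' *v f n \<omega> + B *v \<phi>' n \<omega>)"
        unfolding zt_err[OF Suc.hyps] Suc.IH innovation[OF \<omega> Suc.hyps]
        by (simp add: F'_def AL matrix_vector_right_distrib matrix_vector_mult_diff_distrib
            matrix_vector_mult_diff_rdistrib flip: matrix_vector_mul_assoc)
      finally show ?case
        unfolding Suc_eq_plus1 using err_Suc[OF \<omega> Suc.hyps] f_Suc[OF Suc.hyps] by simp
    qed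
    show "zt n \<omega> = z n \<omega> + C *v f n \<omega>"
      unfolding zt_err[OF n] 1 innovation[OF \<omega> n] by (simp add: matrix_vector_right_distrib)
  qed
  define s where "s \<omega> = (\<Sum>n=1..d. \<Gamma> n *v \<zeta> n \<omega>)" for \<omega>
  \<comment> \<open>The transient that remains because the attack is applied from time 1 on only.\<close>
  define g where "g n \<omega> = C *v (((*v) F' ^^ (n - 1)) (s \<omega>))" for n \<omega>
  have Cf: "C *v f n \<omega> = \<zeta> n \<omega> - g n \<omega>" if n: "1 \<le> n" for n \<omega>
  proof -
    obtain F where F: "F 1 = s \<omega>" "\<And>k. 1 \<le> k \<Longrightarrow> C *v F k = \<zeta> k \<omega>"
        "\<And>k. 1 \<le> k \<Longrightarrow> F (k + 1) = F' *v F k + B *v \<phi>' k \<omega>"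
      using traj[of "\<lambda>n. \<zeta> n \<omega>"] unfolding s_def \<phi>'_def by blast
    have "f n \<omega> = F n - ((*v) F' ^^ (n - 1)) (s \<omega>)"
      using n
    proof (induction n rule: nat_induct_at_least)
      case base
      then show ?case by (simp add: f_1 F(1))
    next
      case (Suc n)
      then obtain j where j: "n = Suc j" by (cases n) (auto simp: One_nat_def)
      show ?case
        using Suc.IH f_Suc[OF Suc.hyps, of \<omega>] F(3)[OF Suc.hyps]
        by (simp add: j matrix_vector_mult_diff_distrib One_nat_def)
    qed
    then show ?thesis by (simp add: matrix_vector_mult_diff_distrib F(2)[OF n] g_def)
  qed
  define oC where "oC = onorm ((*v) C)"
  define c0 where "c0 = oC * c"
  have oC: "norm (C *v x) \<le> oC * norm x" "0 \<le> oC" for x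
    by (auto simp: oC_def intro!: onorm onorm_pos_le)
  have c0: "0 \<le> c0" using oC c by (simp add: c0_def)
  have decay: "norm (C *v (((*v) F' ^^ k) r)) \<le> c0 * \<gamma> ^ k * norm r" for k r
    using order_trans[OF oC(1) mult_left_mono[OF stable oC(2)]] by (simp add: c0_def mult_ac)
  have "stealthy M \<epsilon> \<delta> y yt"
    unfolding stealthy_def
  proof (intro allI impI)
    fix Det :: "nat \<Rightarrow> (nat \<Rightarrow> real^'p) \<Rightarrow> real"
    assume Det: "detector Det"
      and detects: "\<forall>k\<ge>1. 0 < 1 - alarm_prob M Det yt k \<and> 1 - alarm_prob M Det yt k \<le> \<delta>"
    \<comment> \<open>The detector as a test on seed and innovations.\<close>
    define \<Phi> where "\<Phi> k p = (if 1 \<le> k then Det k (snd (decoder A B C K \<mu> (fst p) (snd p) k)) else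
        0)" for k p
    have \<Phi>: "\<Phi> k \<in> borel_measurable (S \<Otimes>\<^sub>M PiM {1..k} (\<lambda>_. borel))" if "1 \<le> k" for k
    proof -
      have "(\<lambda>p. snd (decoder A B C K \<mu> (fst p) (snd p) k)) \<in>
          measurable (S \<Otimes>\<^sub>M PiM {1..k} (\<lambda>_. borel)) (PiM {1..k} (\<lambda>_. borel))"
        by (rule conjunct2[OF decoder_measurable[OF law order_refl]])
      moreover have "Det k \<in> borel_measurable (PiM {1..k} (\<lambda>_. borel))"
        using Det that unfolding detector_def by blast
      ultimately have "(\<lambda>p. Det k (snd (decoder A B C K \<mu> (fst p) (snd p) k))) \<in>
          borel_measurable (S \<Otimes>\<^sub>M PiM {1..k} (\<lambda>_. borel))"
        by (rule measurable_compose)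
      then show ?thesis using that by (simp add: \<Phi>_def[abs_def])
    qed
    have alarm: "alarm_prob M Det y k = (\<integral>\<omega>. \<Phi> k (\<rho> \<omega>, \<lambda>n\<in>{1..k}. z n \<omega>) \<partial>M)"
      "alarm_prob M Det yt k = (\<integral>\<omega>. \<Phi> k (\<rho> \<omega>, \<lambda>n\<in>{1..k}. zt n \<omega>) \<partial>M)" if "1 \<le> k" for k
      unfolding alarm_prob_def using that
      by (auto intro!: Bochner_Integration.integral_cong
          simp: \<Phi>_def decoder_correct[OF nominal _ order_refl] decoder_correct[OF attacked _
              order_refl])
    \<comment> \<open>The mean of the attacked innovation at time \<open>n\<close>, given the noise \<open>\<theta>\<close> of the attacker up to
        time \<open>d\<close>.\<close>
    define m where "m n \<theta> = (if 1 \<le> n \<and> n \<le> d then \<theta> n else 0) -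
        C *v (((*v) F' ^^ (n - 1)) (\<Sum>j=1..d. \<Gamma> j *v \<theta> j))" for n and \<theta> :: "nat \<Rightarrow> real^'p"
    obtain b where b: "0 < b" "\<And>x. mahal Sz x \<le> b * (norm x)\<^sup>2"
      by (rule quadratic_form_le[of "matrix_inv Sz", folded mahal_def], rule that,
          assumption, drule meta_spec, assumption)
    \<comment> \<open>The total energy of these means: finitely many noise terms and a geometric series.\<close>
    define V where "V \<theta> = 2 * (\<Sum>n=1..d. mahal Sz (\<theta> n)) +
        2 * (b * (c0 * norm (\<Sum>j=1..d. \<Gamma> j *v \<theta> j))\<^sup>2 * (1 / (1 - \<gamma>)))" for \<theta> :: "nat \<Rightarrow> real^'p"
    have comp [measurable]: "(\<lambda>\<theta>. \<theta> n) \<in> borel_measurable (PiM {1..d} (\<lambda>_. borel :: (real^'p)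
        measure))"
      if "n \<in> {1..d}" for n
      using that by (rule measurable_component_singleton)
    have sum_meas [measurable]: "(\<lambda>\<theta>. \<Sum>j=1..d. \<Gamma> j *v \<theta> j) \<in>
        borel_measurable (PiM {1..d} (\<lambda>_. borel :: (real^'p) measure))"
      by (intro borel_measurable_sum borel_measurable_matrix_vector_mult comp)
    have m_meas: "m n \<in> borel_measurable (PiM {1..d} (\<lambda>_. borel))" for n
    proof -
      have "(\<lambda>\<theta>. if 1 \<le> n \<and> n \<le> d then \<theta> n else 0) \<in>
          borel_measurable (PiM {1..d} (\<lambda>_. borel :: (real^'p) measure))"
        using comp[of n] by (cases "1 \<le> n \<and> n \<le> d") auto
      moreover have "(\<lambda>\<theta>. C *v (((*v) F' ^^ (n - 1)) (\<Sum>j=1..d. \<Gamma> j *v \<theta> j))) \<in>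
          borel_measurable (PiM {1..d} (\<lambda>_. borel :: (real^'p) measure))"
        by (intro borel_measurable_matrix_vector_mult borel_measurable_funpow_matrix sum_meas)
      ultimately show ?thesis unfolding m_def[abs_def] by (rule borel_measurable_diff)
    qed
    have V_meas: "V \<in> borel_measurable (PiM {1..d} (\<lambda>_. borel))"
      unfolding V_def by (intro borel_measurable_add borel_measurable_times borel_measurable_const
          borel_measurable_sum measurable_compose[OF comp mahal_measurable] borel_measurable_power
          measurable_compose[OF sum_meas borel_measurable_norm])
    have V_bound: "(\<Sum>n=1..k. mahal Sz (m n \<theta>)) \<le> V \<theta>" for k \<theta>
    proof -
      define r where "r = (\<Sum>j=1..d. \<Gamma> j *v \<theta> j)"
      have "mahal Sz (m n \<theta>) \<le> 2 * (if n \<le> d then mahal Sz (\<theta> n) else 0) +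
          2 * (b * (c0 * norm r)\<^sup>2 * \<gamma> ^ (n - 1))" if n: "n \<in> {1..k}" for n
      proof -
        define t where "t = C *v (((*v) F' ^^ (n - 1)) r)"
        have "mahal Sz t \<le> b * (norm t)\<^sup>2" by (rule b)
        also have "\<dots> \<le> b * (c0 * \<gamma> ^ (n - 1) * norm r)\<^sup>2"
          using b decay by (intro mult_left_mono power_mono) (auto simp: t_def)
        also have "\<dots> = b * (c0 * norm r)\<^sup>2 * (\<gamma> ^ (n - 1) * \<gamma> ^ (n - 1))"
          by (simp add: power2_eq_square mult_ac)
        also have "\<dots> \<le> b * (c0 * norm r)\<^sup>2 * (\<gamma> ^ (n - 1) * 1)"
          using b c by (intro mult_left_mono power_le_one) auto
        finally have t: "mahal Sz t \<le> b * (c0 * norm r)\<^sup>2 * \<gamma> ^ (n - 1)" by simp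
        have "m n \<theta> = (if n \<le> d then \<theta> n else 0) + - t"
          using n by (simp add: m_def t_def r_def)
        then have "mahal Sz (m n \<theta>) \<le> 2 * mahal Sz (if n \<le> d then \<theta> n else 0) + 2 * mahal Sz (- t)"
          using mahal_add_le[OF pos_def_Sz, of 1 "if n \<le> d then \<theta> n else 0" "- t"] by simp
        moreover have "mahal Sz (- t) = mahal Sz t" using mahal_scale[of Sz "-1" t] by simp
        moreover have "mahal Sz 0 = 0" by (simp add: mahal_def)
        ultimately show ?thesis using t by auto
      qed
      then have "(\<Sum>n=1..k. mahal Sz (m n \<theta>)) \<le> (\<Sum>n=1..k. 2 * (if n \<le> d then mahal Sz (\<theta> n) else 0) +
          2 * (b * (c0 * norm r)\<^sup>2 * \<gamma> ^ (n - 1)))" by (rule sum_mono)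
      also have "\<dots> = 2 * (\<Sum>n=1..k. (if n \<le> d then mahal Sz (\<theta> n) else 0)) +
          2 * (b * (c0 * norm r)\<^sup>2 * (\<Sum>n=1..k. \<gamma> ^ (n - 1)))"
        by (simp only: sum.distrib sum_distrib_left)
      also have "\<dots> \<le> 2 * (\<Sum>n=1..d. mahal Sz (\<theta> n)) + 2 * (b * (c0 * norm r)\<^sup>2 * (1 / (1 - \<gamma>)))"
      proof (intro add_mono mult_left_mono sum_power_pred_le c)
        have "(\<Sum>n=1..k. (if n \<le> d then mahal Sz (\<theta> n) else 0)) = (\<Sum>n\<in>{1..k} \<inter> {n. n \<le> d}. mahal Sz
            (\<theta> n))"
          by (simp add: sum.inter_restrict)
        also have "\<dots> \<le> (\<Sum>n=1..d. mahal Sz (\<theta> n))"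
          by (rule sum_mono2) (auto simp: mahal_nonneg pos_def_Sz)
        finally show "(\<Sum>n=1..k. (if n \<le> d then mahal Sz (\<theta> n) else 0)) \<le> (\<Sum>n=1..d. mahal Sz (\<theta>
            n))" .
      qed (use b in auto)
      finally show ?thesis by (simp add: V_def r_def)
    qed
    have zt_eq: "zt n \<omega> = (if d < n then z n \<omega> + \<zeta> n \<omega> else z n \<omega>) + m n (\<lambda>j\<in>{1..d}. \<zeta> j \<omega>)"
      if \<omega>: "\<omega> \<in> space M" and n: "1 \<le> n" for n \<omega>
    proof -
      have "(\<Sum>j=1..d. \<Gamma> j *v (\<lambda>j\<in>{1..d}. \<zeta> j \<omega>) j) = s \<omega>" by (simp add: s_def)
      then show ?thesis
        using attacked_err(2)[OF \<omega> n] n by (simp add: Cf[OF n] m_def g_def)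
    qed
    show "limsup (\<lambda>k. ereal (1 / real k) * neg_log (alarm_prob M Det y k)) \<le> ereal \<epsilon>"
    proof (rule ereal_le_epsilon2)
      fix e :: real assume e: "0 < e"
      have "\<forall>\<^sub>F k in sequentially. (1 - \<delta>) / 2 \<le> exp (real k * (\<epsilon> + e)) *
          (\<integral>\<omega>. \<Phi> k (\<rho> \<omega>, \<lambda>n\<in>{1..k}. z n \<omega>) \<partial>M)"
      proof (rule detection_bound[OF \<Phi> _ _ m_meas V_meas V_bound zt_eq delta(2)])
        show "real CARD('p) / 2 * (D - 1 - ln D) < \<epsilon> + e" unfolding Dbar(2) using e by simp
        show "1 - (\<integral>\<omega>. \<Phi> k (\<rho> \<omega>, \<lambda>n\<in>{1..k}. zt n \<omega>) \<partial>M) \<le> \<delta>" if "1 \<le> k" for k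
          using detects that alarm(2)[OF that] by auto
      qed (use Det in \<open>auto simp: \<Phi>_def detector_def\<close>)
      then have "\<forall>\<^sub>F k in sequentially. (1 - \<delta>) / 2 \<le> exp (real k * (\<epsilon> + e)) * alarm_prob M Det y k"
        using eventually_ge_at_top[of 1] by eventually_elim (simp add: alarm)
      from limsup_error_exponent_le[OF _ this]
      show "limsup (\<lambda>k. ereal (1 / real k) * neg_log (alarm_prob M Det y k)) \<le> ereal \<epsilon> + ereal e"
        using delta by simp
    qed
  qed
  moreover have "weighted_mse M W xt xht = ereal (trace (P ** W) + real CARD('p) * (D - 1))"
  proof -
    have known_\<phi>: "\<phi>' k \<in> borel_measurable (known (Attacker ` {1..}))" for k
    proof -
      have "(\<lambda>\<omega>. \<phi>' k \<omega> $ i) \<in> borel_measurable (known (Attacker ` {1..}))" for i :: 'm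
        unfolding \<phi>'_def system_output_def vec_lambda_beta
        by (intro borel_measurable_sum borel_measurable_times borel_measurable_const
            borel_measurable_vec_nth
            known_zeta) auto
      then show ?thesis
        by (subst borel_measurable_euclidean_space) (auto simp: Basis_vec_def inner_axis)
    qed
    have sq_\<phi>: "square_integrable M (\<phi>' k)" for k
    proof -
      have "square_integrable M (\<lambda>\<omega>. \<Sum>j\<in>UNIV. \<Sum>n = 1..nat (int k - fls_subdegree (impulse_response
          (G $ i $ j))).
          fls_nth (impulse_response (G $ i $ j)) (int k - int n) * (\<zeta> n \<omega> $ j))" for i :: 'm
        by (intro square_integrable_sum square_integrable_scale square_integrable_component
            normal_vector.square_integrable[OF normal_\<zeta>]) auto
      then show ?thesis unfolding \<phi>'_def[abs_def] system_output_def by (rule square_integrable_vec)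
    qed
    have dev: "dev k \<in> borel_measurable (known (Attacker ` {1..})) \<and> square_integrable M (dev k)"
        for k
    proof (induction k)
      case 0
      then show ?case by (simp add: dev_simps square_integrable_zero)
    next
      case (Suc k)
      then show ?case unfolding dev_simps
        by (intro conjI borel_measurable_add borel_measurable_matrix_vector_mult known_\<phi>
            square_integrable_add square_integrable_matrix sq_\<phi>) auto
    qed
    have sq_s: "square_integrable M s"
      unfolding s_def[abs_def]
      by (intro square_integrable_sum square_integrable_matrix normal_vector.square_integrable[OF
          normal_\<zeta>]) simp
    have "\<exists>b. \<forall>n\<ge>1. \<bar>expectation (\<lambda>\<omega>. (err n \<omega> + f n \<omega>) \<bullet> (W *v (err n \<omega> + f n \<omega>))) -
        (trace (P ** W) + real CARD('p) * (D - 1))\<bar> \<le> b * \<gamma> ^ (n - 1)"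
    proof (rule mean_square_error[where g=g, OF _ _ _ _ sq_s c0 c(2) less_imp_le[OF c(3)] W])
      fix n :: nat
      show "f n \<in> borel_measurable (known (Attacker ` {1..}))" "square_integrable M (f n)"
        using dev by (simp_all add: f_def)
      show "C *v f n \<omega> = \<zeta> n \<omega> - g n \<omega>" if "1 \<le> n" for \<omega> using that by (rule Cf)
      show "norm (g n \<omega>) \<le> c0 * \<gamma> ^ (n - 1) * norm (s \<omega>)" for \<omega> unfolding g_def by (rule decay)
    qed
    then obtain b where b: "\<And>n. 1 \<le> n \<Longrightarrow> \<bar>expectation (\<lambda>\<omega>. (err n \<omega> + f n \<omega>) \<bullet> (W *v (err n \<omega> + f n
        \<omega>))) -
        (trace (P ** W) + real CARD('p) * (D - 1))\<bar> \<le> b * \<gamma> ^ (n - 1)"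
      by blast
    define t where "t = trace (P ** W) + real CARD('p) * (D - 1)"
    define q where "q n = trace (error_cov M xt xht n ** W)" for n
    have q: "\<bar>q n - t\<bar> \<le> b * \<gamma> ^ (n - 1)" if n: "1 \<le> n" for n
    proof -
      have "error_cov M xt xht n = (\<integral>\<omega>. outer (err n \<omega> + f n \<omega>) (err n \<omega> + f n \<omega>) \<partial>M)"
        unfolding error_cov_def
      proof (intro Bochner_Integration.integral_cong refl)
        fix \<omega> assume "\<omega> \<in> space M"
        then have "xht n \<omega> - xt n \<omega> = - (err n \<omega> + f n \<omega>)"
          using attacked_err(1)[OF _ n] by (metis minus_diff_eq)
        then show "outer (xht n \<omega> - xt n \<omega>) (xht n \<omega> - xt n \<omega>) = outer (err n \<omega> + f n \<omega>) (err n \<omega>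
            + f n \<omega>)"
          by (simp only: outer_uminus)
      qed
      moreover have "square_integrable M (\<lambda>\<omega>. err n \<omega> + f n \<omega>)"
        using dev by (intro square_integrable_add normal_vector.square_integrable[OF normal_err[OF
            n]]) (simp add: f_def)
      ultimately show ?thesis using b[OF n] by (simp add: q_def t_def trace_error_cov)
    qed
    have "(\<lambda>k. 1 / real k * (\<Sum>n=1..k. t + (q n - t))) \<longlonglongrightarrow> t"
      by (rule cesaro_geometric[OF q c(2,3)])
    then have "(\<lambda>k. 1 / real k * (\<Sum>n=1..k. q n)) \<longlonglongrightarrow> t" by simp
    then show ?thesis
      unfolding weighted_mse_def q_def[symmetric] t_def[symmetric]
      by (intro lim_imp_Limsup tendsto_ereal) simp
  qed
  ultimately show ?thesis by (simp add: D_def)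
qed

end
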